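(* Let $\psi\in L^1\cap L^2(\mathbb{R})$ be a (complex-valued) function with $\int_{\mathbb{R}}\psi=0$, and for $j\in\mathbb{Z}$ let $\psi_j(t)=2^{-j}\psi(2^{-j}t)$, so that $\hat\psi_j(\omega)=\hat\psi(2^j\omega)$. Assume: (i) for all $\omega\in\mathbb{R}$, $$\frac12\sum_{j\in\mathbb{Z}}\left(|\hat\psi_j(\omega)|^2+|\hat\psi_j(-\omega)|^2\right)\le 1;$$ (ii) for all $j\in\mathbb{Z}$ and all $\omega>0$, $|\hat\psi_j(-\omega)|\le|\hat\psi_j(\omega)|$, and for every $\omega>0$ the inequality is strict for at least one value of $j$; (iii) for some $\epsilon>0$, $\hat\psi(\omega)=O(|\omega|^{1+\epsilon})$ when $\omega\to0$. Then for any $J\in\mathbb{Z}$ there exist $r>0$ and $a>1$ such that, for all $n\ge 2$ and all real-valued $f\in L^2(\mathbb{R})$, $$\sum_{p\in\mathcal{P}_J,\,|p|=n}\|U[p]f\|_2^2\;\le\;\|f\|_2^2-\|f\star\chi_{ra^n}\|_2^2=\int_{\mathbb{R}}|\hat f(\omega)|^2\left(1-|\hat\chi_{ra^n}(\omega)|^2\right)d\omega .$$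
   Context: Fourier transform convention: $\hat f(\omega)=\int_{\mathbb{R}}f(t)e^{-2\pi i\omega t}dt$; $\star$ denotes convolution on $\mathbb{R}$. For $a>0$, $\chi_a$ is the Gaussian $\chi_a(t)=\sqrt{\pi}\,a\exp(-(\pi a)^2t^2)$, whose Fourier transform is $\hat\chi_a(\omega)=\exp(-(\omega/a)^2)$. For $J\in\mathbb{Z}$, $\mathcal{P}_J$ is the set of all finite sequences ("paths") $p=(j_1,\dots,j_n)$, $n\in\mathbb{N}$, of integers $j_1,\dots,j_n\le J$; $|p|=n$ denotes the length of $p$. For $f\in L^2(\mathbb{R})$, $U[\emptyset]f=f$ and, iteratively for $n\ge1$, $U[(j_1,\dots,j_n)]f=\big|U[(j_1,\dots,j_{n-1})]f\star\psi_{j_n}\big|$ (pointwise modulus). *)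

theory Defs
  imports "HOL-Analysis.Analysis" "HOL-Library.Landau_Symbols"
begin

(* Elements of L^2(R) are represented by Borel measurable functions; every L^2 class has
   such a representative. *)
definition square_integrable :: "(real \<Rightarrow> complex) \<Rightarrow> bool" where
  "square_integrable f \<longleftrightarrow>
     f \<in> borel_measurable lborel \<and> integrable lborel (\<lambda>t. (cmod (f t))\<^sup>2)"

(* Only meaningful for square integrable functions. *)
definition L2norm :: "(real \<Rightarrow> complex) \<Rightarrow> real" where
  "L2norm f = sqrt (LINT t|lborel. (cmod (f t))\<^sup>2)"

definition convolution :: "(real \<Rightarrow> complex) \<Rightarrow> (real \<Rightarrow> complex) \<Rightarrow> real \<Rightarrow> complex"
    (infixl "\<star>" 75) where
  "f \<star> g = (\<lambda>t. LINT s|lborel. f s * g (t - s))"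

(* The pointwise Fourier integral, for functions in L^1(R). *)
definition fourier :: "(real \<Rightarrow> complex) \<Rightarrow> real \<Rightarrow> complex" where
  "fourier f \<omega> = (LINT t|lborel. f t * exp (- 2 * complex_of_real pi * \<i> * complex_of_real \<omega> * complex_of_real t))"

(* The Fourier-Plancherel transform on L^2(R): the limit in L^2 of the Fourier integrals of the
   truncations of f to [-N, N]. The limit is unique up to null sets, and the choice operator
   picks one of its representatives. *)
definition fourier_L2 :: "(real \<Rightarrow> complex) \<Rightarrow> real \<Rightarrow> complex" where
  "fourier_L2 f = (SOME g. square_integrable g \<and>
     (\<lambda>N::nat. L2norm (\<lambda>\<omega>. fourier (\<lambda>t. indicator {- real N..real N} t * f t) \<omega> - g \<omega>))
       \<longlonglongrightarrow> 0)"

definition gaussian :: "real \<Rightarrow> real \<Rightarrow> complex" where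
  "gaussian a t = complex_of_real (sqrt pi * a * exp (- ((pi * a)\<^sup>2 * t\<^sup>2)))"

definition dilate :: "(real \<Rightarrow> complex) \<Rightarrow> int \<Rightarrow> real \<Rightarrow> complex" where
  "dilate \<psi> j t = complex_of_real (2 powi (- j)) * \<psi> (2 powi (- j) * t)"

definition paths :: "int \<Rightarrow> int list set" where
  "paths J = {p. \<forall>j\<in>set p. j \<le> J}"

definition scatter :: "(real \<Rightarrow> complex) \<Rightarrow> int list \<Rightarrow> (real \<Rightarrow> complex) \<Rightarrow> real \<Rightarrow> complex" where
  "scatter \<psi> p f = foldl (\<lambda>g j t. complex_of_real (cmod ((g \<star> dilate \<psi> j) t))) f p"

lemma scatter_Nil: "scatter \<psi> [] f = f"
  by (simp add: scatter_def)

lemma scatter_snoc: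
  "scatter \<psi> (p @ [j]) f = (\<lambda>t. complex_of_real (cmod ((scatter \<psi> p f \<star> dilate \<psi> j) t)))"
  by (simp add: scatter_def)

end

theory Submission
  imports Defs "HOL-Probability.Characteristic_Functions"
begin

text \<open>
  Write \<open>F\<close> for the Fourier transform. If \<open>k\<close> is a weight with nonnegative transform, then for every
  shift \<open>\<eta>\<close> the integral of \<open>|F u(\<omega>)|\<^sup>2 k(\<omega> - \<eta>)\<close> is at most that of \<open>|F|u|(\<omega>)|\<^sup>2 k(\<omega>)\<close>: both are
  quadratic forms in the time domain, and the shift is a phase factor there. Apply this to the
  Gaussian weight \<open>k(\<omega>) = exp (- 2 \<omega>\<^sup>2 / x\<^sup>2)\<close> and to each \<open>u = f \<star> \<psi>\<^sub>j\<close>, with the shift \<open>\<eta>\<close> equal to \<open>\<delta>\<close> times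
  the \<open>(-j)\<close>-th power of \<open>2\<close>. As \<open>f\<close> is real, its spectrum is even; by concavity of \<open>1 - exp (- y)\<close> the
  resulting weight on \<open>|F f|\<^sup>2\<close> is at most \<open>1 - exp (- 2 Q(\<omega>) / x\<^sup>2)\<close>, where \<open>Q(\<omega>)\<close> averages \<open>(\<omega> - \<eta>)\<^sup>2\<close>
  and \<open>(\<omega> + \<eta>)\<^sup>2\<close> against the Littlewood-Paley sum. Positive frequencies dominate in \<open>F \<psi>\<close>, so
  for small \<open>\<delta>\<close> we have \<open>Q(\<omega>) \<le> \<omega>\<^sup>2 / a\<^sup>2\<close> with some \<open>a > 1\<close> independent of \<open>x\<close>, and every layer
  multiplies the scale \<open>x\<close> by \<open>a\<close>. The induction starts with two layers: there \<open>k\<close> is a compactly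
  supported weight below one minus the Littlewood-Paley sum over \<open>j \<le> J\<close>, and the shift is averaged
  against a Gaussian.
\<close>

section \<open>Square integrable functions\<close>

text \<open>With u = 2 powi j * \<omega> the shift \<open>\<delta> * 2 powi (- j)\<close> equals
  \<omega> * (\<delta> / u), so its relative effect is unchanged when \<omega> is multiplied by a
  power of 2. Let A and B be the squared moduli of the transform of the wavelet at u and -u. In
  units of \<omega>^2, the shift gains 2 \<delta> (A - B) / u to first order and costs \<delta>^2 (A
  + B) / u^2. The exponent 1 + \<epsilon> makes the cost summable over the scales; the strict
  asymmetry, made uniform by compactness of one octave, bounds the gain from below. Hence a small
  \<delta> wins. Two layers are the starting point because the weight after one layer, the
  Littlewood-Paley sum over j \<le> J, may reach 1 at some frequency, which a Gaussian complement 1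
  - exp (- 2 (\<omega> / x)^2) never does. The second layer contributes a factor 1 - k' with k'
  above a multiple of a Gaussian, which opens a gap at high frequencies. At low frequencies the
  restriction j \<le> J makes the sum O(\<omega>^2). The estimates concern finite sets of scales and
  real signals in both L^1 and L^2, where the Fourier integral is pointwise; general signals are
  reached by truncation.\<close>

lemma square_integrable_measurable [measurable_dest]:
  "square_integrable f \<Longrightarrow> f \<in> borel_measurable lborel"
  by (simp add: square_integrable_def)

lemma L2norm_nonneg [simp]: "0 \<le> L2norm f"
  by (simp add: L2norm_def)

lemma L2norm_square: "(L2norm f)\<^sup>2 = (LINT t|lborel. (cmod (f t))\<^sup>2)"
  by (simp add: L2norm_def)

lemma square_integrable_bound:
  assumes "f \<in> borel_measurable lborel" "square_integrable g" "\<And>t. cmod (f t) \<le> C * cmod (g t)"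
  shows "square_integrable f"
  unfolding square_integrable_def
proof
  show "integrable lborel (\<lambda>t. (cmod (f t))\<^sup>2)"
  proof (rule Bochner_Integration.integrable_bound)
    show "integrable lborel (\<lambda>t. C\<^sup>2 * (cmod (g t))\<^sup>2)"
      using assms(2) by (simp add: square_integrable_def)
    show "AE t in lborel. norm ((cmod (f t))\<^sup>2) \<le> norm (C\<^sup>2 * (cmod (g t))\<^sup>2)"
      using power_mono[OF assms(3) norm_ge_zero, of _ 2] by (simp add: power_mult_distrib)
  qed (use assms(1) in measurable)
qed fact

lemma square_integrable_mult_integrable:
  assumes "square_integrable f" "square_integrable g"
  shows "integrable lborel (\<lambda>t. f t * g t)"
proof (rule Bochner_Integration.integrable_bound)
  show "integrable lborel (\<lambda>t. (cmod (f t))\<^sup>2 + (cmod (g t))\<^sup>2)"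
    using assms by (simp add: square_integrable_def)
  have "a * b \<le> a\<^sup>2 + b\<^sup>2" if "0 \<le> a" "0 \<le> b" for a b :: real
    using sum_squares_bound[of a b] mult_nonneg_nonneg[OF that] by linarith
  then show "AE t in lborel. norm (f t * g t) \<le> norm ((cmod (f t))\<^sup>2 + (cmod (g t))\<^sup>2)"
    by (simp add: norm_mult)
qed (use assms in measurable)

lemma square_integrable_cnj: "square_integrable f \<Longrightarrow> square_integrable (\<lambda>t. cnj (f t))"
  by (simp add: square_integrable_def borel_measurable_continuous_on)

lemma square_integrable_cmod: "square_integrable f \<Longrightarrow> square_integrable (\<lambda>t. complex_of_real (cmod (f t)))"
  unfolding square_integrable_def by auto

lemma L2norm_cmod: "L2norm (\<lambda>t. complex_of_real (cmod (f t))) = L2norm f"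
  by (simp add: L2norm_def)

lemma square_integrable_add:
  assumes "square_integrable f" "square_integrable g"
  shows "square_integrable (\<lambda>t. f t + g t)"
  unfolding square_integrable_def
proof
  show "integrable lborel (\<lambda>t. (cmod (f t + g t))\<^sup>2)"
  proof (rule Bochner_Integration.integrable_bound)
    show "integrable lborel (\<lambda>t. 2 * (cmod (f t))\<^sup>2 + 2 * (cmod (g t))\<^sup>2)"
      using assms by (simp add: square_integrable_def)
    have "(cmod (a + b))\<^sup>2 \<le> 2 * (cmod a)\<^sup>2 + 2 * (cmod b)\<^sup>2" for a b
      using power_mono[OF norm_triangle_ineq norm_ge_zero, of a b 2] sum_squares_bound[of "cmod a" "cmod b"]
      by (simp add: power2_sum)
    then show "AE t in lborel. norm ((cmod (f t + g t))\<^sup>2) \<le> norm (2 * (cmod (f t))\<^sup>2 + 2 * (cmod (g t))\<^sup>2)"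
      by simp
  qed (use assms in measurable)
qed (use assms in measurable)

lemma square_integrable_minus: "square_integrable f \<Longrightarrow> square_integrable (\<lambda>t. - f t)"
  by (simp add: square_integrable_def)

lemma square_integrable_diff:
  "square_integrable f \<Longrightarrow> square_integrable g \<Longrightarrow> square_integrable (\<lambda>t. f t - g t)"
  using square_integrable_add[OF _ square_integrable_minus, of f g] by simp

lemma Cauchy_Schwarz_L2:
  assumes "square_integrable f" "square_integrable g"
  shows "(LINT t|lborel. cmod (f t) * cmod (g t)) \<le> L2norm f * L2norm g"
proof -
  have int: "integrable lborel (\<lambda>t. cmod (f t) * cmod (g t))"
    using integrable_norm[OF square_integrable_mult_integrable[OF assms]] by (simp add: norm_mult)
  have [measurable]: "f \<in> borel_measurable lborel" "g \<in> borel_measurable lborel"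
    using assms by (auto simp: square_integrable_def)
  have "(\<integral>\<^sup>+t. ennreal (cmod (f t)) * ennreal (cmod (g t)) \<partial>lborel)\<^sup>2
      \<le> (\<integral>\<^sup>+t. ennreal (cmod (f t)) ^ 2 \<partial>lborel) * (\<integral>\<^sup>+t. ennreal (cmod (g t)) ^ 2 \<partial>lborel)"
    by (rule Cauchy_Schwarz_nn_integral) measurable
  then have "(ennreal (LINT t|lborel. cmod (f t) * cmod (g t)))\<^sup>2
      \<le> ennreal (LINT t|lborel. (cmod (f t))\<^sup>2) * ennreal (LINT t|lborel. (cmod (g t))\<^sup>2)"
    using int assms by (simp add: ennreal_power nn_integral_eq_integral square_integrable_def flip: ennreal_mult)
  then have "(LINT t|lborel. cmod (f t) * cmod (g t))\<^sup>2 \<le> (L2norm f * L2norm g)\<^sup>2"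
    by (simp add: power_mult_distrib L2norm_square ennreal_power flip: ennreal_mult)
  then show ?thesis
    by (rule power2_le_imp_le) simp
qed

lemma L2norm_triangle:
  assumes "square_integrable f" "square_integrable g"
  shows "L2norm (\<lambda>t. f t + g t) \<le> L2norm f + L2norm g"
proof (rule power2_le_imp_le)
  have i: "integrable lborel (\<lambda>t. cmod (f t) * cmod (g t))"
    using integrable_norm[OF square_integrable_mult_integrable[OF assms]] by (simp add: norm_mult)
  have "(LINT t|lborel. (cmod (f t + g t))\<^sup>2)
      \<le> (LINT t|lborel. (cmod (f t))\<^sup>2 + (cmod (g t))\<^sup>2 + 2 * (cmod (f t) * cmod (g t)))"
    using square_integrable_add[OF assms] assms i
      power_mono[OF norm_triangle_ineq norm_ge_zero, of "f _" "g _" 2]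
    by (intro integral_mono) (auto simp: square_integrable_def power2_sum algebra_simps)
  also have "\<dots> = (L2norm f)\<^sup>2 + (L2norm g)\<^sup>2 + 2 * (LINT t|lborel. cmod (f t) * cmod (g t))"
    using assms i by (simp add: L2norm_square square_integrable_def)
  also have "\<dots> \<le> (L2norm f + L2norm g)\<^sup>2"
    using Cauchy_Schwarz_L2[OF assms] by (simp add: power2_sum)
  finally show "(L2norm (\<lambda>t. f t + g t))\<^sup>2 \<le> (L2norm f + L2norm g)\<^sup>2"
    by (simp add: L2norm_square)
qed simp

lemma L2norm_minus_commute: "L2norm (\<lambda>t. f t - g t) = L2norm (\<lambda>t. g t - f t)"
  by (simp add: L2norm_def norm_minus_commute)

lemma L2norm_diff_triangle:
  assumes "square_integrable f" "square_integrable g"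
  shows "\<bar>L2norm f - L2norm g\<bar> \<le> L2norm (\<lambda>t. f t - g t)"
  using L2norm_triangle[OF square_integrable_diff[OF assms] assms(2)]
    L2norm_triangle[OF square_integrable_diff[OF assms(2,1)] assms(1)]
  by (simp add: L2norm_minus_commute[of f g])

lemma L2norm_tendsto:
  assumes "\<And>n. square_integrable (f n)" "square_integrable g"
    and "(\<lambda>n. L2norm (\<lambda>t. f n t - g t)) \<longlonglongrightarrow> 0"
  shows "(\<lambda>n. L2norm (f n)) \<longlonglongrightarrow> L2norm g"
proof (rule LIM_zero_cancel, rule Lim_null_comparison[OF _ assms(3)])
  show "\<forall>\<^sub>F n in sequentially. norm (L2norm (f n) - L2norm g) \<le> L2norm (\<lambda>t. f n t - g t)"
    using L2norm_diff_triangle[OF assms(1,2)] by simp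
qed

lemma L2norm_mono:
  assumes "f \<in> borel_measurable lborel" "square_integrable g" "\<And>t. cmod (f t) \<le> cmod (g t)"
  shows "L2norm f \<le> L2norm g"
proof -
  have "square_integrable f"
    using square_integrable_bound[of f g 1] assms by simp
  then show ?thesis
    unfolding L2norm_def
    using assms by (intro real_sqrt_le_mono integral_mono power_mono) (auto simp: square_integrable_def)
qed

text \<open>This is the cut-off from the definition of \<open>fourier_L2\<close>. It turns square
  integrable functions into integrable ones and keeps real values real, so estimates for integrable
  signals transfer by letting N grow.\<close>

abbreviation truncate :: "nat \<Rightarrow> (real \<Rightarrow> complex) \<Rightarrow> real \<Rightarrow> complex" where
  "truncate N f \<equiv> (\<lambda>t. indicator {- real N..real N} t * f t)"

lemma square_integrable_truncate:
  assumes "square_integrable f" shows "square_integrable (truncate N f)"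
  by (rule square_integrable_bound[OF _ assms, of _ 1])
    (use assms in \<open>auto simp: square_integrable_def indicator_def\<close>)

lemma integrable_truncate:
  assumes "square_integrable f" shows "integrable lborel (truncate N f)"
proof (rule square_integrable_mult_integrable[OF _ assms])
  show "square_integrable (indicator {- real N..real N})"
    unfolding square_integrable_def
  proof
    have "(cmod (indicator {- real N..real N} t))\<^sup>2 = indicator {- real N..real N} t" for t
      by (simp add: indicator_def)
    then show "integrable lborel (\<lambda>t. (cmod (indicator {- real N..real N} t))\<^sup>2)"
      by (simp only:) simp
  qed simp
qed

lemma truncate_tendsto_L2:
  assumes "square_integrable f"
  shows "(\<lambda>N. L2norm (\<lambda>t. truncate N f t - f t)) \<longlonglongrightarrow> 0"
proof -
  have [measurable]: "f \<in> borel_measurable lborel"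
    using assms by (simp add: square_integrable_def)
  have "(\<lambda>N. LINT t|lborel. (cmod (truncate N f t - f t))\<^sup>2) \<longlonglongrightarrow> (LINT t|(lborel :: real measure). (0::real))"
  proof (rule integral_dominated_convergence[where f = "\<lambda>t. 0"
        and s = "\<lambda>N t. (cmod (truncate N f t - f t))\<^sup>2" and w = "\<lambda>t. (cmod (f t))\<^sup>2"])
    show "integrable lborel (\<lambda>t. (cmod (f t))\<^sup>2)"
      using assms by (simp add: square_integrable_def)
    show "AE t in lborel. (\<lambda>N. (cmod (truncate N f t - f t))\<^sup>2) \<longlonglongrightarrow> 0"
    proof (rule AE_I2, rule tendsto_eventually)
      fix t
      obtain M where "\<bar>t\<bar> \<le> real M"
        using real_arch_simple by blast
      then show "\<forall>\<^sub>F N in sequentially. (cmod (truncate N f t - f t))\<^sup>2 = 0"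
        unfolding eventually_sequentially by (intro exI[of _ M]) (auto simp: indicator_def)
    qed
    show "AE t in lborel. norm ((cmod (truncate N f t - f t))\<^sup>2) \<le> (cmod (f t))\<^sup>2" for N
      by (auto simp: indicator_def)
  qed measurable
  from tendsto_real_sqrt[OF this] show ?thesis
    by (simp add: L2norm_def)
qed

lemma square_integrable_affine:
  assumes "square_integrable f" "c \<noteq> 0" shows "square_integrable (\<lambda>t. f (a + c * t))"
  using assms lborel_integrable_real_affine[of "\<lambda>t. (cmod (f t))\<^sup>2" c a]
  by (auto simp: square_integrable_def)

lemma square_integrable_reflect:
  "square_integrable f \<Longrightarrow> square_integrable (\<lambda>s. f (t - s))"
  using square_integrable_affine[of f "-1" t] by simp

section \<open>Convolution\<close>

lemma convolution_measurable [measurable]: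
  assumes [measurable]: "f \<in> borel_measurable lborel" "g \<in> borel_measurable lborel"
  shows "f \<star> g \<in> borel_measurable lborel"
  unfolding Defs.convolution_def by measurable

text \<open>Write the modulus of \<open>g\<close> as a product of two square roots and apply
  Cauchy-Schwarz at each t: the squared convolution is at most A times the convolution of the
  squared modulus of \<open>f\<close> with the modulus of \<open>g\<close>. Tonelli then yields the
  second factor A.\<close>

lemma Young_L2:
  assumes f: "square_integrable f" and g: "integrable lborel g"
  shows "square_integrable (f \<star> g)" and "L2norm (f \<star> g) \<le> (LINT t|lborel. cmod (g t)) * L2norm f"
proof -
  define A where "A = (LINT t|lborel. cmod (g t))"
  have A0: "0 \<le> A" by (simp add: A_def)
  have [measurable]: "f \<in> borel_measurable borel" "g \<in> borel_measurable borel"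
    using f g by (auto simp: square_integrable_def)
  have Ag: "(\<integral>\<^sup>+s. ennreal (cmod (g (t - s))) \<partial>lborel) = ennreal A" for t
    using nn_integral_real_affine[of "\<lambda>s. ennreal (cmod (g s))" "-1" t] integrable_norm[OF g]
    by (simp add: A_def nn_integral_eq_integral)
  have Ag': "(\<integral>\<^sup>+t. ennreal (cmod (g (t - s))) \<partial>lborel) = ennreal A" for s
    using nn_integral_real_affine[of "\<lambda>s. ennreal (cmod (g s))" "1" "-s"] integrable_norm[OF g]
    by (simp add: A_def nn_integral_eq_integral)
  have pt: "ennreal ((cmod ((f \<star> g) t))\<^sup>2)
      \<le> ennreal A * (\<integral>\<^sup>+s. ennreal ((cmod (f s))\<^sup>2 * cmod (g (t - s))) \<partial>lborel)" for t
  proof (cases "integrable lborel (\<lambda>s. f s * g (t - s))")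
    \<comment> \<open>Where the product is not integrable, the Bochner integral defaults to 0 and
      the bound is trivial; the estimate thus holds at every t.\<close>
    case False
    then have "(f \<star> g) t = 0"
      by (simp add: Defs.convolution_def not_integrable_integral_eq)
    then show ?thesis by simp
  next
    case True
    have "ennreal (cmod ((f \<star> g) t)) \<le> (\<integral>\<^sup>+s. ennreal (cmod (f s * g (t - s))) \<partial>lborel)"
      using integral_norm_bound_ennreal[OF True] by (simp add: Defs.convolution_def)
    also have "\<dots> = (\<integral>\<^sup>+s. ennreal (cmod (f s) * sqrt (cmod (g (t - s)))) * ennreal (sqrt (cmod (g (t - s)))) \<partial>lborel)"
      by (intro nn_integral_cong) (simp add: norm_mult mult.assoc flip: ennreal_mult)
    finally have "(ennreal (cmod ((f \<star> g) t)))\<^sup>2 \<le> (\<integral>\<^sup>+s. ennreal (cmod (f s) * sqrt (cmod (g (t - s)))) * ennreal (sqrt (cmod (g (t - s)))) \<partial>lborel)\<^sup>2"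
      by (rule power_mono) simp
    also have "\<dots> \<le> (\<integral>\<^sup>+s. (ennreal (cmod (f s) * sqrt (cmod (g (t - s)))))\<^sup>2 \<partial>lborel)
        * (\<integral>\<^sup>+s. (ennreal (sqrt (cmod (g (t - s)))))\<^sup>2 \<partial>lborel)"
      by (rule Cauchy_Schwarz_nn_integral) measurable
    also have "\<dots> = (\<integral>\<^sup>+s. ennreal ((cmod (f s))\<^sup>2 * cmod (g (t - s))) \<partial>lborel) * ennreal A"
      by (simp add: ennreal_power power_mult_distrib Ag)
    finally show ?thesis
      by (simp add: ennreal_power mult.commute)
  qed
  have int_f: "(\<integral>\<^sup>+s. ennreal ((cmod (f s))\<^sup>2) \<partial>lborel) = ennreal ((L2norm f)\<^sup>2)"
    using f by (simp add: nn_integral_eq_integral square_integrable_def L2norm_square)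
  have "(\<integral>\<^sup>+t. ennreal ((cmod ((f \<star> g) t))\<^sup>2) \<partial>lborel)
     \<le> (\<integral>\<^sup>+t. ennreal A * (\<integral>\<^sup>+s. ennreal ((cmod (f s))\<^sup>2 * cmod (g (t - s))) \<partial>lborel) \<partial>lborel)"
    by (intro nn_integral_mono pt)
  also have "\<dots> = ennreal A * (\<integral>\<^sup>+t. \<integral>\<^sup>+s. ennreal ((cmod (f s))\<^sup>2 * cmod (g (t - s))) \<partial>lborel \<partial>lborel)"
    by (rule nn_integral_cmult) measurable
  also have "(\<integral>\<^sup>+t. \<integral>\<^sup>+s. ennreal ((cmod (f s))\<^sup>2 * cmod (g (t - s))) \<partial>lborel \<partial>lborel)
     = (\<integral>\<^sup>+s. \<integral>\<^sup>+t. ennreal ((cmod (f s))\<^sup>2 * cmod (g (t - s))) \<partial>lborel \<partial>lborel)"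
    by (rule lborel_pair.Fubini') measurable
  also have "\<dots> = (\<integral>\<^sup>+s. ennreal ((cmod (f s))\<^sup>2) * ennreal A \<partial>lborel)"
  proof (intro nn_integral_cong)
    fix s
    have "(\<integral>\<^sup>+t. ennreal ((cmod (f s))\<^sup>2 * cmod (g (t - s))) \<partial>lborel)
      = ennreal ((cmod (f s))\<^sup>2) * (\<integral>\<^sup>+t. ennreal (cmod (g (t - s))) \<partial>lborel)"
      by (simp add: ennreal_mult nn_integral_cmult)
    then show "(\<integral>\<^sup>+t. ennreal ((cmod (f s))\<^sup>2 * cmod (g (t - s))) \<partial>lborel) = ennreal ((cmod (f s))\<^sup>2) * ennreal A"
      by (simp add: Ag')
  qed
  also have "\<dots> = ennreal ((L2norm f)\<^sup>2) * ennreal A"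
    by (subst nn_integral_multc) (auto simp: int_f)
  finally have fin: "(\<integral>\<^sup>+t. ennreal ((cmod ((f \<star> g) t))\<^sup>2) \<partial>lborel) \<le> ennreal ((A * L2norm f)\<^sup>2)"
    using A0 by (simp add: power_mult_distrib power2_eq_square mult_ac flip: ennreal_mult)
  show sq: "square_integrable (f \<star> g)"
    unfolding square_integrable_def
  proof
    show "integrable lborel (\<lambda>t. (cmod ((f \<star> g) t))\<^sup>2)"
      using fin by (intro integrableI_bounded) (auto simp: le_less_trans)
  qed measurable
  have "ennreal ((L2norm (f \<star> g))\<^sup>2) \<le> ennreal ((A * L2norm f)\<^sup>2)"
    using fin sq by (simp add: nn_integral_eq_integral square_integrable_def L2norm_square)
  then have "(L2norm (f \<star> g))\<^sup>2 \<le> (A * L2norm f)\<^sup>2"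
    by simp
  then show "L2norm (f \<star> g) \<le> (LINT t|lborel. cmod (g t)) * L2norm f"
    unfolding A_def by (rule power2_le_imp_le) (simp add: A0[unfolded A_def])
qed

text \<open>Square integrability of \<open>g\<close> makes each integrand integrable at every point,
  so the identity holds pointwise and not merely almost everywhere.\<close>

lemma convolution_diff_left:
  assumes "square_integrable f" "square_integrable f'" "square_integrable g"
  shows "((\<lambda>t. f t - f' t) \<star> g) = (\<lambda>t. (f \<star> g) t - (f' \<star> g) t)"
  unfolding Defs.convolution_def
  using square_integrable_mult_integrable[OF _ square_integrable_reflect[OF assms(3)]] assms
  by (auto simp: algebra_simps)

lemma integrable_convolution_prod:
  fixes f g :: "real \<Rightarrow> complex"
  assumes f: "integrable lborel f" and g: "integrable lborel g"
  shows "integrable (lborel \<Otimes>\<^sub>M lborel) (\<lambda>(t, s). f s * g (t - s))"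
proof -
  have [measurable]: "f \<in> borel_measurable borel" "g \<in> borel_measurable borel"
    using f g by auto
  have "integrable (lborel \<Otimes>\<^sub>M lborel) (\<lambda>(s, t). f s * g (t - s))"
  proof (rule lborel_pair.Fubini_integrable)
    have eq: "(LINT t|lborel. norm (case (s, t) of (s, t) \<Rightarrow> f s * g (t - s)))
        = cmod (f s) * (LINT t|lborel. cmod (g t))" for s
      using lborel_integral_real_affine[of 1 "\<lambda>t. cmod (g t)" "-s"] by (simp add: norm_mult)
    show "integrable lborel (\<lambda>s. LINT t|lborel. norm (case (s, t) of (s, t) \<Rightarrow> f s * g (t - s)))"
      unfolding eq using f by simp
    show "AE s in lborel. integrable lborel (\<lambda>t. case (s, t) of (s, t) \<Rightarrow> f s * g (t - s))"
      using lborel_integrable_real_affine[OF g, of 1 "- _"] by simp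
  qed measurable
  from lborel_pair.integrable_product_swap[OF this] show ?thesis
    by (simp add: case_prod_beta)
qed

lemma integrable_convolution:
  assumes "integrable lborel f" "integrable lborel g"
  shows "integrable lborel (f \<star> g)"
  using lborel_pair.integrable_fst[OF integrable_convolution_prod[OF assms]]
  by (simp add: Defs.convolution_def)

section \<open>The Fourier integral\<close>

lemma fourier_cis: "fourier f \<omega> = (LINT t|lborel. f t * cis (- (2 * pi * \<omega> * t)))"
  unfolding fourier_def by (intro Bochner_Integration.integral_cong) (simp_all add: cis_conv_exp mult_ac)

lemma cis_measurable [measurable]:
  "h \<in> borel_measurable M \<Longrightarrow> (\<lambda>x. cis (h x)) \<in> borel_measurable M"
  by (rule borel_measurable_continuous_onI[THEN measurable_compose_rev])
    (intro continuous_intros)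

lemma integrable_mult_bounded:
  fixes f g :: "'a \<Rightarrow> complex"
  assumes "integrable M f" "g \<in> borel_measurable M" "\<And>x. cmod (g x) \<le> B"
  shows "integrable M (\<lambda>x. f x * g x)"
proof (rule Bochner_Integration.integrable_bound)
  show "integrable M (\<lambda>x. B * cmod (f x))"
    using assms(1) by simp
  have "0 \<le> B" using assms(3) norm_ge_zero order_trans by blast
  then show "AE x in M. norm (f x * g x) \<le> norm (B * cmod (f x))"
    using mult_right_mono[OF assms(3) norm_ge_zero] by (auto simp: norm_mult mult_ac)
qed (use assms in measurable)

lemma integrable_mult_cis:
  fixes f :: "real \<Rightarrow> complex"
  assumes "integrable lborel f" shows "integrable lborel (\<lambda>t. f t * cis (a * t))"
  by (rule integrable_mult_bounded[OF assms, of _ 1]) auto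

lemma integrable_fourier: "integrable lborel f \<Longrightarrow> integrable lborel (\<lambda>t. f t * cis (- (2 * pi * \<omega> * t)))"
  using integrable_mult_cis[of f "- (2 * pi * \<omega>)"] by simp

lemma fourier_le:
  shows "cmod (fourier f \<omega>) \<le> (LINT t|lborel. cmod (f t))"
  unfolding fourier_cis by (rule order_trans[OF integral_norm_bound]) (simp add: norm_mult)

lemma fourier_0: "fourier f 0 = (LINT t|lborel. f t)"
  by (simp add: fourier_cis)

lemma continuous_fourier:
  assumes "integrable lborel f" shows "continuous_on UNIV (fourier f)"
proof (unfold continuous_on_sequentially, safe)
  fix X :: "nat \<Rightarrow> real" and \<omega> assume X: "X \<longlonglongrightarrow> \<omega>"
  have "(\<lambda>n. LINT t|lborel. f t * cis (- (2 * pi * X n * t))) \<longlonglongrightarrow> (LINT t|lborel. f t * cis (- (2 * pi * \<omega> * t)))"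
  proof (rule integral_dominated_convergence)
    show "integrable lborel (\<lambda>t. cmod (f t))" using assms by simp
    show "AE t in lborel. (\<lambda>n. f t * cis (- (2 * pi * X n * t))) \<longlonglongrightarrow> f t * cis (- (2 * pi * \<omega> * t))"
      using X by (intro AE_I2 tendsto_intros)
  qed (use assms in \<open>auto simp: norm_mult\<close>)
  then show "(fourier f \<circ> X) \<longlonglongrightarrow> fourier f \<omega>"
    by (simp add: fourier_cis o_def)
qed

lemma fourier_measurable [measurable]:
  "integrable lborel f \<Longrightarrow> fourier f \<in> borel_measurable borel"
  by (simp add: borel_measurable_continuous_onI continuous_fourier)

lemma fourier_diff:
  "integrable lborel f \<Longrightarrow> integrable lborel g \<Longrightarrow> fourier (\<lambda>t. f t - g t) \<omega> = fourier f \<omega> - fourier g \<omega>"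
  by (simp add: fourier_cis left_diff_distrib integrable_fourier)

lemma fourier_cnj: "fourier (\<lambda>t. cnj (f t)) \<omega> = cnj (fourier f (- \<omega>))"
  using Bochner_Integration.integral_cnj[of lborel "\<lambda>t. f t * cis (2 * pi * \<omega> * t)"]
  by (simp add: fourier_cis cis_cnj)

lemma fourier_uminus_real:
  assumes "\<And>t. f t \<in> \<real>" shows "fourier f (- \<omega>) = cnj (fourier f \<omega>)"
  using fourier_cnj[of f "- \<omega>"] assms by (simp add: Reals_cnj_iff)

lemma fourier_shift:
  "fourier (\<lambda>\<omega>. k (\<omega> - \<eta>)) t = cis (- (2 * pi * \<eta> * t)) * fourier k t"
proof -
  have "fourier (\<lambda>\<omega>. k (\<omega> - \<eta>)) t = (LINT \<omega>|lborel. k \<omega> * cis (- (2 * pi * t * (\<eta> + \<omega>))))"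
    unfolding fourier_cis by (subst lborel_integral_real_affine[of 1 _ \<eta>]) auto
  also have "\<dots> = (LINT \<omega>|lborel. cis (- (2 * pi * \<eta> * t)) * (k \<omega> * cis (- (2 * pi * t * \<omega>))))"
    by (intro Bochner_Integration.integral_cong) (simp_all add: cis_mult[symmetric] algebra_simps cis_mult)
  finally show ?thesis by (simp add: fourier_cis)
qed

lemma fourier_scale:
  assumes "c > 0"
  shows "fourier (\<lambda>t. complex_of_real c * f (c * t)) \<omega> = fourier f (\<omega> / c)"
proof -
  have "fourier f (\<omega> / c) = \<bar>c\<bar> *\<^sub>R (LINT t|lborel. f (c * t) * cis (- (2 * pi * \<omega> * t)))"
    unfolding fourier_cis
    by (subst lborel_integral_real_affine[of c _ 0]) (use assms in \<open>auto simp: mult_ac\<close>)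
  then show ?thesis
    using assms by (simp add: fourier_cis scaleR_conv_of_real mult.assoc)
qed

lemma fourier_reflect: "fourier (\<lambda>\<omega>. k (- \<omega>)) t = fourier k (- t)"
  unfolding fourier_cis by (subst lborel_integral_real_affine[of "-1" _ 0]) auto

lemma fourier_convolution:
  assumes f: "integrable lborel f" and g: "integrable lborel g"
  shows "fourier (f \<star> g) \<omega> = fourier f \<omega> * fourier g \<omega>"
proof -
  have [measurable]: "f \<in> borel_measurable borel" "g \<in> borel_measurable borel"
    using f g by auto
  let ?e = "\<lambda>t. cis (- (2 * pi * \<omega> * t))"
  have int: "integrable (lborel \<Otimes>\<^sub>M lborel) (\<lambda>(t, s). f s * g (t - s) * ?e t)"
    using integrable_mult_bounded[OF integrable_convolution_prod[OF f g], of "\<lambda>(t, s). ?e t" 1]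
    by (simp add: case_prod_beta')
  have "fourier (f \<star> g) \<omega> = (LINT t|lborel. LINT s|lborel. f s * g (t - s) * ?e t)"
    by (simp add: fourier_cis Defs.convolution_def)
  also have "\<dots> = (LINT s|lborel. LINT t|lborel. f s * g (t - s) * ?e t)"
    by (rule lborel_pair.Fubini_integral[OF int, symmetric])
  also have "\<dots> = (LINT s|lborel. f s * ?e s * fourier g \<omega>)"
  proof (intro Bochner_Integration.integral_cong refl)
    fix s
    have "(LINT t|lborel. g (t - s) * ?e t) = ?e s * fourier g \<omega>"
      using fourier_shift[of g s \<omega>] by (simp add: fourier_cis mult_ac)
    then show "(LINT t|lborel. f s * g (t - s) * ?e t) = f s * ?e s * fourier g \<omega>"
      by (simp add: mult.assoc)
  qed
  finally show ?thesis by (simp add: fourier_cis)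
qed

lemma fourier_multiplication_formula:
  assumes f: "integrable lborel f" and g: "integrable lborel g"
  shows "(LINT \<omega>|lborel. fourier f \<omega> * g \<omega>) = (LINT s|lborel. f s * fourier g s)"
proof -
  have [measurable]: "f \<in> borel_measurable borel" "g \<in> borel_measurable borel"
    using f g by auto
  let ?F = "\<lambda>\<omega> s. f s * g \<omega> * cis (- (2 * pi * \<omega> * s))"
  have "integrable (lborel \<Otimes>\<^sub>M lborel) (\<lambda>(\<omega>, s). ?F \<omega> s)"
  proof (rule lborel_pair.Fubini_integrable)
    have "(LINT s|lborel. norm (case (\<omega>, s) of (\<omega>, s) \<Rightarrow> ?F \<omega> s)) = (LINT s|lborel. cmod (f s)) * cmod (g \<omega>)" for \<omega>
      by (simp add: norm_mult)
    then show "integrable lborel (\<lambda>\<omega>. LINT s|lborel. norm (case (\<omega>, s) of (\<omega>, s) \<Rightarrow> ?F \<omega> s))"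
      using g by simp
    show "AE \<omega> in lborel. integrable lborel (\<lambda>s. case (\<omega>, s) of (\<omega>, s) \<Rightarrow> ?F \<omega> s)"
      using integrable_fourier[OF f] by (auto simp: mult.commute[of "f _" "g _"] mult.assoc)
  qed measurable
  from lborel_pair.Fubini_integral[OF this]
  have "(LINT \<omega>|lborel. LINT s|lborel. ?F \<omega> s) = (LINT s|lborel. LINT \<omega>|lborel. ?F \<omega> s)"
    by simp
  moreover have "(LINT s|lborel. ?F \<omega> s) = fourier f \<omega> * g \<omega>" for \<omega>
  proof -
    have "(LINT s|lborel. ?F \<omega> s) = (LINT s|lborel. g \<omega> * (f s * cis (- (2 * pi * \<omega> * s))))"
      by (simp add: mult_ac)
    then show ?thesis by (simp add: fourier_cis)
  qed
  moreover have "(LINT \<omega>|lborel. ?F \<omega> s) = f s * fourier g s" for s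
    by (simp add: fourier_cis mult_ac)
  ultimately show ?thesis by simp
qed

text \<open>Two uses of the multiplication formula: one moves the transform off the factor
  \<open>fourier u\<close>, the other computes the transform of \<open>k\<close> times the conjugate
  of \<open>fourier u\<close>. The resulting kernel is \<open>fourier k\<close> at s - t, so
  positivity of that transform becomes the decisive property of a weight.\<close>

lemma integral_fourier_square:
  assumes u: "integrable lborel u" and k: "integrable lborel k"
  shows "(LINT \<omega>|lborel. complex_of_real ((cmod (fourier u \<omega>))\<^sup>2) * k \<omega>)
       = (LINT s|lborel. u s * (LINT t|lborel. cnj (u t) * fourier k (s - t)))"
proof -
  have cu: "integrable lborel (\<lambda>t. cnj (u t))"
    using u by simp
  have w: "integrable lborel (\<lambda>\<omega>. k \<omega> * cnj (fourier u \<omega>))"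
    using fourier_le[of u] k borel_measurable_continuous_on[OF _ fourier_measurable[OF u], of cnj]
    by (intro integrable_mult_bounded[of _ _ _ "LINT t|lborel. cmod (u t)"]) (auto intro: continuous_intros)
  have inner: "fourier (\<lambda>\<omega>. k \<omega> * cnj (fourier u \<omega>)) s = (LINT t|lborel. cnj (u t) * fourier k (s - t))" for s
  proof -
    \<comment> \<open>After \<omega> is replaced by -\<omega>, the conjugate spectrum is the
      transform of the conjugate of \<open>u\<close>. The rest of the integrand is
      \<open>?g\<close>, whose phase turns into the argument s - t of
      \<open>fourier k\<close>.\<close>
    let ?g = "\<lambda>\<omega>. k (- \<omega>) * cis (2 * pi * s * \<omega>)"
    have "integrable lborel (\<lambda>\<omega>. k (- \<omega>))"
      using lborel_integrable_real_affine[OF k, of "-1" 0] by simp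
    then have g: "integrable lborel ?g"
      by (rule integrable_mult_cis)
    have fg: "fourier ?g t = fourier k (s - t)" for t
      unfolding fourier_cis
      by (subst lborel_integral_real_affine[of "-1" _ 0])
         (auto simp: cis_mult algebra_simps intro!: Bochner_Integration.integral_cong)
    have "fourier (\<lambda>\<omega>. k \<omega> * cnj (fourier u \<omega>)) s
        = (LINT \<omega>|lborel. k (- \<omega>) * cnj (fourier u (- \<omega>)) * cis (2 * pi * s * \<omega>))"
      unfolding fourier_cis by (subst lborel_integral_real_affine[of "-1" _ 0]) auto
    also have "\<dots> = (LINT \<omega>|lborel. fourier (\<lambda>t. cnj (u t)) \<omega> * ?g \<omega>)"
      by (simp add: fourier_cnj mult_ac)
    also have "\<dots> = (LINT t|lborel. cnj (u t) * fourier k (s - t))"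
      by (simp add: fourier_multiplication_formula[OF cu g] fg)
    finally show ?thesis .
  qed
  have "complex_of_real ((cmod (fourier u \<omega>))\<^sup>2) * k \<omega> = fourier u \<omega> * (k \<omega> * cnj (fourier u \<omega>))" for \<omega>
    unfolding complex_norm_square by (simp add: mult_ac)
  then show ?thesis
    by (simp only: fourier_multiplication_formula[OF u w] inner)
qed

lemma integrable_mult_bounded_real:
  fixes f g :: "'a \<Rightarrow> real"
  assumes "integrable M f" "g \<in> borel_measurable M" "\<And>x. \<bar>g x\<bar> \<le> B"
  shows "integrable M (\<lambda>x. f x * g x)"
proof (rule Bochner_Integration.integrable_bound)
  show "integrable M (\<lambda>x. B * \<bar>f x\<bar>)"
    using assms(1) by simp
  have "0 \<le> B" using assms(3) abs_ge_zero order_trans by blast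
  then show "AE x in M. norm (f x * g x) \<le> norm (B * \<bar>f x\<bar>)"
    using mult_right_mono[OF assms(3) abs_ge_zero] by (auto simp: abs_mult mult_ac)
qed (use assms in measurable)

text \<open>
  Replacing \<^term>\<open>u\<close> by its modulus moves spectral energy towards the origin: the two quadratic
  forms below have the kernels \<^term>\<open>fourier k'\<close> and \<^term>\<open>fourier k\<close>, and only the second one needs
  to be nonnegative.
\<close>

lemma modulus_spectral_energy:
  fixes k k' :: "real \<Rightarrow> real"
  assumes u: "integrable lborel u" and k: "integrable lborel k" and k': "integrable lborel k'"
    and le: "\<And>t. cmod (fourier (\<lambda>\<omega>. complex_of_real (k' \<omega>)) t) \<le> Re (fourier (\<lambda>\<omega>. complex_of_real (k \<omega>)) t)"
  shows "(LINT \<omega>|lborel. (cmod (fourier u \<omega>))\<^sup>2 * k' \<omega>)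
    \<le> (LINT \<omega>|lborel. (cmod (fourier (\<lambda>t. complex_of_real (cmod (u t))) \<omega>))\<^sup>2 * k \<omega>)"
proof -
  let ?K = "fourier (\<lambda>\<omega>. complex_of_real (k \<omega>))" and ?K' = "fourier (\<lambda>\<omega>. complex_of_real (k' \<omega>))"
  let ?v = "\<lambda>t. complex_of_real (cmod (u t))"
  have [measurable]: "?K \<in> borel_measurable borel" "?K' \<in> borel_measurable borel" "u \<in> borel_measurable borel"
    using k k' u by (auto intro!: fourier_measurable)
  define B where "B = (LINT t|lborel. cmod (complex_of_real (k t)))"
  have B: "cmod (?K t) \<le> B" for t
    unfolding B_def by (rule fourier_le)
  have BR: "\<bar>Re (?K t)\<bar> \<le> B" for t
    using B[of t] abs_Re_le_cmod order_trans by blast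
  have B': "cmod (?K' t) \<le> B" for t
    using le[of t] BR[of t] by linarith
  have Knn: "0 \<le> Re (?K t)" for t
    using order_trans[OF norm_ge_zero le] .
  have uR: "integrable lborel (\<lambda>t. cmod (u t))" and v: "integrable lborel ?v"
    using u by auto
  define A where "A = (LINT t|lborel. cmod (u t))"
  have "complex_of_real (LINT \<omega>|lborel. (cmod (fourier u \<omega>))\<^sup>2 * k' \<omega>)
      = (LINT s|lborel. u s * (LINT t|lborel. cnj (u t) * ?K' (s - t)))"
    using k' by (simp add: integral_fourier_square[OF u, symmetric] integral_complex_of_real[symmetric] del: integral_complex_of_real)
  moreover have "x \<le> cmod z" if "complex_of_real x = z" for x z
    using that by auto
  ultimately have "(LINT \<omega>|lborel. (cmod (fourier u \<omega>))\<^sup>2 * k' \<omega>)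
      \<le> cmod (LINT s|lborel. u s * (LINT t|lborel. cnj (u t) * ?K' (s - t)))"
    by blast
  also have "\<dots> \<le> (LINT s|lborel. cmod (u s * (LINT t|lborel. cnj (u t) * ?K' (s - t))))"
    by (rule integral_norm_bound)
  \<comment> \<open>Moduli inside both integrals discard all phases of \<open>u\<close> and leave
    the form of its modulus, while \<open>le\<close> replaces the kernel \<open>?K'\<close> by the
    real part of \<open>?K\<close>.\<close>
  also have "\<dots> \<le> (LINT s|lborel. cmod (u s) * (LINT t|lborel. cmod (u t) * Re (?K (s - t))))"
  proof (rule integral_mono')
    have "\<bar>LINT t|lborel. cmod (u t) * Re (?K (s - t))\<bar> \<le> A * B" for s
    proof -
      have "\<bar>LINT t|lborel. cmod (u t) * Re (?K (s - t))\<bar> \<le> (LINT t|lborel. \<bar>cmod (u t) * Re (?K (s - t))\<bar>)"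
        by (rule integral_abs_bound)
      also have "\<dots> \<le> (LINT t|lborel. cmod (u t) * B)"
        using BR uR order_trans[OF abs_ge_zero BR]
        by (intro integral_mono') (auto simp: abs_mult intro!: mult_left_mono)
      finally show ?thesis by (simp add: A_def)
    qed
    then show "integrable lborel (\<lambda>s. cmod (u s) * (LINT t|lborel. cmod (u t) * Re (?K (s - t))))"
      by (intro integrable_mult_bounded_real[OF uR]) measurable
    fix s
    have "cmod (LINT t|lborel. cnj (u t) * ?K' (s - t)) \<le> (LINT t|lborel. cmod (cnj (u t) * ?K' (s - t)))"
      by (rule integral_norm_bound)
    also have "\<dots> \<le> (LINT t|lborel. cmod (u t) * Re (?K (s - t)))"
    proof (rule integral_mono')
      show "integrable lborel (\<lambda>t. cmod (u t) * Re (?K (s - t)))"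
        using BR by (intro integrable_mult_bounded_real[OF uR]) measurable
    qed (use le Knn in \<open>auto simp: norm_mult intro!: mult_left_mono\<close>)
    finally show "cmod (u s * (LINT t|lborel. cnj (u t) * ?K' (s - t)))
        \<le> cmod (u s) * (LINT t|lborel. cmod (u t) * Re (?K (s - t)))"
      by (simp add: norm_mult mult_left_mono)
    show "0 \<le> cmod (u s) * (LINT t|lborel. cmod (u t) * Re (?K (s - t)))"
      using Knn by (intro mult_nonneg_nonneg Bochner_Integration.integral_nonneg) auto
  qed
  also have "\<dots> = (LINT \<omega>|lborel. (cmod (fourier ?v \<omega>))\<^sup>2 * k \<omega>)"
  proof -
    have in1: "integrable lborel (\<lambda>t. ?v t * ?K (s - t))" for s
      by (rule integrable_mult_bounded[OF v _ B]) measurable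
    have re1: "(LINT t|lborel. cmod (u t) * Re (?K (s - t))) = Re (LINT t|lborel. ?v t * ?K (s - t))" for s
      using integral_bounded_linear[OF bounded_linear_Re in1[of s]] by simp
    have "cmod (LINT t|lborel. ?v t * ?K (s - t)) \<le> A * B" for s
    proof -
      have "cmod (LINT t|lborel. ?v t * ?K (s - t)) \<le> (LINT t|lborel. cmod (?v t * ?K (s - t)))"
        by (rule integral_norm_bound)
      also have "\<dots> \<le> (LINT t|lborel. cmod (u t) * B)"
        using B uR order_trans[OF norm_ge_zero B]
        by (intro integral_mono') (auto simp: norm_mult intro!: mult_left_mono)
      finally show ?thesis by (simp add: A_def)
    qed
    then have in2: "integrable lborel (\<lambda>s. ?v s * (LINT t|lborel. ?v t * ?K (s - t)))"
      by (intro integrable_mult_bounded[OF v]) measurable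
    have "complex_of_real (LINT \<omega>|lborel. (cmod (fourier ?v \<omega>))\<^sup>2 * k \<omega>)
      = (LINT s|lborel. ?v s * (LINT t|lborel. ?v t * ?K (s - t)))"
      using integral_fourier_square[OF v, of "\<lambda>\<omega>. complex_of_real (k \<omega>)"] k
      by (simp add: integral_complex_of_real[symmetric] del: integral_complex_of_real)
    moreover have "x = Re z" if "complex_of_real x = z" for x z
      using that by auto
    ultimately have "(LINT \<omega>|lborel. (cmod (fourier ?v \<omega>))\<^sup>2 * k \<omega>)
      = Re (LINT s|lborel. ?v s * (LINT t|lborel. ?v t * ?K (s - t)))"
      by blast
    then show ?thesis
      using integral_bounded_linear[OF bounded_linear_Re in2] by (simp add: re1)
  qed
  finally show ?thesis .
qed

section \<open>Gaussians\<close>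

lemma exp_quadratic_eq_std_normal:
  assumes "c > 0"
  shows "exp (- (c * t\<^sup>2)) = sqrt (2 * pi) * std_normal_density (sqrt (2 * c) * t)"
  using assms by (simp add: std_normal_density_def power_mult_distrib)

lemma integrable_exp_quadratic:
  assumes "c > 0" shows "integrable lborel (\<lambda>t::real. exp (- (c * t\<^sup>2)))"
  unfolding exp_quadratic_eq_std_normal[OF assms]
  using lborel_integrable_real_affine[OF integrable_normal_density[of 1 0], of "sqrt (2 * c)" 0] assms
  by simp

text \<open>The transform is the characteristic function of the standard normal distribution,
  rescaled by \<open>sqrt (2 * c)\<close> and evaluated at the matching frequency.\<close>

lemma fourier_exp_quadratic:
  assumes c: "c > 0"
  shows "fourier (\<lambda>t. complex_of_real (exp (- (c * t\<^sup>2)))) \<omega> = complex_of_real (sqrt (pi / c) * exp (- (pi\<^sup>2 * \<omega>\<^sup>2 / c)))"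
proof -
  define s where "s = sqrt (2 * c)"
  have s: "s > 0" "s\<^sup>2 = 2 * c"
    using c by (auto simp: s_def)
  define x where "x = - (2 * pi * \<omega>) / s"
  have "complex_of_real (exp (- x\<^sup>2 / 2)) = char std_normal_distribution x"
    by (simp add: char_std_normal_distribution)
  also have "\<dots> = (LINT t|lborel. std_normal_density t *\<^sub>R cis (x * t))"
    unfolding char_def
    by (subst integral_density) (auto simp: normal_density_nonneg cis_conv_exp mult_ac)
  also have "\<dots> = \<bar>s\<bar> *\<^sub>R (LINT t|lborel. std_normal_density (s * t) *\<^sub>R cis (x * (s * t)))"
    by (subst lborel_integral_real_affine[of s _ 0]) (use s in auto)
  also have "(LINT t|lborel. std_normal_density (s * t) *\<^sub>R cis (x * (s * t)))
     = (LINT t|lborel. complex_of_real (1 / sqrt (2 * pi)) * (complex_of_real (exp (- (c * t\<^sup>2))) * cis (- (2 * pi * \<omega> * t))))"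
    using s by (intro Bochner_Integration.integral_cong)
      (auto simp: exp_quadratic_eq_std_normal[OF c] s_def[symmetric] x_def scaleR_conv_of_real mult.assoc)
  also have "\<dots> = complex_of_real (1 / sqrt (2 * pi)) * fourier (\<lambda>t. complex_of_real (exp (- (c * t\<^sup>2)))) \<omega>"
    by (simp add: fourier_cis)
  finally have "complex_of_real (exp (- x\<^sup>2 / 2))
      = complex_of_real (s / sqrt (2 * pi)) * fourier (\<lambda>t. complex_of_real (exp (- (c * t\<^sup>2)))) \<omega>"
    using s by (simp add: scaleR_conv_of_real)
  then have "fourier (\<lambda>t. complex_of_real (exp (- (c * t\<^sup>2)))) \<omega>
      = complex_of_real (sqrt (2 * pi) / s * exp (- x\<^sup>2 / 2))"
    using s by (simp add: field_simps)
  moreover have "sqrt (2 * pi) / s = sqrt (pi / c)"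
    by (simp add: s_def flip: real_sqrt_divide)
  moreover have "- x\<^sup>2 / 2 = - (pi\<^sup>2 * \<omega>\<^sup>2 / c)"
    using s c by (simp add: x_def power_divide power_mult_distrib)
  ultimately show ?thesis by simp
qed

lemma integrable_gaussian:
  assumes "a > 0" shows "integrable lborel (gaussian a)"
proof -
  have "integrable lborel (\<lambda>t. complex_of_real (sqrt pi * a * exp (- ((pi * a)\<^sup>2 * t\<^sup>2))))"
    using integrable_exp_quadratic[of "(pi * a)\<^sup>2"] assms by (simp del: of_real_mult)
  then show ?thesis
    by (simp add: gaussian_def[abs_def])
qed

lemma fourier_gaussian:
  assumes "a > 0" shows "fourier (gaussian a) \<omega> = complex_of_real (exp (- (\<omega> / a)\<^sup>2))"
proof -
  have "fourier (gaussian a) \<omega>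
      = complex_of_real (sqrt pi * a) * fourier (\<lambda>t. complex_of_real (exp (- ((pi * a)\<^sup>2 * t\<^sup>2)))) \<omega>"
    by (simp add: fourier_cis gaussian_def[abs_def] mult.assoc)
  also have "\<dots> = complex_of_real (sqrt pi * a * sqrt (pi / (pi * a)\<^sup>2) * exp (- (pi\<^sup>2 * \<omega>\<^sup>2 / (pi * a)\<^sup>2)))"
    using assms by (subst fourier_exp_quadratic) auto
  also have "sqrt pi * a * sqrt (pi / (pi * a)\<^sup>2) = 1"
    using assms by (simp add: real_sqrt_divide field_simps real_sqrt_mult)
  also have "pi\<^sup>2 * \<omega>\<^sup>2 / (pi * a)\<^sup>2 = (\<omega> / a)\<^sup>2"
    by (simp add: power_divide power_mult_distrib)
  finally show ?thesis by simp
qed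

text \<open>Fourier inversion for the Gaussian, read off the explicit formula. It exhibits the
  Gaussian frequency weights as weights with a positive transform.\<close>

lemma fourier_exp_square:
  assumes "a > 0" shows "fourier (\<lambda>\<omega>. complex_of_real (exp (- (\<omega> / a)\<^sup>2))) t = gaussian a t"
proof -
  have "fourier (\<lambda>\<omega>. complex_of_real (exp (- (1 / a\<^sup>2 * \<omega>\<^sup>2)))) t
      = complex_of_real (sqrt (pi / (1 / a\<^sup>2)) * exp (- (pi\<^sup>2 * t\<^sup>2 / (1 / a\<^sup>2))))"
    using assms by (intro fourier_exp_quadratic) auto
  then show ?thesis
    using assms by (simp add: gaussian_def power_divide power_mult_distrib real_sqrt_mult mult_ac)
qed

lemma integrable_exp_square:
  assumes "a > 0" shows "integrable lborel (\<lambda>\<omega>::real. exp (- (\<omega> / a)\<^sup>2))"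
  using integrable_exp_quadratic[of "1 / a\<^sup>2"] assms by (simp add: power_divide)

lemma gaussian_rescale: "a > 0 \<Longrightarrow> gaussian a (w / a) = complex_of_real a * gaussian 1 w"
  by (simp add: gaussian_def field_simps power_divide)

section \<open>Continuity of translations and Plancherel's theorem\<close>

text \<open>Three-epsilon argument: translations preserve the L^1 norm, so the functions on which
  they act continuously at 0 form an L^1-closed set.\<close>

lemma translation_L1_approx:
  fixes f :: "real \<Rightarrow> complex"
  assumes f: "integrable lborel f"
    and approx: "\<And>e. e > 0 \<Longrightarrow> \<exists>g. integrable lborel g \<and> (LINT s|lborel. cmod (f s - g s)) \<le> e
      \<and> (\<lambda>n. LINT s|lborel. cmod (g (s - X n) - g s)) \<longlonglongrightarrow> 0"
  shows "(\<lambda>n. LINT s|lborel. cmod (f (s - X n) - f s)) \<longlonglongrightarrow> 0"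
proof (rule LIMSEQ_I)
  fix r :: real assume "0 < r"
  then obtain g where g: "integrable lborel g" "(LINT s|lborel. cmod (f s - g s)) \<le> r / 4"
      "(\<lambda>n. LINT s|lborel. cmod (g (s - X n) - g s)) \<longlonglongrightarrow> 0"
    using approx[of "r / 4"] by auto
  obtain N where N: "\<And>n. n \<ge> N \<Longrightarrow> norm ((LINT s|lborel. cmod (g (s - X n) - g s)) - 0) < r / 4"
    using LIMSEQ_D[OF g(3), of "r / 4"] \<open>0 < r\<close> by auto
  have tr: "integrable lborel (\<lambda>s. h (s - v))" if "integrable lborel h" for h :: "real \<Rightarrow> complex" and v
    using lborel_integrable_real_affine[OF that, of 1 "- v"] by simp
  show "\<exists>N. \<forall>n\<ge>N. norm ((LINT s|lborel. cmod (f (s - X n) - f s)) - 0) < r"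
  proof (intro exI allI impI)
    fix n assume "n \<ge> N"
    have "(LINT s|lborel. cmod (f (s - X n) - f s))
       \<le> (LINT s|lborel. cmod (f (s - X n) - g (s - X n)) + cmod (g (s - X n) - g s) + cmod (f s - g s))"
    proof (rule integral_mono)
      fix s
      show "cmod (f (s - X n) - f s) \<le> cmod (f (s - X n) - g (s - X n)) + cmod (g (s - X n) - g s) + cmod (f s - g s)"
        using norm_triangle_ineq[of "f (s - X n) - g (s - X n)" "g (s - X n) - g s"]
          norm_triangle_ineq4[of "f (s - X n) - g s" "f s - g s"] by simp
    qed (use f g tr in auto)
    also have "\<dots> = (LINT s|lborel. cmod (f (s - X n) - g (s - X n))) + (LINT s|lborel. cmod (g (s - X n) - g s))
        + (LINT s|lborel. cmod (f s - g s))"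
      using f g tr by auto
    also have "(LINT s|lborel. cmod (f (s - X n) - g (s - X n))) = (LINT s|lborel. cmod (f s - g s))"
      using lborel_integral_real_affine[of 1 "\<lambda>s. cmod (f s - g s)" "- X n"] by simp
    finally show "norm ((LINT s|lborel. cmod (f (s - X n) - f s)) - 0) < r"
      using N[OF \<open>n \<ge> N\<close>] g(2) \<open>0 < r\<close> by simp
  qed
qed

text \<open>The modulus of a difference of two indicators is their sum minus twice their product. In
  the product the unshifted indicator selects points of \<open>U\<close>, where openness makes the
  shifted one eventually 1; boundary points of \<open>U\<close> never enter.\<close>

lemma translation_L1_open:
  fixes U :: "real set"
  assumes U: "open U" "emeasure lborel U < \<infinity>" and X: "X \<longlonglongrightarrow> 0"
  shows "(\<lambda>n. LINT s|lborel. cmod (indicator U (s - X n) *\<^sub>R c - indicator U s *\<^sub>R c)) \<longlonglongrightarrow> 0"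
proof -
  have [measurable]: "U \<in> sets borel" using U by auto
  have iU: "integrable lborel (indicator U :: real \<Rightarrow> real)"
    using U by simp
  have iUt: "integrable lborel (\<lambda>s. indicator U (s - v) :: real)" for v
    using lborel_integrable_real_affine[OF iU, of 1 "- v"] by simp
  have iUU: "integrable lborel (\<lambda>s. indicator U s * indicator U (s - v) :: real)" for v
    by (rule integrable_mult_bounded_real[OF iU, of _ 1]) (auto simp: indicator_def)
  have lim: "(\<lambda>n. LINT s|lborel. indicator U s * indicator U (s - X n)) \<longlonglongrightarrow> (LINT s|lborel. indicator U s :: real)"
  proof (rule integral_dominated_convergence)
    show "integrable lborel (indicator U :: real \<Rightarrow> real)" by fact
    show "AE s in lborel. (\<lambda>n. indicator U s * indicator U (s - X n) :: real) \<longlonglongrightarrow> indicator U s"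
    proof (rule AE_I2)
      fix s
      show "(\<lambda>n. indicator U s * indicator U (s - X n) :: real) \<longlonglongrightarrow> indicator U s"
      proof (cases "s \<in> U")
        case True
        have "(\<lambda>n. s - X n) \<longlonglongrightarrow> s - 0"
          by (intro tendsto_intros X)
        then have "\<forall>\<^sub>F n in sequentially. s - X n \<in> U"
          using U(1) True by (simp add: topological_tendstoD)
        then have "\<forall>\<^sub>F n in sequentially. indicator U s * indicator U (s - X n) = (indicator U s :: real)"
          by eventually_elim (simp add: True)
        then show ?thesis by (rule tendsto_eventually)
      qed simp
    qed
  qed (auto simp: indicator_def)
  have eq: "(LINT s|lborel. cmod (indicator U (s - v) *\<^sub>R c - indicator U s *\<^sub>R c))
      = cmod c * (2 * (LINT s|lborel. indicator U s) - 2 * (LINT s|lborel. indicator U s * indicator U (s - v)))" for v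
  proof -
    have "(LINT s|lborel. cmod (indicator U (s - v) *\<^sub>R c - indicator U s *\<^sub>R c))
       = (LINT s|lborel. cmod c * (indicator U (s - v) + indicator U s - 2 * (indicator U s * indicator U (s - v))))"
      by (intro Bochner_Integration.integral_cong) (auto simp: indicator_def)
    also have "\<dots> = cmod c * ((LINT s|lborel. indicator U (s - v)) + (LINT s|lborel. indicator U s)
        - 2 * (LINT s|lborel. indicator U s * indicator U (s - v)))"
      using iU iUt iUU by simp
    also have "(LINT s|lborel. indicator U (s - v) :: real) = (LINT s|lborel. indicator U s)"
      using lborel_integral_real_affine[of 1 "indicator U :: real \<Rightarrow> real" "- v"] by simp
    finally show ?thesis by simp
  qed
  have "(\<lambda>n. cmod c * (2 * (LINT s|lborel. indicator U s) - 2 * (LINT s|lborel. indicator U s * indicator U (s - X n))))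
     \<longlonglongrightarrow> cmod c * (2 * (LINT s|lborel. indicator U s) - 2 * (LINT s|lborel. indicator U s))"
    by (intro tendsto_intros lim)
  then show ?thesis
    unfolding eq by simp
qed

lemma translation_L1:
  fixes f :: "real \<Rightarrow> complex"
  assumes "integrable lborel f" and X: "X \<longlonglongrightarrow> 0"
  shows "(\<lambda>n. LINT s|lborel. cmod (f (s - X n) - f s)) \<longlonglongrightarrow> 0"
  using assms(1)
proof (induction rule: integrable_induct)
  case (base A c)
  have [measurable]: "A \<in> sets borel" using base by simp
  show ?case
  proof (rule translation_L1_approx)
    show "integrable lborel (\<lambda>x. indicator A x *\<^sub>R c)"
      using base by simp
    fix e :: real assume "e > 0"
    \<comment> \<open>The added 1 keeps the denominator positive when \<open>c\<close> is 0. Outer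
      regularity gives an open superset with excess measure below \<open>d\<close>, hence an L^1
      error of at most \<open>e\<close>.\<close>
    define d where "d = e / (cmod c + 1)"
    have "d > 0" using \<open>e > 0\<close> by (simp add: d_def add_nonneg_pos)
    obtain U where U: "open U" "A \<subseteq> U" "emeasure lborel (U - A) < d"
      using outer_regular_lborel[OF \<open>A \<in> sets borel\<close> \<open>d > 0\<close>] by blast
    have [measurable]: "U \<in> sets borel" using U by auto
    have "emeasure lborel U = emeasure lborel A + emeasure lborel (U - A)"
      using U by (subst plus_emeasure) (auto simp: Un_absorb1)
    also have "\<dots> < \<infinity>"
      using base U(3) by (auto simp: less_top[symmetric] top_unique intro: less_trans)
    finally have Ufin: "emeasure lborel U < \<infinity>" .
    have "(LINT s|lborel. cmod (indicator A s *\<^sub>R c - indicator U s *\<^sub>R c)) = (LINT s|lborel. cmod c * indicator (U - A) s)"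
      using U(2) by (intro Bochner_Integration.integral_cong) (auto simp: indicator_def)
    also have "\<dots> = cmod c * measure lborel (U - A)"
      by simp
    also have "\<dots> \<le> cmod c * d"
      using U(3) \<open>d > 0\<close> by (intro mult_left_mono) (auto simp: measure_def enn2real_leI)
    also have "\<dots> \<le> e"
      using \<open>e > 0\<close> add_nonneg_pos[OF norm_ge_zero[of c] zero_less_one]
      by (simp add: d_def divide_le_eq algebra_simps)
    finally show "\<exists>g. integrable lborel g \<and> (LINT s|lborel. cmod (indicator A s *\<^sub>R c - g s)) \<le> e
      \<and> (\<lambda>n. LINT s|lborel. cmod (g (s - X n) - g s)) \<longlonglongrightarrow> 0"
      using translation_L1_open[OF U(1) Ufin X, of c] Ufin
      by (intro exI[of _ "\<lambda>s. indicator U s *\<^sub>R c"]) auto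
  qed
next
  case (add f g)
  have tr: "integrable lborel (\<lambda>s. h (s - v))" if "integrable lborel h" for h :: "real \<Rightarrow> complex" and v
    using lborel_integrable_real_affine[OF that, of 1 "- v"] by simp
  show ?case
  proof (rule Lim_null_comparison)
    show "\<forall>\<^sub>F n in sequentially. norm (LINT s|lborel. cmod (f (s - X n) + g (s - X n) - (f s + g s)))
       \<le> (LINT s|lborel. cmod (f (s - X n) - f s)) + (LINT s|lborel. cmod (g (s - X n) - g s))"
    proof (rule always_eventually, rule allI)
      fix n
      have "(LINT s|lborel. cmod (f (s - X n) + g (s - X n) - (f s + g s)))
         \<le> (LINT s|lborel. cmod (f (s - X n) - f s) + cmod (g (s - X n) - g s))"
      proof (rule integral_mono)
        show "cmod (f (s - X n) + g (s - X n) - (f s + g s)) \<le> cmod (f (s - X n) - f s) + cmod (g (s - X n) - g s)" for s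
          using norm_triangle_ineq[of "f (s - X n) - f s" "g (s - X n) - g s"] by (simp add: algebra_simps)
      qed (use add tr in auto)
      then show "norm (LINT s|lborel. cmod (f (s - X n) + g (s - X n) - (f s + g s)))
       \<le> (LINT s|lborel. cmod (f (s - X n) - f s)) + (LINT s|lborel. cmod (g (s - X n) - g s))"
        using add tr by simp
    qed
    show "(\<lambda>n. (LINT s|lborel. cmod (f (s - X n) - f s)) + (LINT s|lborel. cmod (g (s - X n) - g s))) \<longlonglongrightarrow> 0"
      using tendsto_add[OF add(3,4)] by simp
  qed
next
  case (lim f s)
  show ?case
  proof (rule translation_L1_approx)
    fix e :: real assume "e > 0"
    have "(\<lambda>i. LINT x|lborel. cmod (f x - s i x)) \<longlonglongrightarrow> (LINT x|(lborel :: real measure). (0::real))"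
    proof (rule integral_dominated_convergence[where w="\<lambda>x. 3 * cmod (f x)"])
      show "AE x in lborel. (\<lambda>i. cmod (f x - s i x)) \<longlonglongrightarrow> 0"
      proof (rule AE_I2)
        fix x
        have "(\<lambda>i. cmod (f x - s i x)) \<longlonglongrightarrow> cmod (f x - f x)"
          using lim(2)[of x] by (intro tendsto_intros) auto
        then show "(\<lambda>i. cmod (f x - s i x)) \<longlonglongrightarrow> 0" by simp
      qed
      have "cmod (f x - s i x) \<le> 3 * cmod (f x)" for x i
        using norm_triangle_ineq4[of "f x" "s i x"] lim(3)[of x i] by simp
      then show "AE x in lborel. norm (cmod (f x - s i x)) \<le> 3 * cmod (f x)" for i
        by simp
    qed (use lim in auto)
    then have "\<forall>\<^sub>F i in sequentially. (LINT x|lborel. cmod (f x - s i x)) < e"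
      using \<open>e > 0\<close> by (intro order_tendstoD) auto
    then obtain i where "(LINT x|lborel. cmod (f x - s i x)) < e"
      by (auto simp: eventually_sequentially)
    then show "\<exists>g. integrable lborel g \<and> (LINT s|lborel. cmod (f s - g s)) \<le> e
      \<and> (\<lambda>n. LINT s|lborel. cmod (g (s - X n) - g s)) \<longlonglongrightarrow> 0"
      using lim by (intro exI[of _ "s i"]) auto
  qed (fact lim)
qed

text \<open>The Mazur map \<^term>\<open>a * complex_of_real (cmod a)\<close> from \<open>L\<^sup>2\<close> to \<open>L\<^sup>1\<close> has a
  Hoelder continuous inverse; this transfers the continuity of translations from \<open>L\<^sup>1\<close> to \<open>L\<^sup>2\<close>.\<close>

lemma Mazur_map_bound:
  "(cmod (a - b))\<^sup>2 \<le> 2 * cmod (a * complex_of_real (cmod a) - b * complex_of_real (cmod b))"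
proof (cases "a = b")
  case False
  define z p q r where "z = a * complex_of_real (cmod a) - b * complex_of_real (cmod b)"
    and "p = cmod a" and "q = cmod b" and "r = Re (a * cnj b)"
  have d: "(cmod (a - b))\<^sup>2 = p\<^sup>2 + q\<^sup>2 - 2 * r"
    unfolding p_def q_def r_def cmod_power2 by (simp add: power2_eq_square algebra_simps)
  \<comment> \<open>Strong monotonicity of the Mazur map: the pairing of \<open>z\<close> with a - b
    is at least (p + q) / 2 times the squared distance, and p + q is at least the distance. Bounding
    the pairing above by the product of moduli lets one factor cancel.\<close>
  have "Re (z * cnj (a - b)) = p * p\<^sup>2 + q * q\<^sup>2 - (p + q) * r"
    unfolding p_def[symmetric] q_def[symmetric] z_def
    unfolding p_def q_def r_def cmod_power2
    by (simp add: power2_eq_square algebra_simps)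
  also have "\<dots> = (p + q) / 2 * (cmod (a - b))\<^sup>2 + (p + q) / 2 * (p - q)\<^sup>2"
    unfolding d by (simp add: power2_eq_square algebra_simps add_divide_distrib diff_divide_distrib)
  also have "\<dots> \<ge> cmod (a - b) / 2 * (cmod (a - b))\<^sup>2"
  proof -
    have "cmod (a - b) \<le> p + q" unfolding p_def q_def by (rule norm_triangle_ineq4)
    then have "cmod (a - b) / 2 * (cmod (a - b))\<^sup>2 \<le> (p + q) / 2 * (cmod (a - b))\<^sup>2"
      by (intro mult_right_mono) auto
    moreover have "0 \<le> (p + q) / 2 * (p - q)\<^sup>2"
      by (simp add: p_def q_def)
    ultimately show ?thesis by linarith
  qed
  finally have "cmod (a - b) / 2 * (cmod (a - b))\<^sup>2 \<le> cmod z * cmod (a - b)"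
    using complex_Re_le_cmod[of "z * cnj (a - b)"] by (simp add: norm_mult complex_mod_cnj del: complex_cnj_diff)
  then have "cmod (a - b) * ((cmod (a - b))\<^sup>2) \<le> cmod (a - b) * (2 * cmod z)"
    by (simp add: mult_ac)
  then show ?thesis
    using False by (simp add: z_def)
qed simp

lemma translation_L2:
  assumes u: "square_integrable u" and X: "X \<longlonglongrightarrow> 0"
  shows "(\<lambda>n. L2norm (\<lambda>s. u (s - X n) - u s)) \<longlonglongrightarrow> 0"
proof -
  have [measurable]: "u \<in> borel_measurable borel" using u by (simp add: square_integrable_def)
  define w where "w = (\<lambda>s. u s * complex_of_real (cmod (u s)))"
  have w: "integrable lborel w"
    unfolding w_def by (rule square_integrable_mult_integrable[OF u square_integrable_cmod[OF u]])
  have wt: "integrable lborel (\<lambda>s. w (s - v))" for v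
    using lborel_integrable_real_affine[OF w, of 1 "- v"] by simp
  have "(L2norm (\<lambda>s. u (s - v) - u s))\<^sup>2 \<le> 2 * (LINT s|lborel. cmod (w (s - v) - w s))" for v
  proof -
    have "(LINT s|lborel. (cmod (u (s - v) - u s))\<^sup>2) \<le> (LINT s|lborel. 2 * cmod (w (s - v) - w s))"
      using Mazur_map_bound w wt by (intro integral_mono') (auto simp: w_def)
    then show ?thesis by (simp add: L2norm_square)
  qed
  then have bound: "\<bar>L2norm (\<lambda>s. u (s - v) - u s)\<bar> \<le> sqrt (2 * (LINT s|lborel. cmod (w (s - v) - w s)))" for v
    by (simp add: real_le_rsqrt)
  have "(\<lambda>n. sqrt (2 * (LINT s|lborel. cmod (w (s - X n) - w s)))) \<longlonglongrightarrow> sqrt (2 * 0)"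
    by (intro tendsto_intros translation_L1[OF w X])
  then have lim: "(\<lambda>n. sqrt (2 * (LINT s|lborel. cmod (w (s - X n) - w s)))) \<longlonglongrightarrow> 0"
    by (simp only: mult_zero_right real_sqrt_zero)
  show ?thesis
    by (rule Lim_null_comparison[OF always_eventually lim]) (simp only: real_norm_def bound simp_thms)
qed

text \<open>For the damped spectrum the quadratic form has kernel \<open>gaussian a\<close> at s -
  t. The substitution t = s - w / a rewrites it as an average of autocorrelations over a fixed
  Gaussian; growing \<open>a\<close> sends all lags to 0.\<close>

lemma Plancherel_gaussian_mean:
  assumes u: "integrable lborel u" "square_integrable u" and a: "a > 0"
  shows "complex_of_real (LINT \<omega>|lborel. (cmod (fourier u \<omega>))\<^sup>2 * exp (- (\<omega> / a)\<^sup>2))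
    = (LINT w|lborel. gaussian 1 w * (LINT s|lborel. u s * cnj (u (s - w / a))))"
proof -
  let ?F = "\<lambda>s t. u s * (cnj (u t) * gaussian a (s - t))"
  have [measurable]: "u \<in> borel_measurable borel" using u by auto
  have [measurable]: "gaussian a \<in> borel_measurable borel"
    using integrable_gaussian[OF a] by auto
  have gb: "cmod (gaussian a t) \<le> sqrt pi * a" for t
    using a by (simp add: gaussian_def norm_mult)
  have cu: "integrable lborel (\<lambda>t. cnj (u t))" using u by simp
  have [measurable]: "(\<lambda>t. cnj (u t)) \<in> borel_measurable borel"
    using borel_measurable_integrable[OF cu] by simp
  have int: "integrable (lborel \<Otimes>\<^sub>M lborel) (\<lambda>(s, v). ?F s (s - v))"
  proof (rule lborel_pair.Fubini_integrable)
    have inner: "integrable lborel (\<lambda>t. cnj (u t) * gaussian a (s - t))" for s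
      by (rule integrable_mult_bounded[OF cu _ gb]) measurable
    have eq: "(LINT v|lborel. norm (case (s, v) of (s, v) \<Rightarrow> ?F s (s - v)))
       = cmod (u s) * (LINT t|lborel. cmod (cnj (u t) * gaussian a (s - t)))" for s
      using lborel_integral_real_affine[of "-1" "\<lambda>t. cmod (cnj (u t) * gaussian a (s - t))" s]
      by (simp add: norm_mult)
    have "\<bar>LINT t|lborel. cmod (cnj (u t) * gaussian a (s - t))\<bar> \<le> (LINT t|lborel. cmod (u t) * (sqrt pi * a))" for s
    proof -
      have "(LINT t|lborel. cmod (cnj (u t) * gaussian a (s - t))) \<le> (LINT t|lborel. cmod (u t) * (sqrt pi * a))"
        using u gb by (intro integral_mono[OF integrable_norm[OF inner]]) (auto simp: norm_mult intro!: mult_left_mono)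
      then show ?thesis by simp
    qed
    then show "integrable lborel (\<lambda>s. LINT v|lborel. norm (case (s, v) of (s, v) \<Rightarrow> ?F s (s - v)))"
      unfolding eq using u by (intro integrable_mult_bounded_real) auto
    show "AE s in lborel. integrable lborel (\<lambda>v. case (s, v) of (s, v) \<Rightarrow> ?F s (s - v))"
    proof (rule AE_I2)
      fix s
      show "integrable lborel (\<lambda>v. case (s, v) of (s, v) \<Rightarrow> ?F s (s - v))"
        using lborel_integrable_real_affine[OF inner[of s], of "-1" s] by simp
    qed
  qed measurable
  have "complex_of_real (LINT \<omega>|lborel. (cmod (fourier u \<omega>))\<^sup>2 * exp (- (\<omega> / a)\<^sup>2))
    = (LINT \<omega>|lborel. complex_of_real ((cmod (fourier u \<omega>))\<^sup>2) * complex_of_real (exp (- (\<omega> / a)\<^sup>2)))"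
    by (simp only: integral_complex_of_real[symmetric] of_real_mult)
  also have "\<dots> = (LINT s|lborel. u s * (LINT t|lborel. cnj (u t) * gaussian a (s - t)))"
    using integrable_exp_square[OF a]
    by (subst integral_fourier_square[OF u(1) integrable_of_real]) (auto simp only: fourier_exp_square[OF a])
  also have "\<dots> = (LINT s|lborel. LINT v|lborel. ?F s (s - v))"
  proof (intro Bochner_Integration.integral_cong refl)
    fix s
    show "u s * (LINT t|lborel. cnj (u t) * gaussian a (s - t)) = (LINT v|lborel. ?F s (s - v))"
      using lborel_integral_real_affine[of "-1" "\<lambda>t. cnj (u t) * gaussian a (s - t)" s] by simp
  qed
  also have "\<dots> = (LINT v|lborel. LINT s|lborel. ?F s (s - v))"
    by (rule lborel_pair.Fubini_integral[OF int, symmetric])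
  also have "\<dots> = (LINT v|lborel. gaussian a v * (LINT s|lborel. u s * cnj (u (s - v))))"
  proof (intro Bochner_Integration.integral_cong refl)
    fix v
    have "(LINT s|lborel. ?F s (s - v)) = (LINT s|lborel. gaussian a v * (u s * cnj (u (s - v))))"
      by (simp add: mult_ac)
    then show "(LINT s|lborel. ?F s (s - v)) = gaussian a v * (LINT s|lborel. u s * cnj (u (s - v)))"
      by simp
  qed
  also have "\<dots> = (LINT w|lborel. gaussian 1 w * (LINT s|lborel. u s * cnj (u (s - w / a))))"
    using a by (subst lborel_integral_real_affine[of "1 / a" _ 0])
      (auto simp: gaussian_rescale scaleR_conv_of_real mult.assoc)
  finally show ?thesis .
qed

text \<open>Both bounds are Cauchy-Schwarz. The first provides the dominating function for the
  Gaussian average, the second reduces continuity at lag 0 to L^2 continuity of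
  translations.\<close>

lemma autocorrelation_bound:
  assumes u: "square_integrable u"
  shows "cmod (LINT s|lborel. u s * cnj (u (s - v))) \<le> (L2norm u)\<^sup>2"
    and "cmod ((LINT s|lborel. u s * cnj (u (s - v))) - complex_of_real ((L2norm u)\<^sup>2))
      \<le> L2norm u * L2norm (\<lambda>s. u (s - v) - u s)"
proof -
  have ut: "square_integrable (\<lambda>s. u (s - v))"
    using square_integrable_affine[OF u, of 1 "- v"] by simp
  have nt: "L2norm (\<lambda>s. u (s - v)) = L2norm u"
    using lborel_integral_real_affine[of 1 "\<lambda>s. (cmod (u s))\<^sup>2" "- v"] by (simp add: L2norm_def)
  have "cmod (LINT s|lborel. u s * cnj (u (s - v))) \<le> (LINT s|lborel. cmod (u s * cnj (u (s - v))))"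
    by (rule integral_norm_bound)
  also have "\<dots> \<le> L2norm u * L2norm u"
    using Cauchy_Schwarz_L2[OF u ut] by (simp add: norm_mult nt)
  finally show "cmod (LINT s|lborel. u s * cnj (u (s - v))) \<le> (L2norm u)\<^sup>2"
    by (simp add: power2_eq_square)
  have "complex_of_real ((L2norm u)\<^sup>2) = (LINT s|lborel. u s * cnj (u s))"
    by (simp only: L2norm_square integral_complex_of_real[symmetric] complex_norm_square)
  then have "(LINT s|lborel. u s * cnj (u (s - v))) - complex_of_real ((L2norm u)\<^sup>2)
     = (LINT s|lborel. u s * cnj (u (s - v)) - u s * cnj (u s))"
    using square_integrable_mult_integrable[OF u square_integrable_cnj[OF ut]]
      square_integrable_mult_integrable[OF u square_integrable_cnj[OF u]] by simp
  also have "\<dots> = (LINT s|lborel. u s * cnj (u (s - v) - u s))"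
    by (simp add: right_diff_distrib)
  also have "cmod \<dots> \<le> (LINT s|lborel. cmod (u s * cnj (u (s - v) - u s)))"
    by (rule integral_norm_bound)
  also have "\<dots> \<le> L2norm u * L2norm (\<lambda>s. u (s - v) - u s)"
    using Cauchy_Schwarz_L2[OF u square_integrable_diff[OF ut u]]
    by (simp add: norm_mult complex_mod_cnj del: complex_cnj_diff)
  finally show "cmod ((LINT s|lborel. u s * cnj (u (s - v))) - complex_of_real ((L2norm u)\<^sup>2))
      \<le> L2norm u * L2norm (\<lambda>s. u (s - v) - u s)" .
qed

lemma autocorrelation_tendsto:
  assumes u: "square_integrable u" and X: "X \<longlonglongrightarrow> 0"
  shows "(\<lambda>n. LINT s|lborel. u s * cnj (u (s - X n))) \<longlonglongrightarrow> complex_of_real ((L2norm u)\<^sup>2)"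
proof (rule LIM_zero_cancel, rule Lim_null_comparison[OF always_eventually])
  show "\<forall>n. norm ((LINT s|lborel. u s * cnj (u (s - X n))) - complex_of_real ((L2norm u)\<^sup>2))
      \<le> L2norm u * L2norm (\<lambda>s. u (s - X n) - u s)"
    by (intro allI autocorrelation_bound(2) u)
  show "(\<lambda>n. L2norm u * L2norm (\<lambda>s. u (s - X n) - u s)) \<longlonglongrightarrow> 0"
    using tendsto_mult[OF tendsto_const translation_L2[OF u X], of "L2norm u"] by (simp only: mult_zero_right)
qed

text \<open>Let the damping scale n + 1 grow in \<open>Plancherel_gaussian_mean\<close>. The
  autocorrelation side converges by dominated convergence to the energy of \<open>u\<close>; the
  spectral side increases, so monotone convergence yields integrability and the value
  together.\<close>

theorem Plancherel:
  assumes u: "integrable lborel u" "square_integrable u"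
  shows "square_integrable (fourier u)" and "L2norm (fourier u) = L2norm u"
proof -
  have [measurable]: "u \<in> borel_measurable borel" using u by auto
  have [measurable]: "(\<lambda>t. cnj (u t)) \<in> borel_measurable borel"
    using square_integrable_cnj[OF u(2)] by (simp add: square_integrable_def)
  have [measurable]: "fourier u \<in> borel_measurable borel"
    by (rule fourier_measurable[OF u(1)])
  define h where "h n \<omega> = (cmod (fourier u \<omega>))\<^sup>2 * exp (- (\<omega> / real (Suc n))\<^sup>2)" for n \<omega>
  have g1: "integrable lborel (gaussian 1)" "(LINT w|lborel. gaussian 1 w) = 1"
    using integrable_gaussian[of 1] fourier_gaussian[of 1 0] by (simp_all add: fourier_0)
  have "(\<lambda>n. LINT w|lborel. gaussian 1 w * (LINT s|lborel. u s * cnj (u (s - w / real (Suc n)))))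
     \<longlonglongrightarrow> (LINT w|lborel. gaussian 1 w * complex_of_real ((L2norm u)\<^sup>2))"
  proof (rule integral_dominated_convergence[where w="\<lambda>w. cmod (gaussian 1 w) * (L2norm u)\<^sup>2"])
    show "AE w in lborel. (\<lambda>n. gaussian 1 w * (LINT s|lborel. u s * cnj (u (s - w / real (Suc n)))))
        \<longlonglongrightarrow> gaussian 1 w * complex_of_real ((L2norm u)\<^sup>2)"
    proof (intro AE_I2 tendsto_mult[OF tendsto_const] autocorrelation_tendsto[OF u(2)])
      show "(\<lambda>n. w / real (Suc n)) \<longlonglongrightarrow> 0" for w :: real
        using LIMSEQ_Suc[OF lim_const_over_n[of w]] by simp
    qed
    show "AE w in lborel. norm (gaussian 1 w * (LINT s|lborel. u s * cnj (u (s - w / real (Suc n)))))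
        \<le> cmod (gaussian 1 w) * (L2norm u)\<^sup>2" for n
      using autocorrelation_bound(1)[OF u(2)] by (auto simp: norm_mult intro!: mult_left_mono)
    have [measurable]: "gaussian 1 \<in> borel_measurable borel" using g1 by auto
    show "(\<lambda>w. gaussian 1 w * (LINT s|lborel. u s * cnj (u (s - w / real (Suc n))))) \<in> borel_measurable lborel" for n
      by measurable
    show "(\<lambda>w. gaussian 1 w * complex_of_real ((L2norm u)\<^sup>2)) \<in> borel_measurable lborel"
      by measurable
    show "integrable lborel (\<lambda>w. cmod (gaussian 1 w) * (L2norm u)\<^sup>2)"
      using g1(1) by auto
  qed
  moreover have "(LINT w|lborel. gaussian 1 w * (LINT s|lborel. u s * cnj (u (s - w / real (Suc n)))))
     = complex_of_real (LINT \<omega>|lborel. h n \<omega>)" for n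
    unfolding h_def by (rule Plancherel_gaussian_mean[OF u, symmetric]) simp
  moreover have "(LINT w|lborel. gaussian 1 w * complex_of_real ((L2norm u)\<^sup>2)) = complex_of_real ((L2norm u)\<^sup>2)"
    by (subst integral_mult_left_zero) (simp add: g1)
  ultimately have lim: "(\<lambda>n. LINT \<omega>|lborel. h n \<omega>) \<longlonglongrightarrow> (L2norm u)\<^sup>2"
    by (simp only: tendsto_of_real_iff)
  have "has_bochner_integral lborel (\<lambda>\<omega>. (cmod (fourier u \<omega>))\<^sup>2) ((L2norm u)\<^sup>2)"
  proof (rule has_bochner_integral_monotone_convergence[OF _ _ _ lim])
    show "integrable lborel (h n)" for n
    proof -
      have "integrable lborel (\<lambda>\<omega>. exp (- (\<omega> / real (Suc n))\<^sup>2) * (cmod (fourier u \<omega>))\<^sup>2)"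
      proof (rule integrable_mult_bounded_real)
        show "integrable lborel (\<lambda>\<omega>. exp (- (\<omega> / real (Suc n))\<^sup>2))"
          by (rule integrable_exp_square) simp
        show "\<bar>(cmod (fourier u \<omega>))\<^sup>2\<bar> \<le> (LINT t|lborel. cmod (u t))\<^sup>2" for \<omega>
          using fourier_le[of u \<omega>] by (simp add: power_mono)
      qed measurable
      then show ?thesis
        by (simp only: h_def[abs_def] mult.commute)
    qed
    show "AE \<omega> in lborel. mono (\<lambda>n. h n \<omega>)"
    proof (intro AE_I2 monoI)
      fix \<omega> :: real and m n :: nat assume "m \<le> n"
      then have "\<bar>\<omega> / real (Suc n)\<bar> \<le> \<bar>\<omega> / real (Suc m)\<bar>"
        by (auto simp: abs_divide intro!: divide_left_mono mult_pos_pos)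
      then have "(\<omega> / real (Suc n))\<^sup>2 \<le> (\<omega> / real (Suc m))\<^sup>2"
        by (rule abs_le_square_iff[THEN iffD1])
      then show "h m \<omega> \<le> h n \<omega>"
        unfolding h_def by (intro mult_left_mono) auto
    qed
    show "AE \<omega> in lborel. (\<lambda>n. h n \<omega>) \<longlonglongrightarrow> (cmod (fourier u \<omega>))\<^sup>2"
    proof (rule AE_I2)
      fix \<omega> :: real
      have "(\<lambda>n. \<omega> / real (Suc n)) \<longlonglongrightarrow> 0"
        using LIMSEQ_Suc[OF lim_const_over_n[of \<omega>]] by simp
      then have "(\<lambda>n. h n \<omega>) \<longlonglongrightarrow> (cmod (fourier u \<omega>))\<^sup>2 * exp (- 0\<^sup>2)"
        unfolding h_def by (intro tendsto_intros)
      then show "(\<lambda>n. h n \<omega>) \<longlonglongrightarrow> (cmod (fourier u \<omega>))\<^sup>2" by simp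
    qed
    show "(\<lambda>\<omega>. (cmod (fourier u \<omega>))\<^sup>2) \<in> borel_measurable lborel"
      by measurable
  qed
  then have *: "integrable lborel (\<lambda>\<omega>. (cmod (fourier u \<omega>))\<^sup>2)"
      "(LINT \<omega>|lborel. (cmod (fourier u \<omega>))\<^sup>2) = (L2norm u)\<^sup>2"
    by (auto simp: has_bochner_integral_iff)
  show "square_integrable (fourier u)"
    using * by (simp add: square_integrable_def)
  show "L2norm (fourier u) = L2norm u"
    using *(2) by (simp add: L2norm_def)
qed

section \<open>Spectral kernels\<close>

lemma L2norm_convolution:
  assumes "integrable lborel f" "square_integrable f" "integrable lborel g"
  shows "(L2norm (f \<star> g))\<^sup>2 = (LINT \<omega>|lborel. (cmod (fourier f \<omega>))\<^sup>2 * (cmod (fourier g \<omega>))\<^sup>2)"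
proof -
  have "(L2norm (f \<star> g))\<^sup>2 = (L2norm (fourier (f \<star> g)))\<^sup>2"
    using Plancherel(2)[OF integrable_convolution[OF assms(1,3)] Young_L2(1)[OF assms(2,3)]] by simp
  then show ?thesis
    using assms by (simp add: L2norm_square fourier_convolution norm_mult power_mult_distrib)
qed

lemma integrable_fourier_square:
  assumes "integrable lborel f" "square_integrable f" "k \<in> borel_measurable lborel" "\<And>\<omega>. \<bar>k \<omega>\<bar> \<le> B"
  shows "integrable lborel (\<lambda>\<omega>. (cmod (fourier f \<omega>))\<^sup>2 * k \<omega>)"
  using Plancherel(1)[OF assms(1,2)] assms(3,4)
  by (intro integrable_mult_bounded_real) (auto simp: square_integrable_def)

lemma modulus_gaussian_energy:
  assumes u: "integrable lborel u" and x: "x > 0"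
  shows "(LINT \<omega>|lborel. (cmod (fourier u \<omega>))\<^sup>2 * exp (- 2 * ((\<omega> - \<eta>) / x)\<^sup>2))
    \<le> (LINT \<omega>|lborel. (cmod (fourier (\<lambda>t. complex_of_real (cmod (u t))) \<omega>))\<^sup>2 * exp (- 2 * (\<omega> / x)\<^sup>2))"
proof (rule modulus_spectral_energy[OF u])
  \<comment> \<open>The exponent 2 arises because the weight is the squared transform of
    \<open>gaussian x\<close>; with this \<open>b\<close> it is itself the transform of
    \<open>gaussian b\<close>.\<close>
  define b where "b = x / sqrt 2"
  have b: "b > 0" using x by (simp add: b_def)
  have eq: "exp (- 2 * (\<omega> / x)\<^sup>2) = exp (- (\<omega> / b)\<^sup>2)" for \<omega>
    using x by (simp add: b_def power_divide power_mult_distrib)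
  show int: "integrable lborel (\<lambda>\<omega>. exp (- 2 * (\<omega> / x)\<^sup>2))"
    unfolding eq by (rule integrable_exp_square[OF b])
  show "integrable lborel (\<lambda>\<omega>. exp (- 2 * ((\<omega> - \<eta>) / x)\<^sup>2))"
    using lborel_integrable_real_affine[OF int, of 1 "- \<eta>"] by simp
  have F: "fourier (\<lambda>\<omega>. complex_of_real (exp (- 2 * (\<omega> / x)\<^sup>2))) t = gaussian b t" for t
    unfolding eq by (rule fourier_exp_square[OF b])
  show "cmod (fourier (\<lambda>\<omega>. complex_of_real (exp (- 2 * ((\<omega> - \<eta>) / x)\<^sup>2))) t)
      \<le> Re (fourier (\<lambda>\<omega>. complex_of_real (exp (- 2 * (\<omega> / x)\<^sup>2))) t)" for t
    using fourier_shift[of "\<lambda>\<omega>. complex_of_real (exp (- 2 * (\<omega> / x)\<^sup>2))" \<eta> t] b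
    by (simp only: F) (simp add: norm_mult gaussian_def)
qed

text \<open>
  \<open>k\<close> is a triangle function supported on \<^term>\<open>{- w..w}\<close>, i.e. the autoconvolution of a box, so that
  its transform is a square; \<open>k'\<close> is its convolution with a Gaussian of integral \<open>1\<close>, whose transform
  is at most \<open>1\<close>.
\<close>

lemma lowpass_kernels:
  fixes w :: real
  assumes w: "w > 0"
  obtains k k' :: "real \<Rightarrow> real" and c :: real
  where "c > 0" "integrable lborel k" "integrable lborel k'"
    "\<forall>\<omega>. 0 \<le> k \<omega>" "\<forall>\<omega>. k \<omega> \<le> 1 / 2" "\<forall>\<omega>. w \<le> \<bar>\<omega>\<bar> \<longrightarrow> k \<omega> = 0"
    "\<forall>\<omega>. k' \<omega> \<le> 1 / 2" "\<forall>\<omega>. c * exp (- (2 * pi\<^sup>2 * \<omega>\<^sup>2)) \<le> k' \<omega>"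
    "\<forall>t. cmod (fourier (\<lambda>\<omega>. complex_of_real (k' \<omega>)) t) \<le> Re (fourier (\<lambda>\<omega>. complex_of_real (k \<omega>)) t)"
proof -
  define box :: "real \<Rightarrow> complex" where "box = indicator {- (w/2)..w/2}"
  have ibox: "integrable lborel box"
  proof -
    have eq: "box = (\<lambda>t. complex_of_real (indicator {- (w/2)..w/2} t))"
      by (auto simp: box_def indicator_def)
    show ?thesis
      unfolding eq by (rule integrable_of_real) (use w in simp)
  qed
  have box_real: "fourier box t = complex_of_real (Re (fourier box t))" for t
  proof -
    have "fourier box (- t) = fourier (\<lambda>s. box (- s)) t"
      by (simp add: fourier_reflect)
    also have "(\<lambda>s. box (- s)) = box"
      by (rule ext) (auto simp: box_def indicator_def)
    also have "fourier box (- t) = cnj (fourier box t)"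
      by (rule fourier_uminus_real) (simp add: box_def split: split_indicator)
    finally have "cnj (fourier box t) = fourier box t" .
    then show ?thesis
      by (simp add: complex_eq_iff)
  qed
  \<comment> \<open>This is the overlap of two intervals of length \<open>w\<close> whose centres
    differ by \<omega>. Division by \<open>2 * w\<close> sets the peak to 1/2, the room that the
    Littlewood-Paley sum will leave at low frequencies.\<close>
  define k where "k = (\<lambda>\<omega>. measure lborel ({- (w/2)..w/2} \<inter> {\<omega> - w/2..\<omega> + w/2}) / (2 * w))"
  have k_eq: "k \<omega> = measure lborel {max (- (w/2)) (\<omega> - w/2)..min (w/2) (\<omega> + w/2)} / (2 * w)" for \<omega>
    unfolding k_def by simp
  have conv: "complex_of_real (k \<omega>) = complex_of_real (1 / (2 * w)) * (box \<star> box) \<omega>" for \<omega>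
  proof -
    have "(box \<star> box) \<omega> = (LINT s|lborel. complex_of_real (indicator ({- (w/2)..w/2} \<inter> {\<omega> - w/2..\<omega> + w/2}) s))"
      unfolding Defs.convolution_def
      by (intro Bochner_Integration.integral_cong) (auto simp: box_def indicator_def)
    also have "\<dots> = complex_of_real (measure lborel ({- (w/2)..w/2} \<inter> {\<omega> - w/2..\<omega> + w/2}))"
      unfolding integral_complex_of_real by simp
    finally show ?thesis by (simp add: k_def)
  qed
  have ikc: "integrable lborel (\<lambda>\<omega>. complex_of_real (k \<omega>))"
    unfolding conv using integrable_convolution[OF ibox ibox] by simp
  have ik: "integrable lborel k"
    using ikc by (simp add: complex_of_real_integrable_eq)
  have fk: "fourier (\<lambda>\<omega>. complex_of_real (k \<omega>)) t = complex_of_real (1 / (2 * w) * (Re (fourier box t))\<^sup>2)" for t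
  proof -
    have "fourier (\<lambda>\<omega>. complex_of_real (k \<omega>)) t = complex_of_real (1 / (2 * w)) * fourier (box \<star> box) t"
      unfolding conv fourier_cis by (simp add: mult.assoc)
    also have "fourier (box \<star> box) t = complex_of_real ((Re (fourier box t))\<^sup>2)"
      unfolding fourier_convolution[OF ibox ibox] using box_real[of t]
      by (metis of_real_mult power2_eq_square)
    finally show ?thesis by simp
  qed
  have k0: "0 \<le> k \<omega>" for \<omega>
    using w by (simp add: k_def)
  have k_half: "k \<omega> \<le> 1 / 2" for \<omega>
    using w by (simp add: k_eq max_def min_def field_simps)
  have k_supp: "k \<omega> = 0" if "w \<le> \<bar>\<omega>\<bar>" for \<omega>
    using w that by (auto simp: k_eq max_def min_def abs_if split: if_splits)
  have k_quarter: "1 / 4 \<le> k \<omega>" if "\<bar>\<omega>\<bar> \<le> w / 2" for \<omega>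
    using w that by (auto simp: k_eq max_def min_def abs_if field_simps split: if_splits)

  define g where "g = (\<lambda>t::real. sqrt pi * exp (- (pi\<^sup>2 * t\<^sup>2)))"
  have gg: "gaussian 1 t = complex_of_real (g t)" for t
    by (simp add: gaussian_def g_def)
  have igc: "integrable lborel (gaussian 1)" "(LINT t|lborel. gaussian 1 t) = 1"
    using integrable_gaussian[of 1] fourier_gaussian[of 1 0] by (simp_all add: fourier_0)
  have ig: "integrable lborel g" "(LINT t|lborel. g t) = 1"
    using igc unfolding gg[abs_def] by (simp_all add: complex_of_real_integrable_eq)
  have ig_shift: "integrable lborel (\<lambda>s. g (\<omega> - s))" for \<omega>
    using lborel_integrable_real_affine[OF ig(1), of "-1" \<omega>] by simp
  have g_shift: "(LINT s|lborel. g (\<omega> - s)) = 1" for \<omega>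
    using lborel_integral_real_affine[of "-1" g \<omega>] ig(2) by simp
  have g0: "0 \<le> g t" for t by (simp add: g_def)
  have [measurable]: "k \<in> borel_measurable borel" using ik by auto
  define k' where "k' = (\<lambda>\<omega>. LINT s|lborel. k s * g (\<omega> - s))"
  have conv': "complex_of_real (k' \<omega>) = ((\<lambda>\<omega>. complex_of_real (k \<omega>)) \<star> gaussian 1) \<omega>" for \<omega>
    unfolding k'_def Defs.convolution_def gg by (simp flip: integral_complex_of_real)
  have ikc': "integrable lborel (\<lambda>\<omega>. complex_of_real (k' \<omega>))"
    unfolding conv' by (rule integrable_convolution[OF ikc igc(1)])
  have ik': "integrable lborel k'"
    using ikc' by (simp add: complex_of_real_integrable_eq)
  have ikg: "integrable lborel (\<lambda>s. k s * g (\<omega> - s))" for \<omega>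
    using integrable_mult_bounded_real[OF ig_shift[of \<omega>], of k "1/2"] k0 k_half
    by (simp add: mult.commute abs_of_nonneg)
  have k'_half: "k' \<omega> \<le> 1 / 2" for \<omega>
  proof -
    have "k' \<omega> \<le> (LINT s|lborel. 1 / 2 * g (\<omega> - s))"
      unfolding k'_def using ikg ig_shift k_half g0 by (intro integral_mono mult_right_mono) auto
    then show ?thesis by (simp add: g_shift)
  qed
  \<comment> \<open>The factors come from integrating over s in an interval of length
    \<open>w\<close>: there k is at least 1/4, and (\<omega> - s)^2 \<le> 2 \<omega>^2 + w^2 / 2
    splits the Gaussian into a constant and a Gaussian in \<omega>.\<close>
  define c where "c = 1 / 4 * sqrt pi * exp (- (pi\<^sup>2 * w\<^sup>2 / 2)) * w"
  have c: "c > 0" using w by (simp add: c_def)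
  have k'_low: "c * exp (- (2 * pi\<^sup>2 * \<omega>\<^sup>2)) \<le> k' \<omega>" for \<omega>
  proof -
    let ?d = "1 / 4 * sqrt pi * exp (- (pi\<^sup>2 * w\<^sup>2 / 2)) * exp (- (2 * pi\<^sup>2 * \<omega>\<^sup>2))"
    have "?d * indicator {- (w/2)..w/2} s \<le> k s * g (\<omega> - s)" for s
    proof (cases "s \<in> {- (w/2)..w/2}")
      case True
      then have s: "\<bar>s\<bar> \<le> w / 2" by auto
      have "(\<omega> - s)\<^sup>2 \<le> 2 * \<omega>\<^sup>2 + 2 * s\<^sup>2"
        using zero_le_power2[of "\<omega> + s"] by (simp add: power2_sum power2_diff)
      also have "\<dots> \<le> 2 * \<omega>\<^sup>2 + w\<^sup>2 / 2"
        using power_mono[OF s, of 2] by (simp add: power_divide)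
      finally have "pi\<^sup>2 * (\<omega> - s)\<^sup>2 \<le> pi\<^sup>2 * (2 * \<omega>\<^sup>2 + w\<^sup>2 / 2)"
        by (intro mult_left_mono) auto
      then have "exp (- (pi\<^sup>2 * w\<^sup>2 / 2)) * exp (- (2 * pi\<^sup>2 * \<omega>\<^sup>2)) \<le> exp (- (pi\<^sup>2 * (\<omega> - s)\<^sup>2))"
        by (simp add: algebra_simps flip: exp_add)
      then have "sqrt pi * (exp (- (pi\<^sup>2 * w\<^sup>2 / 2)) * exp (- (2 * pi\<^sup>2 * \<omega>\<^sup>2))) \<le> g (\<omega> - s)"
        unfolding g_def by (intro mult_left_mono) auto
      then have "1 / 4 * (sqrt pi * (exp (- (pi\<^sup>2 * w\<^sup>2 / 2)) * exp (- (2 * pi\<^sup>2 * \<omega>\<^sup>2)))) \<le> k s * g (\<omega> - s)"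
        by (rule mult_mono[OF k_quarter[OF s]]) (use k0 in auto)
      then show ?thesis using True by (simp add: mult.assoc)
    next
      case False
      then show ?thesis using k0 g0 by simp
    qed
    then have "(LINT s|lborel. ?d * indicator {- (w/2)..w/2} s) \<le> k' \<omega>"
      unfolding k'_def by (rule integral_mono'[OF ikg]) (auto simp: k0 g0)
    then show ?thesis using w by (simp add: c_def mult_ac)
  qed
  have "cmod (fourier (\<lambda>\<omega>. complex_of_real (k' \<omega>)) t) \<le> Re (fourier (\<lambda>\<omega>. complex_of_real (k \<omega>)) t)" for t
  proof -
    have "fourier (\<lambda>\<omega>. complex_of_real (k' \<omega>)) t
        = fourier (\<lambda>\<omega>. complex_of_real (k \<omega>)) t * complex_of_real (exp (- (t / 1)\<^sup>2))"
      unfolding conv' by (subst fourier_convolution[OF ikc igc(1)]) (simp only: fourier_gaussian zero_less_one)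
    then have "cmod (fourier (\<lambda>\<omega>. complex_of_real (k' \<omega>)) t) \<le> cmod (fourier (\<lambda>\<omega>. complex_of_real (k \<omega>)) t)"
      by (simp add: norm_mult mult_left_le)
    also have "\<dots> = Re (fourier (\<lambda>\<omega>. complex_of_real (k \<omega>)) t)"
      unfolding fk norm_of_real using w by simp
    finally show ?thesis .
  qed
  then show ?thesis
    using k0 k_half k_supp k'_half k'_low by (intro that[OF c ik ik'] allI impI) auto
qed

section \<open>Scalar inequalities\<close>

text \<open>Jensen's inequality for the concave function 1 - exp (- y) with total weight at most 1.
  The tangent at the weighted sum \<open>Y\<close> has a nonnegative intercept, so missing weight
  can only lower the left side.\<close>

lemma weighted_one_minus_exp_le:
  fixes w y :: "'a \<Rightarrow> real"
  assumes fin: "finite F" and w: "\<And>i. i \<in> F \<Longrightarrow> 0 \<le> w i" and W: "sum w F \<le> 1"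
  shows "(\<Sum>i\<in>F. w i * (1 - exp (- y i))) \<le> 1 - exp (- (\<Sum>i\<in>F. w i * y i))"
proof -
  define Y where "Y = (\<Sum>i\<in>F. w i * y i)"
  have tangent: "1 - exp (- y i) \<le> 1 - exp (- Y) * (1 + Y) + exp (- Y) * y i" for i
  proof -
    have "exp (- Y) * (1 + (Y - y i)) \<le> exp (- Y) * exp (Y - y i)"
      by (intro mult_left_mono exp_ge_add_one_self) simp
    then have "exp (- Y) * (1 + (Y - y i)) \<le> exp (- y i)"
      by (simp flip: exp_add)
    then show ?thesis by (simp add: algebra_simps)
  qed
  have "(\<Sum>i\<in>F. w i * (1 - exp (- y i))) \<le> (\<Sum>i\<in>F. w i * (1 - exp (- Y) * (1 + Y) + exp (- Y) * y i))"
    using w tangent by (intro sum_mono mult_left_mono) auto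
  also have "\<dots> = sum w F * (1 - exp (- Y) * (1 + Y)) + exp (- Y) * Y"
    unfolding Y_def sum_distrib_left sum_distrib_right sum.distrib[symmetric]
    by (intro sum.cong refl) (simp add: Y_def algebra_simps)
  also have "\<dots> \<le> 1 * (1 - exp (- Y) * (1 + Y)) + exp (- Y) * Y"
  proof (intro add_right_mono mult_right_mono W)
    have "exp (- Y) * (1 + Y) \<le> exp (- Y) * exp Y"
      by (intro mult_left_mono exp_ge_add_one_self) simp
    then show "0 \<le> 1 - exp (- Y) * (1 + Y)" by (simp flip: exp_add)
  qed
  also have "\<dots> = 1 - exp (- Y)" by (simp add: algebra_simps)
  finally show ?thesis by (simp add: Y_def)
qed

text \<open>Two regimes. While M \<omega>^2 \<le> 1/2, the quadratic bound on S is enough. Beyond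
  that S is only known to be at most 1, and the Gaussian gap in the second factor must absorb exp (-
  2 (\<omega> / \<rho>)^2).\<close>

lemma lowpass_le_gaussian_complement:
  fixes M c C :: real
  assumes M: "M > 0" and c: "0 < c" "c \<le> 1" and C: "C \<ge> 0"
  obtains \<rho> where "\<rho> > 0"
    "\<And>S \<omega>. 0 \<le> S \<Longrightarrow> S \<le> 1 \<Longrightarrow> S \<le> M * \<omega>\<^sup>2 \<Longrightarrow>
      S * (1 - c * exp (- (C * \<omega>\<^sup>2))) \<le> 1 - exp (- 2 * (\<omega> / \<rho>)\<^sup>2)"
proof -
  define L where "L = - ln c"
  have L: "L \<ge> 0" "exp (- L) = c"
    using c by (auto simp: L_def)
  \<comment> \<open>\<open>M\<close> serves the first regime and \<open>C\<close> matches the decay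
    of the gap. The term \<open>2 * M * L\<close> pays for the constant c = exp (- L), since 1 \<le>
    2 M \<omega>^2 in the second regime.\<close>
  define D where "D = M + C + 2 * M * L"
  have D: "D > 0" "M \<le> D"
    using M C L by (auto simp: D_def add_pos_nonneg)
  define \<rho> where "\<rho> = 1 / sqrt D"
  have \<rho>: "\<rho> > 0" "\<And>\<omega>. (\<omega> / \<rho>)\<^sup>2 = D * \<omega>\<^sup>2"
    using D by (auto simp: \<rho>_def power_mult_distrib)
  show ?thesis
  proof (rule that[OF \<rho>(1)])
    fix S \<omega> :: real assume S: "0 \<le> S" "S \<le> 1" "S \<le> M * \<omega>\<^sup>2"
    have ce: "0 \<le> c * exp (- (C * \<omega>\<^sup>2))" "c * exp (- (C * \<omega>\<^sup>2)) \<le> 1"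
      using c C by (auto intro!: mult_le_one)
    show "S * (1 - c * exp (- (C * \<omega>\<^sup>2))) \<le> 1 - exp (- 2 * (\<omega> / \<rho>)\<^sup>2)"
    proof (cases "2 * (M * \<omega>\<^sup>2) \<le> 1")
      case True
      define y where "y = 2 * (D * \<omega>\<^sup>2)"
      have y: "0 \<le> y" "2 * (M * \<omega>\<^sup>2) \<le> y"
        using D by (auto simp: y_def mult_right_mono)
      have "exp (- y) \<le> 1 / (1 + y)"
        using exp_ge_add_one_self[of y] y by (simp add: exp_minus field_simps)
      also have "\<dots> \<le> 1 - M * \<omega>\<^sup>2"
      proof -
        define m where "m = M * \<omega>\<^sup>2"
        have m: "0 \<le> m" "2 * m \<le> 1" "2 * m \<le> y"
          using True y M by (auto simp: m_def)
        have "m * y \<le> y / 2" using mult_right_mono[of m "1/2" y] m y(1) by simp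
        then have "1 \<le> (1 - m) * (1 + y)" using m by (simp add: algebra_simps)
        then show ?thesis using y(1) by (simp add: m_def divide_le_eq)
      qed
      finally have "S \<le> 1 - exp (- y)" using S by simp
      moreover have "S * (1 - c * exp (- (C * \<omega>\<^sup>2))) \<le> S"
        using S ce by (intro mult_left_le) auto
      ultimately show ?thesis by (simp add: \<rho> y_def)
    next
      case False
      then have "L * 1 \<le> L * (2 * (M * \<omega>\<^sup>2))"
        using L by (intro mult_left_mono) auto
      moreover have "0 \<le> M * \<omega>\<^sup>2" "0 \<le> C * \<omega>\<^sup>2" "0 \<le> L * (2 * (M * \<omega>\<^sup>2))"
        using M C L by auto
      ultimately have "L + C * \<omega>\<^sup>2 \<le> 2 * (D * \<omega>\<^sup>2)"
        by (simp add: D_def algebra_simps)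
      then have "exp (- 2 * (\<omega> / \<rho>)\<^sup>2) \<le> exp (- L + - (C * \<omega>\<^sup>2))"
        by (simp add: \<rho>)
      then have "exp (- 2 * (\<omega> / \<rho>)\<^sup>2) \<le> c * exp (- (C * \<omega>\<^sup>2))"
        by (simp only: exp_add L)
      moreover have "S * (1 - c * exp (- (C * \<omega>\<^sup>2))) \<le> 1 * (1 - c * exp (- (C * \<omega>\<^sup>2)))"
        using S ce by (intro mult_right_mono) auto
      ultimately show ?thesis by simp
    qed
  qed
qed

section \<open>Littlewood-Paley sums\<close>

lemma sum_geometric_int_le:
  fixes q :: real
  assumes q: "0 < q" "q < 1" and F: "finite (F :: int set)"
  shows "(\<Sum>j\<in>F. q ^ nat \<bar>j\<bar>) \<le> 2 / (1 - q)"
proof -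
  have geo: "(\<Sum>j\<in>G. q ^ nat \<bar>j\<bar>) \<le> 1 / (1 - q)" if "finite G" "inj_on (\<lambda>j. nat \<bar>j\<bar>) G" for G :: "int set"
  proof -
    have "(\<Sum>j\<in>G. q ^ nat \<bar>j\<bar>) = (\<Sum>n\<in>(\<lambda>j. nat \<bar>j\<bar>) ` G. q ^ n)"
      by (simp add: sum.reindex[OF that(2)])
    also have "\<dots> \<le> (\<Sum>n. q ^ n)"
      using q that(1) by (intro sum_le_suminf summable_geometric) auto
    also have "\<dots> = 1 / (1 - q)"
      using q by (simp add: suminf_geometric)
    finally show ?thesis .
  qed
  have "(\<Sum>j\<in>F. q ^ nat \<bar>j\<bar>) = (\<Sum>j\<in>{j\<in>F. 0 \<le> j}. q ^ nat \<bar>j\<bar>) + (\<Sum>j\<in>{j\<in>F. j < 0}. q ^ nat \<bar>j\<bar>)"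
    using F by (subst sum.union_disjoint[symmetric]) (auto intro: sum.cong)
  also have "\<dots> \<le> 1 / (1 - q) + 1 / (1 - q)"
    using F by (intro add_mono geo) (auto simp: inj_on_def)
  finally show ?thesis by simp
qed

lemma two_powi: "(2::real) powi n = 2 powr real_of_int n"
  by (simp add: powr_real_of_int')

lemma dyadic_normalize:
  assumes "\<omega> > (0::real)"
  obtains n :: int where "2 powi n \<le> \<omega>" "\<omega> < 2 powi (n + 1)"
proof (rule that[of "\<lfloor>log 2 \<omega>\<rfloor>"])
  have "2 powr real_of_int \<lfloor>log 2 \<omega>\<rfloor> \<le> 2 powr log 2 \<omega>"
    by (intro powr_mono) auto
  then show "2 powi \<lfloor>log 2 \<omega>\<rfloor> \<le> \<omega>"
    using assms unfolding two_powi by simp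
  have "2 powr log 2 \<omega> < 2 powr real_of_int (\<lfloor>log 2 \<omega>\<rfloor> + 1)"
    by (intro powr_less_mono) linarith+
  then show "\<omega> < 2 powi (\<lfloor>log 2 \<omega>\<rfloor> + 1)"
    using assms unfolding two_powi by simp
qed

text \<open>Below, \<open>P\<close> stands for the modulus of the Fourier transform of the wavelet.\<close>

locale littlewood_paley =
  fixes P :: "real \<Rightarrow> real"
  assumes P_cont: "continuous_on UNIV P"
    and P_nonneg: "\<And>u. 0 \<le> P u"
    and P_sum: "\<And>F \<omega>. finite F \<Longrightarrow> 1 / 2 * (\<Sum>j\<in>F. (P (2 powi j * \<omega>))\<^sup>2 + (P (- (2 powi j * \<omega>)))\<^sup>2) \<le> 1"
    and P_asym: "\<And>u. u > 0 \<Longrightarrow> P (- u) \<le> P u"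
    and P_strict: "\<And>\<omega>. \<omega> > 0 \<Longrightarrow> \<exists>j::int. P (- (2 powi j * \<omega>)) < P (2 powi j * \<omega>)"
    and P_decay: "\<exists>\<epsilon>>0. P \<in> O[at 0](\<lambda>\<omega>. \<bar>\<omega>\<bar> powr (1 + \<epsilon>))"
begin

lemma P_pair_le: "(P u)\<^sup>2 + (P (- u))\<^sup>2 \<le> 2"
  using P_sum[of "{0}" u] by simp

text \<open>The quotient decays geometrically in both directions: near 0 the decay of
  \<open>P\<close> makes it O(u powr (2 * \<epsilon>)), and for large u the pair bound makes it at
  most 2 / u^2.\<close>

lemma P_pair_dyadic_bound:
  obtains K q where "K > 0" "0 < q" "q < 1"
    "\<And>u m. 2 powi m \<le> u \<Longrightarrow> u < 2 powi (m + 1) \<Longrightarrow> ((P u)\<^sup>2 + (P (- u))\<^sup>2) / u\<^sup>2 \<le> K * q ^ nat \<bar>m\<bar>"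
proof -
  obtain \<epsilon> where \<epsilon>: "\<epsilon> > 0" "P \<in> O[at 0](\<lambda>\<omega>. \<bar>\<omega>\<bar> powr (1 + \<epsilon>))"
    using P_decay by blast
  obtain c where c: "c > 0" "\<forall>\<^sub>F x in at 0. norm (P x) \<le> c * norm (\<bar>x\<bar> powr (1 + \<epsilon>))"
    using \<epsilon>(2) by (elim landau_o.bigE)
  obtain d where d: "d > 0" "\<And>x. x \<noteq> 0 \<Longrightarrow> \<bar>x\<bar> < d \<Longrightarrow> P x \<le> c * \<bar>x\<bar> powr (1 + \<epsilon>)"
    using c(2) P_nonneg unfolding eventually_at by (auto simp: dist_real_def)
  \<comment> \<open>The second entry extends the estimate past \<open>d\<close>: there the quotient
    is at most 2 / d^2, which is again a multiple of u powr (2 * \<epsilon>).\<close>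
  define K1 where "K1 = max (2 * c\<^sup>2) (2 / (d\<^sup>2 * d powr (2 * \<epsilon>)))"
  have K1: "K1 > 0" using c by (simp add: K1_def less_max_iff_disj)
  have small: "((P u)\<^sup>2 + (P (- u))\<^sup>2) / u\<^sup>2 \<le> K1 * u powr (2 * \<epsilon>)" if u: "0 < u" for u
  proof (cases "u < d")
    case True
    have "(P x)\<^sup>2 \<le> c\<^sup>2 * (u\<^sup>2 * u powr (2 * \<epsilon>))" if "\<bar>x\<bar> = u" for x
    proof -
      have "(P x)\<^sup>2 \<le> (c * \<bar>x\<bar> powr (1 + \<epsilon>))\<^sup>2"
        using d(2)[of x] True u that by (intro power_mono P_nonneg) auto
      also have "\<dots> = c\<^sup>2 * (u\<^sup>2 * u powr (2 * \<epsilon>))"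
      proof -
        have "u powr (1 + \<epsilon>) = u * u powr \<epsilon>" "u powr (2 * \<epsilon>) = u powr \<epsilon> * u powr \<epsilon>"
          using u by (simp_all only: powr_add powr_one less_imp_le mult_2)
        then show ?thesis
          unfolding that by (simp only: power2_eq_square) (simp only: mult_ac)
      qed
      finally show ?thesis .
    qed
    from this[of u] this[of "- u"] have "(P u)\<^sup>2 + (P (- u))\<^sup>2 \<le> 2 * c\<^sup>2 * u powr (2 * \<epsilon>) * u\<^sup>2"
      using u by (simp add: mult_ac)
    then have "((P u)\<^sup>2 + (P (- u))\<^sup>2) / u\<^sup>2 \<le> 2 * c\<^sup>2 * u powr (2 * \<epsilon>)"
      using u by (simp add: divide_le_eq)
    also have "\<dots> \<le> K1 * u powr (2 * \<epsilon>)"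
      by (intro mult_right_mono) (auto simp: K1_def)
    finally show ?thesis .
  next
    case False
    have "((P u)\<^sup>2 + (P (- u))\<^sup>2) / u\<^sup>2 \<le> 2 / d\<^sup>2"
      using P_pair_le[of u] False d(1) by (intro frac_le) auto
    also have "\<dots> = 2 / (d\<^sup>2 * d powr (2 * \<epsilon>)) * d powr (2 * \<epsilon>)"
      using d(1) by simp
    also have "\<dots> \<le> K1 * u powr (2 * \<epsilon>)"
      using False d(1) \<epsilon>(1) K1 by (intro mult_mono powr_mono2) (auto simp: K1_def)
    finally show ?thesis .
  qed
  \<comment> \<open>The rate is (1/4) powr \<epsilon> for shells below 1 and 1/4 for shells above 1;
    the larger one serves both.\<close>
  define q where "q = max ((1/4) powr \<epsilon>) (1 / 4 :: real)"
  have q: "0 < q" "q < 1"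
    using \<epsilon>(1) powr_less_mono'[of "1/4::real" 0 \<epsilon>] by (auto simp: q_def less_max_iff_disj)
  define K where "K = max (K1 * 4 powr \<epsilon>) 2"
  show ?thesis
  proof (rule that[of K q])
    show "K > 0" by (simp add: K_def less_max_iff_disj)
    fix u :: real and m :: int assume m: "2 powi m \<le> u" "u < 2 powi (m + 1)"
    have u: "0 < u" using m(1) by (rule less_le_trans[rotated]) simp
    show "((P u)\<^sup>2 + (P (- u))\<^sup>2) / u\<^sup>2 \<le> K * q ^ nat \<bar>m\<bar>"
    proof (cases "m \<ge> 0")
      case True
      have "((P u)\<^sup>2 + (P (- u))\<^sup>2) / u\<^sup>2 \<le> 2 / (2 ^ nat m)\<^sup>2"
      proof (intro frac_le P_pair_le power_mono)
        show "2 ^ nat m \<le> u" using m(1) True by (simp add: power_int_def)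
      qed auto
      also have "\<dots> = 2 * (1 / 4) ^ nat m"
        by (simp add: power_one_over power2_eq_square flip: power_mult_distrib)
      also have "\<dots> \<le> K * q ^ nat \<bar>m\<bar>"
        using True by (simp only: abs_of_nonneg, intro mult_mono power_mono) (auto simp: K_def q_def)
      finally show ?thesis .
    next
      case False
      have "u powr (2 * \<epsilon>) \<le> (2 powi (m + 1)) powr (2 * \<epsilon>)"
        using m u \<epsilon>(1) by (intro powr_mono2) auto
      also have "\<dots> = 2 powr (real_of_int (m + 1) * (2 * \<epsilon>))"
        unfolding two_powi powr_powr ..
      also have "\<dots> = 2 powr (2 * \<epsilon> + (2 * \<epsilon>) * real_of_int m)"
        by (simp add: algebra_simps)
      also have "\<dots> = 4 powr \<epsilon> * ((1/4) powr \<epsilon>) ^ nat \<bar>m\<bar>"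
      proof -
        have "(2::real) powr (2 * \<epsilon>) = (2 powr 2) powr \<epsilon>"
          by (simp only: powr_powr)
        then have *: "(2::real) powr (2 * \<epsilon>) = 4 powr \<epsilon>" by simp
        have "((1/4::real) powr \<epsilon>) ^ nat \<bar>m\<bar> = (1/4) powr (\<epsilon> * real (nat \<bar>m\<bar>))"
          by (simp flip: powr_realpow add: powr_powr)
        also have "\<dots> = (2 powr (- 2)) powr (\<epsilon> * real (nat \<bar>m\<bar>))"
          by (simp add: powr_minus_divide)
        also have "\<dots> = 2 powr ((2 * \<epsilon>) * real_of_int m)"
          unfolding powr_powr using False by (simp add: mult_ac)
        finally show ?thesis by (simp add: powr_add *)
      qed
      finally have "K1 * u powr (2 * \<epsilon>) \<le> K1 * (4 powr \<epsilon> * ((1/4) powr \<epsilon>) ^ nat \<bar>m\<bar>)"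
        using K1 by (intro mult_left_mono) auto
      also have "\<dots> = (K1 * 4 powr \<epsilon>) * ((1/4) powr \<epsilon>) ^ nat \<bar>m\<bar>" by simp
      also have "\<dots> \<le> K * q ^ nat \<bar>m\<bar>"
        by (intro mult_mono power_mono) (auto simp: K_def q_def le_max_iff_disj)
      finally show ?thesis using small[OF u] by linarith
    qed
  qed (fact q)+
qed

text \<open>Different scales place 2 powi j * \<omega> in different dyadic shells, so the shell
  bounds add up to a geometric series. The sum is the second-order cost of the frequency shifts, and
  also the source of the O(\<omega>^2) bound at low frequencies.\<close>

lemma P_weighted_sum_bound:
  obtains M where "M > 0"
    "\<And>F \<omega>. finite F \<Longrightarrow> \<omega> > 0 \<Longrightarrow>
      (\<Sum>j\<in>F. ((P (2 powi j * \<omega>))\<^sup>2 + (P (- (2 powi j * \<omega>)))\<^sup>2) / (2 powi j * \<omega>)\<^sup>2) \<le> M"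
proof -
  obtain K q where K: "K > 0" and q: "0 < q" "q < 1"
    and bound: "\<And>u m. 2 powi m \<le> u \<Longrightarrow> u < 2 powi (m + 1) \<Longrightarrow> ((P u)\<^sup>2 + (P (- u))\<^sup>2) / u\<^sup>2 \<le> K * q ^ nat \<bar>m\<bar>"
    using P_pair_dyadic_bound by blast
  show ?thesis
  proof (rule that[of "K * (2 / (1 - q))"])
    show "0 < K * (2 / (1 - q))" using K q by simp
    fix F :: "int set" and \<omega> :: real assume F: "finite F" and \<omega>: "\<omega> > 0"
    obtain n where n: "2 powi n \<le> \<omega>" "\<omega> < 2 powi (n + 1)"
      using dyadic_normalize[OF \<omega>] .
    have "(\<Sum>j\<in>F. ((P (2 powi j * \<omega>))\<^sup>2 + (P (- (2 powi j * \<omega>)))\<^sup>2) / (2 powi j * \<omega>)\<^sup>2)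
       \<le> (\<Sum>j\<in>F. K * q ^ nat \<bar>j + n\<bar>)"
    proof (intro sum_mono bound)
      fix j :: int
      have "2 powi (j + n) = (2::real) powi j * 2 powi n" "2 powi (j + n + 1) = (2::real) powi j * 2 powi (n + 1)"
        by (simp_all add: power_int_add)
      then show "2 powi (j + n) \<le> 2 powi j * \<omega>" "2 powi j * \<omega> < 2 powi (j + n + 1)"
        using n by (simp_all add: mult_left_mono)
    qed
    also have "\<dots> = K * (\<Sum>i\<in>(\<lambda>j. j + n) ` F. q ^ nat \<bar>i\<bar>)"
      by (simp add: sum_distrib_left sum.reindex)
    also have "\<dots> \<le> K * (2 / (1 - q))"
      using K F by (intro mult_left_mono sum_geometric_int_le q) auto
    finally show "(\<Sum>j\<in>F. ((P (2 powi j * \<omega>))\<^sup>2 + (P (- (2 powi j * \<omega>)))\<^sup>2) / (2 powi j * \<omega>)\<^sup>2)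
       \<le> K * (2 / (1 - q))" .
  qed
qed

text \<open>By continuity, the frequencies at which some scale with index between -n and n shows a
  gap above 1 / (n + 1) form an open set, increasing in n. These sets cover the compact octave from
  1 to 2, so one n suffices there; a dyadic rescaling of \<omega> only re-indexes j.\<close>

lemma P_uniform_asymmetry:
  obtains c R where "c > 0" "R > 0"
    "\<And>\<omega>. \<omega> > 0 \<Longrightarrow> \<exists>j::int. 2 powi j * \<omega> \<le> R \<and> c \<le> (P (2 powi j * \<omega>))\<^sup>2 - (P (- (2 powi j * \<omega>)))\<^sup>2"
proof -
  define D where "D u = (P u)\<^sup>2 - (P (- u))\<^sup>2" for u
  have Dcont: "continuous_on UNIV (\<lambda>\<omega>. D (2 powi j * \<omega>))" for j :: int
  proof -
    have *: "continuous_on UNIV (\<lambda>\<omega>. P (a * \<omega>))" for a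
      by (rule continuous_on_compose2[OF P_cont]) (auto intro!: continuous_intros)
    show ?thesis
      unfolding D_def using *[of "2 powi j"] *[of "- (2 powi j)"] by (auto intro!: continuous_intros)
  qed
  define Op where "Op n = (\<Union>j\<in>{- int n..int n}. {\<omega>. 1 / real (Suc n) < D (2 powi j * \<omega>)})" for n :: nat
  have Op_open: "open (Op n)" for n
    unfolding Op_def by (intro open_UN ballI open_Collect_less Dcont continuous_on_const)
  have Op_mono: "Op m \<subseteq> Op n" if "m \<le> n" for m n
  proof
    fix \<omega> assume "\<omega> \<in> Op m"
    then obtain j where "j \<in> {- int m..int m}" "1 / real (Suc m) < D (2 powi j * \<omega>)"
      by (auto simp: Op_def)
    moreover have "1 / real (Suc n) \<le> 1 / real (Suc m)"
      using that by (intro divide_left_mono) auto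
    ultimately show "\<omega> \<in> Op n"
      using that unfolding Op_def by (intro UN_I[of j]) auto
  qed
  have cover: "{1..2} \<subseteq> (\<Union>n\<in>UNIV. Op n)"
  proof
    fix \<omega> :: real assume "\<omega> \<in> {1..2}"
    then obtain j :: int where "P (- (2 powi j * \<omega>)) < P (2 powi j * \<omega>)"
      using P_strict[of \<omega>] by auto
    then have D: "0 < D (2 powi j * \<omega>)"
      using P_nonneg by (simp add: D_def power_strict_mono)
    obtain n1 where n1: "1 / real (Suc n1) < D (2 powi j * \<omega>)"
      using reals_Archimedean[OF D] by (auto simp: inverse_eq_divide)
    define n where "n = max n1 (nat \<bar>j\<bar>)"
    have "1 / real (Suc n) \<le> 1 / real (Suc n1)"
      by (intro divide_left_mono) (auto simp: n_def)
    then have "\<omega> \<in> Op n"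
      unfolding Op_def using n1 by (intro UN_I[of j]) (auto simp: n_def)
    then show "\<omega> \<in> (\<Union>n\<in>UNIV. Op n)" by blast
  qed
  obtain N where N: "finite N" "{1..2} \<subseteq> (\<Union>n\<in>N. Op n)"
    using compactE_image[OF compact_Icc, of UNIV Op 1 2] Op_open cover by metis
  define n where "n = Max (insert 0 N)"
  have n: "{1..2} \<subseteq> Op n"
  proof -
    have "Op m \<subseteq> Op n" if "m \<in> N" for m
      using N(1) that by (intro Op_mono) (simp add: n_def)
    then show ?thesis using N(2) by blast
  qed
  show ?thesis
  \<comment> \<open>The value of R bounds 2 powi j * v for j \<le> n and normalised frequency v
    \<le> 2.\<close>
  proof (rule that[of "1 / real (Suc n)" "2 powi (int n + 1)"])
    fix \<omega> :: real assume \<omega>: "\<omega> > 0"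
    obtain m where m: "2 powi m \<le> \<omega>" "\<omega> < 2 powi (m + 1)"
      using dyadic_normalize[OF \<omega>] .
    define v where "v = 2 powi (- m) * \<omega>"
    have v: "1 \<le> v" "v \<le> 2"
      using m by (auto simp: v_def power_int_minus power_int_add field_simps)
    then obtain j where j: "j \<in> {- int n..int n}" "1 / real (Suc n) < D (2 powi j * v)"
      using n by (auto simp: Op_def)
    have eq: "2 powi j * v = 2 powi (j - m) * \<omega>"
      by (simp add: v_def power_int_diff power_int_minus field_simps)
    have "2 powi j * v \<le> 2 powi (int n) * 2"
      using j v by (intro mult_mono power_int_increasing) auto
    also have "\<dots> = 2 powi (int n + 1)"
      by (simp add: power_int_add)
    finally show "\<exists>j::int. 2 powi j * \<omega> \<le> 2 powi (int n + 1)
        \<and> 1 / real (Suc n) \<le> (P (2 powi j * \<omega>))\<^sup>2 - (P (- (2 powi j * \<omega>)))\<^sup>2"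
      using j(2) unfolding eq D_def by (intro exI[of _ "j - m"]) auto
  qed auto
qed

text \<open>
  Frequency shifts \<open>\<delta> * 2 powi (- j)\<close> move the mass at \<open>\<omega>\<close> towards the origin because of the asymmetry
  of \<open>P\<close>; a scale witnessing the asymmetry which is missing in \<open>F\<close> leaves room in the
  Littlewood-Paley sum instead.
\<close>

lemma frequency_contraction:
  obtains \<kappa> \<delta> where "0 < \<kappa>" "\<kappa> < 1"
    "\<And>F \<omega>. finite F \<Longrightarrow> \<omega> > 0 \<Longrightarrow>
      1 / 2 * (\<Sum>j\<in>F. (P (2 powi j * \<omega>))\<^sup>2 * (\<omega> - \<delta> * 2 powi (- j))\<^sup>2
        + (P (- (2 powi j * \<omega>)))\<^sup>2 * (\<omega> + \<delta> * 2 powi (- j))\<^sup>2) \<le> (1 - \<kappa>) * \<omega>\<^sup>2"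
proof -
  obtain M where M: "M > 0" and Mb: "\<And>F \<omega>. finite F \<Longrightarrow> \<omega> > 0 \<Longrightarrow>
      (\<Sum>j\<in>F. ((P (2 powi j * \<omega>))\<^sup>2 + (P (- (2 powi j * \<omega>)))\<^sup>2) / (2 powi j * \<omega>)\<^sup>2) \<le> M"
    using P_weighted_sum_bound by blast
  obtain c R where c: "c > 0" "R > 0" and
    gain: "\<And>\<omega>. \<omega> > 0 \<Longrightarrow> \<exists>j::int. 2 powi j * \<omega> \<le> R \<and> c \<le> (P (2 powi j * \<omega>))\<^sup>2 - (P (- (2 powi j * \<omega>)))\<^sup>2"
    using P_uniform_asymmetry by blast
  \<comment> \<open>The bound c / (R * M) keeps the quadratic cost at most half of the linear gain
    \<delta> * c / R. The bound R / 2 keeps that gain at most c / 2, which is the room left when the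
    witnessing scale lies outside F.\<close>
  define \<delta> where "\<delta> = min (R / 2) (c / (R * M))"
  have \<delta>: "\<delta> > 0" "\<delta> \<le> R / 2" "\<delta> \<le> c / (R * M)"
    unfolding \<delta>_def using c M by (simp_all only: min.cobounded1 min.cobounded2) simp
  \<comment> \<open>Half of the linear gain survives the cost; the cap 1/2 ensures \<kappa> <
    1.\<close>
  define \<kappa> where "\<kappa> = min (\<delta> * c / (2 * R)) (1 / 2)"
  have d1: "\<delta> * c / R \<le> c / 2"
    using mult_right_mono[OF \<delta>(2), of c] c by (simp add: field_simps)
  have d2: "\<delta>\<^sup>2 * M \<le> \<delta> * c / R"
  proof -
    have "\<delta> * \<delta> * M \<le> \<delta> * (c / (R * M)) * M"
      using \<delta> M by (intro mult_right_mono mult_left_mono) auto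
    then show ?thesis using M by (simp add: power2_eq_square)
  qed
  show ?thesis
  proof (rule that[of \<kappa> \<delta>])
    show "0 < \<kappa>" "\<kappa> < 1" using c \<delta> by (auto simp: \<kappa>_def)
    fix F :: "int set" and \<omega> :: real assume F: "finite F" and \<omega>: "\<omega> > 0"
    define u where "u j = 2 powi j * \<omega>" for j :: int
    define A B where "A j = (P (u j))\<^sup>2" and "B j = (P (- (u j)))\<^sup>2" for j :: int
    have u: "u j > 0" for j using \<omega> by (simp add: u_def)
    have AB: "0 \<le> A j" "0 \<le> B j" "B j \<le> A j" for j
      using P_asym[OF u] P_nonneg by (auto simp: A_def B_def power_mono)
    \<comment> \<open>Relative to \<omega> the shift depends on u j alone, so expanding the squares
      produces exactly the two sums bounded above.\<close>
    have shift: "\<delta> * 2 powi (- j) = \<omega> * (\<delta> / u j)" for j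
      using \<omega> by (simp add: u_def power_int_minus field_simps)
    have summand: "A j * (\<omega> - \<delta> * 2 powi (- j))\<^sup>2 + B j * (\<omega> + \<delta> * 2 powi (- j))\<^sup>2
        = \<omega>\<^sup>2 * ((A j + B j) - 2 * \<delta> * ((A j - B j) / u j) + \<delta>\<^sup>2 * ((A j + B j) / (u j)\<^sup>2))" for j
      unfolding shift using u[of j] by (simp add: power2_eq_square field_simps)
    have sum_eq: "1 / 2 * (\<Sum>j\<in>F. A j * (\<omega> - \<delta> * 2 powi (- j))\<^sup>2 + B j * (\<omega> + \<delta> * 2 powi (- j))\<^sup>2)
       = \<omega>\<^sup>2 * (1 / 2 * (\<Sum>j\<in>F. A j + B j) - \<delta> * (\<Sum>j\<in>F. (A j - B j) / u j)
            + \<delta>\<^sup>2 / 2 * (\<Sum>j\<in>F. (A j + B j) / (u j)\<^sup>2))"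
      unfolding summand sum_distrib_left[symmetric] sum.distrib sum_subtractf
      by (simp add: algebra_simps)
    have Mb': "(\<Sum>j\<in>F. (A j + B j) / (u j)\<^sup>2) \<le> M"
      using Mb[OF F \<omega>] by (simp add: A_def B_def u_def)
    have S1: "1 / 2 * (\<Sum>j\<in>G. A j + B j) \<le> 1" if "finite G" for G
      using P_sum[OF that, of \<omega>] by (simp add: A_def B_def u_def)
    have pos: "0 \<le> (A j - B j) / u j" for j
      using AB u[of j] by simp
    obtain i where i: "u i \<le> R" "c \<le> A i - B i"
      using gain[OF \<omega>] by (auto simp: A_def B_def u_def)
    have main: "1 / 2 * (\<Sum>j\<in>F. A j + B j) - \<delta> * (\<Sum>j\<in>F. (A j - B j) / u j) \<le> 1 - \<delta> * c / R"
    proof (cases "i \<in> F")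
      case True
      have "c / R \<le> (A i - B i) / u i"
        using i c u[of i] by (intro frac_le) auto
      also have "\<dots> \<le> (\<Sum>j\<in>F. (A j - B j) / u j)"
        using True F pos by (intro member_le_sum) auto
      finally have "\<delta> * (c / R) \<le> \<delta> * (\<Sum>j\<in>F. (A j - B j) / u j)"
        using \<delta>(1) by (intro mult_left_mono) auto
      then show ?thesis using S1[OF F] by simp
    next
      case False
      have "1 / 2 * (\<Sum>j\<in>F. A j + B j) + 1 / 2 * (A i + B i) \<le> 1"
        using S1[of "insert i F"] F False by (simp add: field_simps)
      moreover have "c \<le> A i + B i" using i(2) AB[of i] by linarith
      moreover have "0 \<le> \<delta> * (\<Sum>j\<in>F. (A j - B j) / u j)"
        using \<delta>(1) pos by (intro mult_nonneg_nonneg sum_nonneg) auto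
      moreover have "1 / 2 * x - t \<le> 1 - d" if "1 / 2 * x + 1 / 2 * y \<le> 1" "c \<le> y" "0 \<le> t" "d \<le> c / 2"
        for x y t d :: real
        using that by linarith
      ultimately show ?thesis using d1 by blast
    qed
    have "\<delta>\<^sup>2 / 2 * (\<Sum>j\<in>F. (A j + B j) / (u j)\<^sup>2) \<le> \<delta>\<^sup>2 / 2 * M"
      by (intro mult_left_mono Mb') auto
    also have "\<dots> \<le> \<delta> * c / R / 2" using d2 by simp
    finally have "1 / 2 * (\<Sum>j\<in>F. A j + B j) - \<delta> * (\<Sum>j\<in>F. (A j - B j) / u j)
            + \<delta>\<^sup>2 / 2 * (\<Sum>j\<in>F. (A j + B j) / (u j)\<^sup>2) \<le> 1 - \<delta> * c / R + \<delta> * c / R / 2"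
      by (intro add_mono main)
    also have "\<dots> = 1 - \<delta> * c / (2 * R)" by simp
    also have "\<dots> \<le> 1 - \<kappa>" by (simp add: \<kappa>_def)
    finally have "\<omega>\<^sup>2 * (1 / 2 * (\<Sum>j\<in>F. A j + B j) - \<delta> * (\<Sum>j\<in>F. (A j - B j) / u j)
            + \<delta>\<^sup>2 / 2 * (\<Sum>j\<in>F. (A j + B j) / (u j)\<^sup>2)) \<le> \<omega>\<^sup>2 * (1 - \<kappa>)"
      by (intro mult_left_mono) auto
    then show "1 / 2 * (\<Sum>j\<in>F. (P (2 powi j * \<omega>))\<^sup>2 * (\<omega> - \<delta> * 2 powi (- j))\<^sup>2
        + (P (- (2 powi j * \<omega>)))\<^sup>2 * (\<omega> + \<delta> * 2 powi (- j))\<^sup>2) \<le> (1 - \<kappa>) * \<omega>\<^sup>2"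
      unfolding sum_eq[symmetric] by (simp add: A_def B_def u_def mult.commute)
  qed
qed

end

section \<open>Energy of the scattering layers\<close>

lemma fourier_dilate: "fourier (dilate \<psi> j) \<omega> = fourier \<psi> (2 powi j * \<omega>)"
  using fourier_scale[of "2 powi (- j)" \<psi> \<omega>]
  by (simp add: dilate_def[abs_def] power_int_minus field_simps)

lemma integrable_dilate:
  assumes "integrable lborel \<psi>" shows "integrable lborel (dilate \<psi> j)"
  using lborel_integrable_real_affine[OF assms, of "2 powi (- j)" 0]
  by (simp add: dilate_def[abs_def])

lemma square_integrable_dilate:
  assumes "square_integrable \<psi>" shows "square_integrable (dilate \<psi> j)"
proof (rule square_integrable_bound)
  show sq: "square_integrable (\<lambda>t. \<psi> (2 powi (- j) * t))"
    using square_integrable_affine[OF assms, of "2 powi (- j)" 0] by simp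
  show "dilate \<psi> j \<in> borel_measurable lborel"
    using square_integrable_measurable[OF sq] by (simp add: dilate_def[abs_def])
  show "cmod (dilate \<psi> j t) \<le> 2 powi (- j) * cmod (\<psi> (2 powi (- j) * t))" for t
    by (simp add: dilate_def norm_mult norm_power_int)
qed

lemma scatter_Cons:
  "scatter \<psi> (j # p) f = scatter \<psi> p (\<lambda>t. complex_of_real (cmod ((f \<star> dilate \<psi> j) t)))"
  by (simp add: scatter_def)

lemma finite_words: "finite F \<Longrightarrow> finite {p. set p \<subseteq> F \<and> length p = n}"
  by (rule finite_lists_length_eq)

text \<open>Splitting at the first letter matches \<open>scatter_Cons\<close>: the rest of the word
  acts on the first layer, to which an induction hypothesis on the length can be applied.\<close>

lemma sum_words_Suc:
  assumes "finite F"
  shows "(\<Sum>p\<in>{p. set p \<subseteq> F \<and> length p = Suc n}. h p)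
    = (\<Sum>j\<in>F. \<Sum>p\<in>{p. set p \<subseteq> F \<and> length p = n}. h (j # p))"
proof -
  let ?W = "\<lambda>n. {p. set p \<subseteq> F \<and> length p = n}"
  have "(\<Sum>j\<in>F. \<Sum>p\<in>?W n. h (j # p)) = (\<Sum>(j, p)\<in>F \<times> ?W n. h (j # p))"
    by (rule sum.cartesian_product)
  also have "\<dots> = sum h (?W (Suc n))"
    by (rule sum.reindex_bij_witness[of _ "\<lambda>p. (hd p, tl p)" "\<lambda>(j, p). j # p"])
      (auto simp: length_Suc_conv)
  finally show ?thesis ..
qed

text \<open>Taking the modulus preserves the L^2 norm, hence by Plancherel the total spectral
  energy. Energy gained under the weight is therefore energy lost under its complement.\<close>

lemma modulus_complement_energy:
  fixes k k' :: "real \<Rightarrow> real"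
  assumes u: "integrable lborel u" "square_integrable u"
    and k: "k \<in> borel_measurable lborel" "\<And>\<omega>. \<bar>k \<omega>\<bar> \<le> B"
    and k': "k' \<in> borel_measurable lborel" "\<And>\<omega>. \<bar>k' \<omega>\<bar> \<le> B"
    and le: "(LINT \<omega>|lborel. (cmod (fourier u \<omega>))\<^sup>2 * k' \<omega>)
      \<le> (LINT \<omega>|lborel. (cmod (fourier (\<lambda>t. complex_of_real (cmod (u t))) \<omega>))\<^sup>2 * k \<omega>)"
  shows "(LINT \<omega>|lborel. (cmod (fourier (\<lambda>t. complex_of_real (cmod (u t))) \<omega>))\<^sup>2 * (1 - k \<omega>))
      \<le> (LINT \<omega>|lborel. (cmod (fourier u \<omega>))\<^sup>2 * (1 - k' \<omega>))"
proof -
  let ?v = "\<lambda>t. complex_of_real (cmod (u t))"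
  have v: "integrable lborel ?v" "square_integrable ?v"
    using u square_integrable_cmod by auto
  have eq: "(LINT \<omega>|lborel. (cmod (fourier g \<omega>))\<^sup>2 * (1 - h \<omega>))
      = (L2norm g)\<^sup>2 - (LINT \<omega>|lborel. (cmod (fourier g \<omega>))\<^sup>2 * h \<omega>)"
    if g: "integrable lborel g" "square_integrable g" and h: "h \<in> borel_measurable lborel" "\<And>\<omega>. \<bar>h \<omega>\<bar> \<le> B" for g h
    using Plancherel[OF g] integrable_fourier_square[OF g h]
    by (simp add: right_diff_distrib square_integrable_def L2norm_square[symmetric])
  show ?thesis
    unfolding eq[OF v k] eq[OF u k'] using le by (simp add: L2norm_cmod)
qed

lemma integral_symmetrize:
  fixes h :: "real \<Rightarrow> real"
  assumes "integrable lborel h"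
  shows "(LINT \<omega>|lborel. h \<omega>) = (LINT \<omega>|lborel. (h \<omega> + h (- \<omega>)) / 2)"
    and "integrable lborel (\<lambda>\<omega>. (h \<omega> + h (- \<omega>)) / 2)"
proof -
  have i: "integrable lborel (\<lambda>\<omega>. h (- \<omega>))"
    using lborel_integrable_real_affine[OF assms, of "-1" 0] by simp
  have "(LINT \<omega>|lborel. h (- \<omega>)) = (LINT \<omega>|lborel. h \<omega>)"
    using lborel_integral_real_affine[of "-1" h 0] by simp
  then show "(LINT \<omega>|lborel. h \<omega>) = (LINT \<omega>|lborel. (h \<omega> + h (- \<omega>)) / 2)"
    using assms i by simp
  show "integrable lborel (\<lambda>\<omega>. (h \<omega> + h (- \<omega>)) / 2)"
    using assms i by simp
qed

section \<open>Energy estimates for integrable real signals\<close>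

locale wavelet =
  fixes \<psi> :: "real \<Rightarrow> complex"
  assumes int_psi: "integrable lborel \<psi>"
    and sq_psi: "square_integrable \<psi>"
    and lp: "littlewood_paley (\<lambda>\<omega>. cmod (fourier \<psi> \<omega>))"
begin

sublocale littlewood_paley "\<lambda>\<omega>. cmod (fourier \<psi> \<omega>)"
  by (rule lp)

text \<open>Integrability makes the pointwise Fourier integral and Plancherel available. The class
  is closed under \<open>layer\<close>, as the induction on depth requires.\<close>

definition signal :: "(real \<Rightarrow> complex) \<Rightarrow> bool" where
  "signal f \<longleftrightarrow> integrable lborel f \<and> square_integrable f \<and> (\<forall>t. f t \<in> \<real>)"

definition layer :: "int \<Rightarrow> (real \<Rightarrow> complex) \<Rightarrow> real \<Rightarrow> complex" where
  "layer j f = (\<lambda>t. complex_of_real (cmod ((f \<star> dilate \<psi> j) t)))"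

lemma convolution_dilate:
  assumes "signal f"
  shows "integrable lborel (f \<star> dilate \<psi> j)" "square_integrable (f \<star> dilate \<psi> j)"
  using assms integrable_convolution[OF _ integrable_dilate[OF int_psi]]
    Young_L2(1)[OF _ integrable_dilate[OF int_psi]] by (auto simp: signal_def)

lemma signal_layer: "signal f \<Longrightarrow> signal (layer j f)"
  using convolution_dilate[of f j] square_integrable_cmod
  by (simp add: signal_def layer_def)

lemma signal_spectrum_even:
  "signal f \<Longrightarrow> cmod (fourier f (- \<omega>)) = cmod (fourier f \<omega>)"
  using fourier_uminus_real[of f \<omega>] by (simp add: signal_def)

text \<open>The spectrum of a real signal has even modulus, so only the mean of the weights at
  \<omega> and -\<omega> counts. This lets both signs of the Littlewood-Paley sum act together even
  when each weight \<Phi> j is centred off the origin; s is either sign of \<omega>.\<close>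

lemma sum_convolution_energy_le:
  fixes \<Phi> :: "int \<Rightarrow> real \<Rightarrow> real" and G :: "real \<Rightarrow> real"
  assumes f: "signal f" and F: "finite F"
    and \<Phi>: "\<And>j. \<Phi> j \<in> borel_measurable lborel" "\<And>j \<omega>. \<bar>\<Phi> j \<omega>\<bar> \<le> B"
    and G: "G \<in> borel_measurable lborel" "\<And>\<omega>. \<bar>G \<omega>\<bar> \<le> B'"
    and le: "\<And>\<omega> s. \<omega> > 0 \<Longrightarrow> \<bar>s\<bar> = \<omega> \<Longrightarrow>
      1 / 2 * (\<Sum>j\<in>F. (cmod (fourier \<psi> (2 powi j * \<omega>)))\<^sup>2 * \<Phi> j \<omega>
        + (cmod (fourier \<psi> (- (2 powi j * \<omega>))))\<^sup>2 * \<Phi> j (- \<omega>)) \<le> G s"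
  shows "(\<Sum>j\<in>F. LINT \<omega>|lborel. (cmod (fourier (f \<star> dilate \<psi> j) \<omega>))\<^sup>2 * \<Phi> j \<omega>)
    \<le> (LINT \<omega>|lborel. (cmod (fourier f \<omega>))\<^sup>2 * G \<omega>)"
proof -
  have f': "integrable lborel f" "square_integrable f"
    using f by (auto simp: signal_def)
  define \<Theta> where "\<Theta> \<omega> = (\<Sum>j\<in>F. (cmod (fourier \<psi> (2 powi j * \<omega>)))\<^sup>2 * \<Phi> j \<omega>)" for \<omega>
  define h where "h \<omega> = (cmod (fourier f \<omega>))\<^sup>2 * \<Theta> \<omega>" for \<omega>
  have summand: "(cmod (fourier (f \<star> dilate \<psi> j) \<omega>))\<^sup>2 * \<Phi> j \<omega>
      = (cmod (fourier f \<omega>))\<^sup>2 * ((cmod (fourier \<psi> (2 powi j * \<omega>)))\<^sup>2 * \<Phi> j \<omega>)" for j \<omega>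
    by (simp add: fourier_convolution[OF f'(1) integrable_dilate[OF int_psi]] fourier_dilate
        norm_mult power_mult_distrib)
  have int: "integrable lborel (\<lambda>\<omega>. (cmod (fourier (f \<star> dilate \<psi> j) \<omega>))\<^sup>2 * \<Phi> j \<omega>)" for j
    by (rule integrable_fourier_square[OF convolution_dilate[OF f] \<Phi>])
  have h_eq: "h \<omega> = (\<Sum>j\<in>F. (cmod (fourier (f \<star> dilate \<psi> j) \<omega>))\<^sup>2 * \<Phi> j \<omega>)" for \<omega>
    unfolding h_def \<Theta>_def summand by (rule sum_distrib_left)
  have ih: "integrable lborel h"
    unfolding h_eq[abs_def] using int by (rule Bochner_Integration.integrable_sum)
  have "(\<Sum>j\<in>F. LINT \<omega>|lborel. (cmod (fourier (f \<star> dilate \<psi> j) \<omega>))\<^sup>2 * \<Phi> j \<omega>) = (LINT \<omega>|lborel. h \<omega>)"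
    unfolding h_eq using int by (rule Bochner_Integration.integral_sum[symmetric])
  also have "\<dots> = (LINT \<omega>|lborel. (h \<omega> + h (- \<omega>)) / 2)"
    by (rule integral_symmetrize(1)[OF ih])
  also have "\<dots> \<le> (LINT \<omega>|lborel. (cmod (fourier f \<omega>))\<^sup>2 * G \<omega>)"
  proof (rule integral_mono_AE[OF integral_symmetrize(2)[OF ih] integrable_fourier_square[OF f' G]])
    \<comment> \<open>The pointwise hypothesis speaks of \<omega> > 0 only; the origin is a null
      set.\<close>
    have "AE \<omega> in lborel. \<omega> \<noteq> (0::real)"
      by (rule AE_lborel_singleton)
    then show "AE \<omega> in lborel. (h \<omega> + h (- \<omega>)) / 2 \<le> (cmod (fourier f \<omega>))\<^sup>2 * G \<omega>"
    proof eventually_elim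
      fix \<omega> :: real assume "\<omega> \<noteq> 0"
      have "(h \<omega> + h (- \<omega>)) / 2 = (cmod (fourier f \<omega>))\<^sup>2 * ((\<Theta> \<omega> + \<Theta> (- \<omega>)) / 2)"
        by (simp add: h_def signal_spectrum_even[OF f] algebra_simps)
      moreover have "(\<Theta> \<omega> + \<Theta> (- \<omega>)) / 2 \<le> G \<omega>"
      proof (cases "\<omega> > 0")
        case True
        then show ?thesis
          using le[of \<omega> \<omega>] by (simp add: \<Theta>_def sum.distrib)
      next
        case False
        then show ?thesis
          using le[of "- \<omega>" \<omega>] \<open>\<omega> \<noteq> 0\<close> by (simp add: \<Theta>_def sum.distrib add.commute)
      qed
      ultimately show "(h \<omega> + h (- \<omega>)) / 2 \<le> (cmod (fourier f \<omega>))\<^sup>2 * G \<omega>"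
        using mult_left_mono[of _ "G \<omega>" "(cmod (fourier f \<omega>))\<^sup>2"] by (simp only: zero_le_power2)
    qed
  qed
  finally show ?thesis .
qed

lemma layer_energy_contraction:
  obtains a where "a > 1"
    "\<And>F f x. finite F \<Longrightarrow> signal f \<Longrightarrow> x > 0 \<Longrightarrow>
      (\<Sum>j\<in>F. LINT \<omega>|lborel. (cmod (fourier (layer j f) \<omega>))\<^sup>2 * (1 - exp (- 2 * (\<omega> / x)\<^sup>2)))
      \<le> (LINT \<omega>|lborel. (cmod (fourier f \<omega>))\<^sup>2 * (1 - exp (- 2 * (\<omega> / (a * x))\<^sup>2)))"
proof -
  obtain \<kappa> \<delta> where \<kappa>: "0 < \<kappa>" "\<kappa> < 1" and contr: "\<And>F \<omega>. finite F \<Longrightarrow> \<omega> > 0 \<Longrightarrow>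
      1 / 2 * (\<Sum>j\<in>F. (cmod (fourier \<psi> (2 powi j * \<omega>)))\<^sup>2 * (\<omega> - \<delta> * 2 powi (- j))\<^sup>2
        + (cmod (fourier \<psi> (- (2 powi j * \<omega>))))\<^sup>2 * (\<omega> + \<delta> * 2 powi (- j))\<^sup>2) \<le> (1 - \<kappa>) * \<omega>\<^sup>2"
    by (rule frequency_contraction) (rule that; blast)
  \<comment> \<open>Chosen so that the contraction factor 1 - \<kappa> on squared frequencies
    becomes the dilation of the Gaussian scale from x to a * x.\<close>
  define a where "a = 1 / sqrt (1 - \<kappa>)"
  have a: "a > 1" "\<And>y. (y / a)\<^sup>2 = (1 - \<kappa>) * y\<^sup>2"
    using \<kappa> by (auto simp: a_def power_mult_distrib)
  show ?thesis
  proof (rule that[OF a(1)])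
    fix F :: "int set" and f x assume F: "finite F" and f: "signal f" and x: "(x::real) > 0"
    define \<Phi> where "\<Phi> j \<omega> = 1 - exp (- 2 * ((\<omega> - \<delta> * 2 powi (- j)) / x)\<^sup>2)" for j :: int and \<omega>
    have "(LINT \<omega>|lborel. (cmod (fourier (layer j f) \<omega>))\<^sup>2 * (1 - exp (- 2 * (\<omega> / x)\<^sup>2)))
      \<le> (LINT \<omega>|lborel. (cmod (fourier (f \<star> dilate \<psi> j) \<omega>))\<^sup>2 * \<Phi> j \<omega>)" for j
      unfolding layer_def \<Phi>_def
      by (rule modulus_complement_energy[where B=1, OF convolution_dilate[OF f]])
        (auto intro!: modulus_gaussian_energy[OF convolution_dilate(1)[OF f] x, simplified])
    then have "(\<Sum>j\<in>F. LINT \<omega>|lborel. (cmod (fourier (layer j f) \<omega>))\<^sup>2 * (1 - exp (- 2 * (\<omega> / x)\<^sup>2)))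
      \<le> (\<Sum>j\<in>F. LINT \<omega>|lborel. (cmod (fourier (f \<star> dilate \<psi> j) \<omega>))\<^sup>2 * \<Phi> j \<omega>)"
      by (rule sum_mono)
    also have "\<dots> \<le> (LINT \<omega>|lborel. (cmod (fourier f \<omega>))\<^sup>2 * (1 - exp (- 2 * (\<omega> / (a * x))\<^sup>2)))"
    proof (rule sum_convolution_energy_le[where B=1 and B'=1, OF f F])
      show "\<Phi> j \<in> borel_measurable lborel" for j
        unfolding \<Phi>_def by measurable
      show "\<bar>\<Phi> j \<omega>\<bar> \<le> 1" "\<bar>1 - exp (- 2 * (\<omega> / (a * x))\<^sup>2)\<bar> \<le> 1" for j \<omega>
        by (auto simp: \<Phi>_def abs_le_iff)
      show "(\<lambda>\<omega>. 1 - exp (- 2 * (\<omega> / (a * x))\<^sup>2)) \<in> borel_measurable lborel"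
        by measurable
      fix \<omega> s :: real assume \<omega>: "\<omega> > 0" "\<bar>s\<bar> = \<omega>"
      \<comment> \<open>Jensen is applied over pairs of a scale and a sign. The weights add up to
        the Littlewood-Paley sum over F, hence to at most 1, and \<open>y\<close> holds the
        exponents at the shifted frequencies.\<close>
      define w where "w = (\<lambda>(j, b). (cmod (fourier \<psi> (if b then 2 powi j * \<omega> else - (2 powi j * \<omega>))))\<^sup>2 / 2)"
      define y where "y = (\<lambda>(j, b). 2 * ((if b then \<omega> - \<delta> * 2 powi (- j) else \<omega> + \<delta> * 2 powi (- j)) / x)\<^sup>2)"
      have expand: "(\<Sum>p\<in>F \<times> UNIV. h p) = (\<Sum>j\<in>F. h (j, True) + h (j, False))" for h :: "int \<times> bool \<Rightarrow> real"
        using sum.cartesian_product[of "\<lambda>j b. h (j, b)" UNIV F] by (simp add: UNIV_bool add.commute)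
      have Phi_reflect: "\<Phi> j (- \<omega>) = 1 - exp (- 2 * ((\<omega> + \<delta> * 2 powi (- j)) / x)\<^sup>2)" for j
      proof -
        have "(- \<omega> - \<delta> * 2 powi (- j)) / x = - ((\<omega> + \<delta> * 2 powi (- j)) / x)"
          unfolding minus_divide_left by simp
        then show ?thesis unfolding \<Phi>_def by (simp only: power2_minus)
      qed
      have "1 / 2 * (\<Sum>j\<in>F. (cmod (fourier \<psi> (2 powi j * \<omega>)))\<^sup>2 * \<Phi> j \<omega>
          + (cmod (fourier \<psi> (- (2 powi j * \<omega>))))\<^sup>2 * \<Phi> j (- \<omega>))
        = (\<Sum>p\<in>F \<times> UNIV. w p * (1 - exp (- y p)))"
        unfolding expand Phi_reflect by (simp add: w_def y_def \<Phi>_def sum_distrib_left distrib_left)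
      also have "\<dots> \<le> 1 - exp (- (\<Sum>p\<in>F \<times> UNIV. w p * y p))"
      proof (rule weighted_one_minus_exp_le)
        show "sum w (F \<times> UNIV) \<le> 1"
          using P_sum[OF F, of \<omega>] unfolding expand by (simp add: w_def sum_divide_distrib add_divide_distrib)
      qed (use F in \<open>auto simp: w_def\<close>)
      also have "(\<Sum>p\<in>F \<times> UNIV. w p * y p)
        = 2 / x\<^sup>2 * (1 / 2 * (\<Sum>j\<in>F. (cmod (fourier \<psi> (2 powi j * \<omega>)))\<^sup>2 * (\<omega> - \<delta> * 2 powi (- j))\<^sup>2
          + (cmod (fourier \<psi> (- (2 powi j * \<omega>))))\<^sup>2 * (\<omega> + \<delta> * 2 powi (- j))\<^sup>2))"
        unfolding expand sum_distrib_left
        by (rule sum.cong[OF refl]) (simp add: w_def y_def power_divide add_divide_distrib distrib_left)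
      finally have "1 / 2 * (\<Sum>j\<in>F. (cmod (fourier \<psi> (2 powi j * \<omega>)))\<^sup>2 * \<Phi> j \<omega>
          + (cmod (fourier \<psi> (- (2 powi j * \<omega>))))\<^sup>2 * \<Phi> j (- \<omega>))
        \<le> 1 - exp (- (2 / x\<^sup>2 * (1 / 2 * (\<Sum>j\<in>F. (cmod (fourier \<psi> (2 powi j * \<omega>)))\<^sup>2 * (\<omega> - \<delta> * 2 powi (- j))\<^sup>2
          + (cmod (fourier \<psi> (- (2 powi j * \<omega>))))\<^sup>2 * (\<omega> + \<delta> * 2 powi (- j))\<^sup>2))))" .
      also have "\<dots> \<le> 1 - exp (- (2 / x\<^sup>2 * ((1 - \<kappa>) * \<omega>\<^sup>2)))"
        using contr[OF F \<omega>(1)] x by (intro diff_left_mono iffD2[OF exp_le_cancel_iff] le_imp_neg_le mult_left_mono) auto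
      also have "2 / x\<^sup>2 * ((1 - \<kappa>) * \<omega>\<^sup>2) = 2 * (s / (a * x))\<^sup>2"
      proof -
        have "(s / (a * x))\<^sup>2 = (s / a)\<^sup>2 / x\<^sup>2"
          by (simp add: power_divide power_mult_distrib)
        then show ?thesis using a(2)[of s] \<omega>(2) by auto
      qed
      finally show "1 / 2 * (\<Sum>j\<in>F. (cmod (fourier \<psi> (2 powi j * \<omega>)))\<^sup>2 * \<Phi> j \<omega>
          + (cmod (fourier \<psi> (- (2 powi j * \<omega>))))\<^sup>2 * \<Phi> j (- \<omega>)) \<le> 1 - exp (- 2 * (s / (a * x))\<^sup>2)"
        by simp
    qed
    finally show "(\<Sum>j\<in>F. LINT \<omega>|lborel. (cmod (fourier (layer j f) \<omega>))\<^sup>2 * (1 - exp (- 2 * (\<omega> / x)\<^sup>2)))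
      \<le> (LINT \<omega>|lborel. (cmod (fourier f \<omega>))\<^sup>2 * (1 - exp (- 2 * (\<omega> / (a * x))\<^sup>2)))" .
  qed
qed

lemma L2norm_layer: 
  assumes "signal f"
  shows "(L2norm (layer j f))\<^sup>2 = (LINT \<omega>|lborel. (cmod (fourier (f \<star> dilate \<psi> j) \<omega>))\<^sup>2)"
  using Plancherel(2)[OF convolution_dilate[OF assms, of j]] unfolding layer_def L2norm_cmod
  by (simp flip: L2norm_square)

text \<open>Here the scale limit J enters: each term is its quotient by (2 powi j * \<omega>)^2
  times that square, and the square is at most (2 powi J * \<omega>)^2.\<close>

lemma littlewood_paley_low_frequency:
  obtains M where "M > 0"
    "\<And>F \<omega>. finite F \<Longrightarrow> F \<subseteq> {..J} \<Longrightarrow> \<omega> > 0 \<Longrightarrow>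
      1 / 2 * (\<Sum>j\<in>F. (cmod (fourier \<psi> (2 powi j * \<omega>)))\<^sup>2 + (cmod (fourier \<psi> (- (2 powi j * \<omega>))))\<^sup>2) \<le> M * \<omega>\<^sup>2"
proof -
  obtain M where M: "M > 0" and Mb: "\<And>F \<omega>. finite F \<Longrightarrow> \<omega> > 0 \<Longrightarrow>
      (\<Sum>j\<in>F. ((cmod (fourier \<psi> (2 powi j * \<omega>)))\<^sup>2 + (cmod (fourier \<psi> (- (2 powi j * \<omega>))))\<^sup>2) / (2 powi j * \<omega>)\<^sup>2) \<le> M"
    by (rule P_weighted_sum_bound) (rule that; blast)
  show ?thesis
  proof (rule that[of "M * (2 powi J)\<^sup>2 / 2"])
    show "0 < M * (2 powi J)\<^sup>2 / 2" using M by simp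
    fix F :: "int set" and \<omega> :: real assume F: "finite F" "F \<subseteq> {..J}" and \<omega>: "\<omega> > 0"
    let ?S = "\<lambda>j. (cmod (fourier \<psi> (2 powi j * \<omega>)))\<^sup>2 + (cmod (fourier \<psi> (- (2 powi j * \<omega>))))\<^sup>2"
    have "(\<Sum>j\<in>F. ?S j) \<le> (\<Sum>j\<in>F. (2 powi J * \<omega>)\<^sup>2 * (?S j / (2 powi j * \<omega>)\<^sup>2))"
    proof (rule sum_mono)
      fix j assume "j \<in> F"
      then have "2 powi j * \<omega> \<le> 2 powi J * \<omega>"
        using F(2) \<omega> by (intro mult_right_mono power_int_increasing) auto
      then have "(2 powi j * \<omega>)\<^sup>2 \<le> (2 powi J * \<omega>)\<^sup>2"
        using \<omega> by (intro power_mono) auto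
      then have "(2 powi j * \<omega>)\<^sup>2 * (?S j / (2 powi j * \<omega>)\<^sup>2) \<le> (2 powi J * \<omega>)\<^sup>2 * (?S j / (2 powi j * \<omega>)\<^sup>2)"
        by (intro mult_right_mono) auto
      moreover have "(2 powi j * \<omega>)\<^sup>2 * (?S j / (2 powi j * \<omega>)\<^sup>2) = ?S j"
        using \<omega> by simp
      ultimately show "?S j \<le> (2 powi J * \<omega>)\<^sup>2 * (?S j / (2 powi j * \<omega>)\<^sup>2)" by simp
    qed
    also have "\<dots> = (2 powi J * \<omega>)\<^sup>2 * (\<Sum>j\<in>F. ?S j / (2 powi j * \<omega>)\<^sup>2)"
      by (rule sum_distrib_left[symmetric])
    also have "\<dots> \<le> (2 powi J * \<omega>)\<^sup>2 * M"
      by (intro mult_left_mono Mb F \<omega>) auto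
    finally show "1 / 2 * (\<Sum>j\<in>F. ?S j) \<le> M * (2 powi J)\<^sup>2 / 2 * \<omega>\<^sup>2"
      by (simp add: power_mult_distrib mult_ac)
  qed
qed

text \<open>The second layer is bounded through 1 - k, which the modulus inequality converts into 1
  - k' on the spectrum before the modulus. Summing the first layer then leaves the Littlewood-Paley
  sum times at most 1 - c exp (- 2 pi^2 \<omega>^2), which the scalar lemma compares with a Gaussian
  complement.\<close>

lemma two_layer_energy:
  obtains \<rho> where "\<rho> > 0"
    "\<And>F f. finite F \<Longrightarrow> F \<subseteq> {..J} \<Longrightarrow> signal f \<Longrightarrow>
      (\<Sum>j\<in>F. \<Sum>i\<in>F. (L2norm (layer i (layer j f)))\<^sup>2)
      \<le> (LINT \<omega>|lborel. (cmod (fourier f \<omega>))\<^sup>2 * (1 - exp (- 2 * (\<omega> / \<rho>)\<^sup>2)))"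
proof -
  obtain M where M: "M > 0" and low: "\<And>F \<omega>. finite F \<Longrightarrow> F \<subseteq> {..J} \<Longrightarrow> \<omega> > 0 \<Longrightarrow>
      1 / 2 * (\<Sum>j\<in>F. (cmod (fourier \<psi> (2 powi j * \<omega>)))\<^sup>2 + (cmod (fourier \<psi> (- (2 powi j * \<omega>))))\<^sup>2) \<le> M * \<omega>\<^sup>2"
    by (rule littlewood_paley_low_frequency) (rule that; blast)
  \<comment> \<open>At distance below \<open>w\<close> from the origin the low-frequency bound gives
    S \<le> 1/2, which leaves room for k \<le> 1/2; beyond \<open>w\<close> the kernel vanishes and
    S \<le> 1 is enough.\<close>
  define w where "w = 1 / sqrt (2 * M)"
  have w: "w > 0" "M * w\<^sup>2 = 1 / 2"
    using M by (simp_all add: w_def power_divide)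
  obtain k k' :: "real \<Rightarrow> real" and c where c: "c > 0" and ik: "integrable lborel k" "integrable lborel k'"
    and k: "\<forall>\<omega>. 0 \<le> k \<omega>" "\<forall>\<omega>. k \<omega> \<le> 1 / 2" "\<forall>\<omega>. w \<le> \<bar>\<omega>\<bar> \<longrightarrow> k \<omega> = 0"
    and k': "\<forall>\<omega>. k' \<omega> \<le> 1 / 2" "\<forall>\<omega>. c * exp (- (2 * pi\<^sup>2 * \<omega>\<^sup>2)) \<le> k' \<omega>"
    and kk': "\<forall>t. cmod (fourier (\<lambda>\<omega>. complex_of_real (k' \<omega>)) t) \<le> Re (fourier (\<lambda>\<omega>. complex_of_real (k \<omega>)) t)"
    using lowpass_kernels[OF w(1)] .
  note k = k[rule_format] and k' = k'[rule_format] and kk' = kk'[rule_format]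
  have c1: "c \<le> 1"
    using order_trans[OF k'(2)[of 0] k'(1)] by simp
  obtain \<rho> where \<rho>: "\<rho> > 0"
    and scalar: "\<And>S \<omega>. 0 \<le> S \<Longrightarrow> S \<le> 1 \<Longrightarrow> S \<le> M * \<omega>\<^sup>2 \<Longrightarrow>
      S * (1 - c * exp (- (2 * pi\<^sup>2 * \<omega>\<^sup>2))) \<le> 1 - exp (- 2 * (\<omega> / \<rho>)\<^sup>2)"
    using lowpass_le_gaussian_complement[OF M c c1, of "2 * pi\<^sup>2"] by auto
  have [measurable]: "k \<in> borel_measurable borel" "k' \<in> borel_measurable borel"
    using ik by auto
  have k'0: "0 \<le> k' \<omega>" for \<omega>
    using order_trans[OF _ k'(2)[of \<omega>], of 0] c by simp
  show ?thesis
  proof (rule that[OF \<rho>])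
    fix F :: "int set" and f assume F: "finite F" "F \<subseteq> {..J}" and f: "signal f"
    define S where "S \<omega> = 1 / 2 * (\<Sum>j\<in>F. (cmod (fourier \<psi> (2 powi j * \<omega>)))\<^sup>2 + (cmod (fourier \<psi> (- (2 powi j * \<omega>))))\<^sup>2)" for \<omega>
    have S: "0 \<le> S \<omega>" "S \<omega> \<le> 1" "\<omega> > 0 \<Longrightarrow> S \<omega> \<le> M * \<omega>\<^sup>2" for \<omega>
      using P_sum[OF F(1), of \<omega>] low[OF F] by (auto simp: S_def intro!: sum_nonneg)
    have second: "(\<Sum>i\<in>F. (L2norm (layer i (layer j f)))\<^sup>2)
        \<le> (LINT \<omega>|lborel. (cmod (fourier (f \<star> dilate \<psi> j) \<omega>))\<^sup>2 * (1 - k' \<omega>))" for j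
    proof -
      have "(\<Sum>i\<in>F. (L2norm (layer i (layer j f)))\<^sup>2)
         = (\<Sum>i\<in>F. LINT \<omega>|lborel. (cmod (fourier (layer j f \<star> dilate \<psi> i) \<omega>))\<^sup>2 * 1)"
        by (simp add: L2norm_layer[OF signal_layer[OF f]])
      also have "\<dots> \<le> (LINT \<omega>|lborel. (cmod (fourier (layer j f) \<omega>))\<^sup>2 * (1 - k \<omega>))"
      proof (rule sum_convolution_energy_le[where B=1 and B'=1 and \<Phi>="\<lambda>i \<omega>. 1", OF signal_layer[OF f] F(1)])
        show "\<bar>1 - k \<omega>\<bar> \<le> 1" for \<omega> using k(1,2)[of \<omega>] by simp
        fix \<omega> s :: real assume \<omega>: "\<omega> > 0" "\<bar>s\<bar> = \<omega>"
        have "S \<omega> \<le> 1 - k s"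
        proof (cases "w \<le> \<omega>")
          case True
          then show ?thesis using S(2) k(3)[of s] \<omega> by simp
        next
          case False
          then have "M * \<omega>\<^sup>2 \<le> M * w\<^sup>2"
            using \<omega> M by (intro mult_left_mono power_mono) auto
          then show ?thesis using S(3)[OF \<omega>(1)] w(2) k(2)[of s] by linarith
        qed
        then show "1 / 2 * (\<Sum>j\<in>F. (cmod (fourier \<psi> (2 powi j * \<omega>)))\<^sup>2 * 1
          + (cmod (fourier \<psi> (- (2 powi j * \<omega>))))\<^sup>2 * 1) \<le> 1 - k s"
          by (simp add: S_def)
      qed auto
      also have "\<dots> \<le> (LINT \<omega>|lborel. (cmod (fourier (f \<star> dilate \<psi> j) \<omega>))\<^sup>2 * (1 - k' \<omega>))"
        unfolding layer_def
      proof (rule modulus_complement_energy[where B="1/2", OF convolution_dilate[OF f]])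
        show "\<bar>k \<omega>\<bar> \<le> 1 / 2" "\<bar>k' \<omega>\<bar> \<le> 1 / 2" for \<omega>
          using k k'(1) k'0 by (simp_all add: abs_of_nonneg)
        show "(LINT \<omega>|lborel. (cmod (fourier (f \<star> dilate \<psi> j) \<omega>))\<^sup>2 * k' \<omega>)
          \<le> (LINT \<omega>|lborel. (cmod (fourier (\<lambda>t. complex_of_real (cmod ((f \<star> dilate \<psi> j) t))) \<omega>))\<^sup>2 * k \<omega>)"
          by (rule modulus_spectral_energy[OF convolution_dilate(1)[OF f] ik kk'])
      qed auto
      finally show ?thesis .
    qed
    have "(\<Sum>j\<in>F. \<Sum>i\<in>F. (L2norm (layer i (layer j f)))\<^sup>2)
        \<le> (\<Sum>j\<in>F. LINT \<omega>|lborel. (cmod (fourier (f \<star> dilate \<psi> j) \<omega>))\<^sup>2 * (1 - k' \<omega>))"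
      by (intro sum_mono second)
    also have "\<dots> \<le> (LINT \<omega>|lborel. (cmod (fourier f \<omega>))\<^sup>2 * (1 - exp (- 2 * (\<omega> / \<rho>)\<^sup>2)))"
    proof (rule sum_convolution_energy_le[where B=1 and B'=1 and \<Phi>="\<lambda>i \<omega>. 1 - k' \<omega>", OF f F(1)])
      show "\<bar>1 - k' \<omega>\<bar> \<le> 1" for \<omega>
        using k'(1)[of \<omega>] k'0[of \<omega>] by simp
      show "\<bar>1 - exp (- 2 * (\<omega> / \<rho>)\<^sup>2)\<bar> \<le> 1" for \<omega>
        by (auto simp: abs_le_iff)
      fix \<omega> s :: real assume \<omega>: "\<omega> > 0" "\<bar>s\<bar> = \<omega>"
      let ?e = "1 - c * exp (- (2 * pi\<^sup>2 * \<omega>\<^sup>2))"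
      have "1 / 2 * (\<Sum>j\<in>F. (cmod (fourier \<psi> (2 powi j * \<omega>)))\<^sup>2 * (1 - k' \<omega>)
          + (cmod (fourier \<psi> (- (2 powi j * \<omega>))))\<^sup>2 * (1 - k' (- \<omega>)))
        \<le> 1 / 2 * (\<Sum>j\<in>F. (cmod (fourier \<psi> (2 powi j * \<omega>)))\<^sup>2 * ?e
          + (cmod (fourier \<psi> (- (2 powi j * \<omega>))))\<^sup>2 * ?e)"
        using k'(2)[of \<omega>] k'(2)[of "- \<omega>"] by (intro mult_left_mono sum_mono add_mono) auto
      also have "\<dots> = S \<omega> * ?e"
        unfolding S_def by (simp add: sum_distrib_right flip: distrib_right)
      also have "\<dots> \<le> 1 - exp (- 2 * (\<omega> / \<rho>)\<^sup>2)"
        using scalar S \<omega>(1) by blast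
      also have "\<dots> = 1 - exp (- 2 * (s / \<rho>)\<^sup>2)"
        unfolding \<omega>(2)[symmetric] by (simp add: power_divide)
      finally show "1 / 2 * (\<Sum>j\<in>F. (cmod (fourier \<psi> (2 powi j * \<omega>)))\<^sup>2 * (1 - k' \<omega>)
          + (cmod (fourier \<psi> (- (2 powi j * \<omega>))))\<^sup>2 * (1 - k' (- \<omega>))) \<le> 1 - exp (- 2 * (s / \<rho>)\<^sup>2)" .
    qed auto
    finally show "(\<Sum>j\<in>F. \<Sum>i\<in>F. (L2norm (layer i (layer j f)))\<^sup>2)
      \<le> (LINT \<omega>|lborel. (cmod (fourier f \<omega>))\<^sup>2 * (1 - exp (- 2 * (\<omega> / \<rho>)\<^sup>2)))" .
  qed
qed

lemma scatter_energy_signal: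
  obtains r a where "r > 0" "a > 1"
    "\<And>n F f. n \<ge> 2 \<Longrightarrow> finite F \<Longrightarrow> F \<subseteq> {..J} \<Longrightarrow> signal f \<Longrightarrow>
      (\<Sum>p\<in>{p. set p \<subseteq> F \<and> length p = n}. (L2norm (scatter \<psi> p f))\<^sup>2)
      \<le> (LINT \<omega>|lborel. (cmod (fourier f \<omega>))\<^sup>2 * (1 - exp (- 2 * (\<omega> / (r * a ^ n))\<^sup>2)))"
proof -
  obtain a where a: "a > 1" and contract: "\<And>F f x. finite F \<Longrightarrow> signal f \<Longrightarrow> x > 0 \<Longrightarrow>
      (\<Sum>j\<in>F. LINT \<omega>|lborel. (cmod (fourier (layer j f) \<omega>))\<^sup>2 * (1 - exp (- 2 * (\<omega> / x)\<^sup>2)))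
      \<le> (LINT \<omega>|lborel. (cmod (fourier f \<omega>))\<^sup>2 * (1 - exp (- 2 * (\<omega> / (a * x))\<^sup>2)))"
    by (rule layer_energy_contraction) (rule that; blast)
  obtain \<rho> where \<rho>: "\<rho> > 0" and start: "\<And>F f. finite F \<Longrightarrow> F \<subseteq> {..J} \<Longrightarrow> signal f \<Longrightarrow>
      (\<Sum>j\<in>F. \<Sum>i\<in>F. (L2norm (layer i (layer j f)))\<^sup>2)
      \<le> (LINT \<omega>|lborel. (cmod (fourier f \<omega>))\<^sup>2 * (1 - exp (- 2 * (\<omega> / \<rho>)\<^sup>2)))"
    by (rule two_layer_energy) (rule that; blast)
  have scatter_layer: "scatter \<psi> (j # p) f = scatter \<psi> p (layer j f)" for j p f
    by (simp add: scatter_Cons layer_def)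
  show ?thesis
  \<comment> \<open>Dividing by the square of \<open>a\<close> makes the scale equal \<rho> at n =
    2, where the induction begins.\<close>
  proof (rule that[of "\<rho> / a\<^sup>2" a])
    show "0 < \<rho> / a\<^sup>2" "1 < a" using a \<rho> by auto
    fix n F f assume n: "(2::nat) \<le> n" and F: "finite F" "F \<subseteq> {..J}" and f: "signal f"
    from n f show "(\<Sum>p\<in>{p. set p \<subseteq> F \<and> length p = n}. (L2norm (scatter \<psi> p f))\<^sup>2)
      \<le> (LINT \<omega>|lborel. (cmod (fourier f \<omega>))\<^sup>2 * (1 - exp (- 2 * (\<omega> / (\<rho> / a\<^sup>2 * a ^ n))\<^sup>2)))"
    proof (induction n arbitrary: f rule: dec_induct)
      case base
      have "(\<Sum>p\<in>{p. set p \<subseteq> F \<and> length p = 2}. (L2norm (scatter \<psi> p f))\<^sup>2)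
         = (\<Sum>j\<in>F. \<Sum>i\<in>F. (L2norm (layer i (layer j f)))\<^sup>2)"
      proof -
        have "{p. set p \<subseteq> F \<and> length p = 0} = {[]}" by auto
        then show ?thesis
          by (simp add: numeral_2_eq_2 sum_words_Suc[OF F(1)] scatter_layer scatter_Nil del: length_0_conv)
      qed
      moreover have "\<rho> / a\<^sup>2 * a ^ 2 = \<rho>" using a by simp
      ultimately show ?case using start[OF F base] by simp
    next
      case (step n)
      have "(\<Sum>p\<in>{p. set p \<subseteq> F \<and> length p = Suc n}. (L2norm (scatter \<psi> p f))\<^sup>2)
         = (\<Sum>j\<in>F. \<Sum>p\<in>{p. set p \<subseteq> F \<and> length p = n}. (L2norm (scatter \<psi> p (layer j f)))\<^sup>2)"
        by (simp add: sum_words_Suc[OF F(1)] scatter_layer)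
      also have "\<dots> \<le> (\<Sum>j\<in>F. LINT \<omega>|lborel. (cmod (fourier (layer j f) \<omega>))\<^sup>2 * (1 - exp (- 2 * (\<omega> / (\<rho> / a\<^sup>2 * a ^ n))\<^sup>2)))"
        by (intro sum_mono step.IH signal_layer step.prems)
      also have "\<dots> \<le> (LINT \<omega>|lborel. (cmod (fourier f \<omega>))\<^sup>2 * (1 - exp (- 2 * (\<omega> / (a * (\<rho> / a\<^sup>2 * a ^ n)))\<^sup>2)))"
        using a \<rho> by (intro contract F step.prems) simp
      also have "a * (\<rho> / a\<^sup>2 * a ^ n) = \<rho> / a\<^sup>2 * a ^ Suc n" by simp
      finally show ?case .
    qed
  qed
qed

end

section \<open>Extension to square integrable signals\<close>

text \<open>Riesz-Fischer: a rapidly Cauchy subsequence converges almost everywhere, and Fatou's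
  lemma turns the pointwise limit into an L^2 limit of the whole sequence.\<close>

lemma L2_complete:
  fixes g :: "nat \<Rightarrow> real \<Rightarrow> complex"
  assumes g: "\<And>n. square_integrable (g n)"
    and Cauchy: "\<And>e. e > 0 \<Longrightarrow> \<exists>N. \<forall>m\<ge>N. \<forall>n\<ge>N. L2norm (\<lambda>t. g m t - g n t) < e"
  obtains h where "square_integrable h" "(\<lambda>n. L2norm (\<lambda>t. g n t - h t)) \<longlonglongrightarrow> 0"
proof -
  have [measurable]: "g n \<in> borel_measurable borel" for n
    using g by (simp add: square_integrable_def)
  have diff: "square_integrable (\<lambda>t. g m t - g n t)" for m n
    by (rule square_integrable_diff[OF g g])
  have nn_diff: "(\<integral>\<^sup>+t. ennreal ((cmod (g m t - g n t))\<^sup>2) \<partial>lborel) = ennreal ((L2norm (\<lambda>t. g m t - g n t))\<^sup>2)" for m n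
    using diff[of m n] by (simp add: L2norm_square square_integrable_def nn_integral_eq_integral)
  have "\<forall>k. \<exists>N. \<forall>m\<ge>N. \<forall>n\<ge>N. L2norm (\<lambda>t. g m t - g n t) < (1/2) ^ k"
    using Cauchy by simp
  then obtain r0 where r0: "\<And>k m n. r0 k \<le> m \<Longrightarrow> r0 k \<le> n \<Longrightarrow> L2norm (\<lambda>t. g m t - g n t) < (1/2) ^ k"
    by metis
  \<comment> \<open>Summing the moduli \<open>r0 i + 1\<close> makes \<open>r\<close> increasing and
    at least as large as both \<open>r0 k\<close> and \<open>k\<close>.\<close>
  define r where "r k = (\<Sum>i\<le>k. r0 i + 1)" for k
  have r_mono: "r k \<le> r (Suc k)" for k by (simp add: r_def)
  have r_ge0: "r0 k \<le> r k" for k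
    unfolding r_def using member_le_sum[of k "{..k}" "\<lambda>i. r0 i + 1"] by simp
  have r_ge: "k \<le> r k" for k
  proof -
    have "(\<Sum>i\<le>k. 1) \<le> (\<Sum>i\<le>k. r0 i + 1)" by (intro sum_mono) simp
    then show ?thesis by (simp add: r_def)
  qed
  define d where "d k t = g (r (Suc k)) t - g (r k) t" for k t
  have d_norm: "(L2norm (d k))\<^sup>2 \<le> (1/4) ^ k" for k
  proof -
    have "L2norm (d k) \<le> (1/2) ^ k"
      unfolding d_def using r0[of k "r (Suc k)" "r k"] r_ge0[of k] r_mono[of k] by simp
    then have "(L2norm (d k))\<^sup>2 \<le> ((1/2) ^ k)\<^sup>2"
      by (intro power_mono) auto
    also have "\<dots> = (1/4) ^ k"
      by (simp add: power2_eq_square flip: power_mult_distrib)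
    finally show ?thesis .
  qed
  \<comment> \<open>The weight 2 ^ k against norms squared of size (1/4) ^ k leaves a convergent
    series. Finiteness at a point then forces the increments there to decay like (1 / sqrt 2) ^ k,
    so they are summable.\<close>
  have "(\<integral>\<^sup>+t. (\<Sum>k. ennreal (2 ^ k * (cmod (d k t))\<^sup>2)) \<partial>lborel) = (\<Sum>k. \<integral>\<^sup>+t. ennreal (2 ^ k * (cmod (d k t))\<^sup>2) \<partial>lborel)"
    unfolding d_def by (rule nn_integral_suminf) measurable
  also have "\<dots> \<le> (\<Sum>k. ennreal ((1/2) ^ k))"
  proof (intro suminf_le)
    fix k
    have "(\<integral>\<^sup>+t. ennreal (2 ^ k * (cmod (d k t))\<^sup>2) \<partial>lborel) = ennreal (2 ^ k) * ennreal ((L2norm (d k))\<^sup>2)"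
      unfolding d_def nn_diff[symmetric]
      by (subst nn_integral_cmult[symmetric]) (auto simp: ennreal_mult)
    also have "\<dots> \<le> ennreal (2 ^ k * (1/4) ^ k)"
      using d_norm[of k] by (simp add: mult_left_mono flip: ennreal_mult)
    also have "2 ^ k * (1/4) ^ k = (1/2 :: real) ^ k"
      by (simp flip: power_mult_distrib)
    finally show "(\<integral>\<^sup>+t. ennreal (2 ^ k * (cmod (d k t))\<^sup>2) \<partial>lborel) \<le> ennreal ((1/2) ^ k)" .
  qed auto
  also have "\<dots> = ennreal (\<Sum>k. (1/2) ^ k)"
    by (rule suminf_ennreal2) (auto intro: summable_geometric)
  also have "\<dots> < \<infinity>" by simp
  finally have "(\<integral>\<^sup>+t. (\<Sum>k. ennreal (2 ^ k * (cmod (d k t))\<^sup>2)) \<partial>lborel) \<noteq> \<infinity>" by simp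
  then have "AE t in lborel. (\<Sum>k. ennreal (2 ^ k * (cmod (d k t))\<^sup>2)) \<noteq> \<infinity>"
    unfolding d_def by (intro nn_integral_PInf_AE) measurable
  then have conv: "AE t in lborel. convergent (\<lambda>k. g (r k) t)"
  proof eventually_elim
    fix t assume "(\<Sum>k. ennreal (2 ^ k * (cmod (d k t))\<^sup>2)) \<noteq> \<infinity>"
    then have "(\<Sum>k. ennreal (2 ^ k * (cmod (d k t))\<^sup>2)) < top"
      unfolding infinity_ennreal_def by (rule top.not_eq_extremum[THEN iffD1])
    then obtain C where C: "0 \<le> C" "(\<Sum>k. ennreal (2 ^ k * (cmod (d k t))\<^sup>2)) = ennreal C"
      unfolding less_top_ennreal by (elim exE conjE)
    have d_le: "cmod (d k t) \<le> sqrt C * (1 / sqrt 2) ^ k" for k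
    proof -
      have "ennreal (2 ^ k * (cmod (d k t))\<^sup>2) \<le> ennreal C"
      proof -
        have "(\<Sum>i\<in>{k}. ennreal (2 ^ i * (cmod (d i t))\<^sup>2)) \<le> (\<Sum>i. ennreal (2 ^ i * (cmod (d i t))\<^sup>2))"
          by (intro sum_le_suminf summableI) auto
        then show ?thesis unfolding C(2) by simp
      qed
      then have "2 ^ k * (cmod (d k t))\<^sup>2 \<le> C"
        using C by (simp add: ennreal_le_iff)
      then have "2 ^ k * (cmod (d k t))\<^sup>2 * (1 / 2) ^ k \<le> C * (1 / 2) ^ k"
        by (rule mult_right_mono) simp
      moreover have "2 ^ k * (1 / 2 :: real) ^ k = 1"
        by (simp flip: power_mult_distrib)
      then have "2 ^ k * (cmod (d k t))\<^sup>2 * (1 / 2) ^ k = (cmod (d k t))\<^sup>2"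
        by (metis mult.commute mult.left_commute mult_1)
      ultimately have "(cmod (d k t))\<^sup>2 \<le> C * (1 / 2) ^ k"
        by simp
      also have "\<dots> = (sqrt C * (1 / sqrt 2) ^ k)\<^sup>2"
      proof -
        have "((1 / sqrt 2) ^ k)\<^sup>2 = ((1 / sqrt 2)\<^sup>2) ^ k"
          unfolding power2_eq_square by (rule power_mult_distrib[symmetric])
        then show ?thesis
          using C(1) by (simp add: power_mult_distrib power_divide)
      qed
      finally show ?thesis
        by (rule power2_le_imp_le) (use C in simp)
    qed
    have "summable (\<lambda>k. sqrt C * (1 / sqrt 2) ^ k)"
      by (intro summable_mult summable_geometric) simp
    then have "summable (\<lambda>k. d k t)"
      by (rule summable_comparison_test'[where N=0]) (rule d_le)
    then have "convergent (\<lambda>n. \<Sum>k<n. d k t)"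
      by (simp add: summable_iff_convergent)
    moreover have "(\<Sum>k<n. d k t) = g (r n) t - g (r 0) t" for n
      unfolding d_def by (rule sum_lessThan_telescope)
    ultimately have "convergent (\<lambda>n. (g (r n) t - g (r 0) t) + g (r 0) t)"
      by (intro convergent_add convergent_const) simp
    then show "convergent (\<lambda>k. g (r k) t)" by simp
  qed
  \<comment> \<open>Where the subsequence diverges, \<open>lim\<close> has some unspecified value;
    this affects a null set only, and \<open>h\<close> is measurable all the same.\<close>
  define h where "h t = lim (\<lambda>k. g (r k) t)" for t
  have h_meas [measurable]: "h \<in> borel_measurable borel"
    unfolding h_def by measurable
  \<comment> \<open>Fatou along the subsequence: a bound on the distances from \<open>g n\<close> to
    all late terms passes to the distance from \<open>g n\<close> to \<open>h\<close>.\<close>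
  have bound: "(\<integral>\<^sup>+t. ennreal ((cmod (g n t - h t))\<^sup>2) \<partial>lborel) \<le> ennreal (e\<^sup>2)"
    if e: "\<And>m. N \<le> m \<Longrightarrow> L2norm (\<lambda>t. g n t - g m t) \<le> e" for n N e
  proof -
    have "(\<integral>\<^sup>+t. ennreal ((cmod (g n t - h t))\<^sup>2) \<partial>lborel)
        = (\<integral>\<^sup>+t. liminf (\<lambda>k. ennreal ((cmod (g n t - g (r k) t))\<^sup>2)) \<partial>lborel)"
    proof (rule nn_integral_cong_AE)
      show "AE t in lborel. ennreal ((cmod (g n t - h t))\<^sup>2) = liminf (\<lambda>k. ennreal ((cmod (g n t - g (r k) t))\<^sup>2))"
        using conv
      proof eventually_elim
        fix t assume "convergent (\<lambda>k. g (r k) t)"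
        then have "(\<lambda>k. g (r k) t) \<longlonglongrightarrow> h t"
          unfolding h_def by (simp add: convergent_LIMSEQ_iff)
        then have "(\<lambda>k. ennreal ((cmod (g n t - g (r k) t))\<^sup>2)) \<longlonglongrightarrow> ennreal ((cmod (g n t - h t))\<^sup>2)"
          by (intro tendsto_intros tendsto_ennrealI)
        then show "ennreal ((cmod (g n t - h t))\<^sup>2) = liminf (\<lambda>k. ennreal ((cmod (g n t - g (r k) t))\<^sup>2))"
          by (rule lim_imp_Liminf[symmetric, rotated]) simp
      qed
    qed
    also have "\<dots> \<le> liminf (\<lambda>k. \<integral>\<^sup>+t. ennreal ((cmod (g n t - g (r k) t))\<^sup>2) \<partial>lborel)"
      by (rule nn_integral_liminf) measurable
    also have "\<dots> = liminf (\<lambda>k. ennreal ((L2norm (\<lambda>t. g n t - g (r k) t))\<^sup>2))"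
      by (simp add: nn_diff)
    also have "\<dots> \<le> liminf (\<lambda>k. ennreal (e\<^sup>2))"
    proof (rule Liminf_mono)
      show "\<forall>\<^sub>F k in sequentially. ennreal ((L2norm (\<lambda>t. g n t - g (r k) t))\<^sup>2) \<le> ennreal (e\<^sup>2)"
        unfolding eventually_sequentially
      proof (intro exI[of _ N] allI impI)
        fix k assume "N \<le> k"
        then have "N \<le> r k" using r_ge order_trans by blast
        then show "ennreal ((L2norm (\<lambda>t. g n t - g (r k) t))\<^sup>2) \<le> ennreal (e\<^sup>2)"
          by (intro ennreal_leI power_mono e) auto
      qed
    qed
    also have "\<dots> = ennreal (e\<^sup>2)"
      by (simp add: Liminf_const)
    finally show ?thesis .
  qed
  have close: "square_integrable (\<lambda>t. g n t - h t)" "L2norm (\<lambda>t. g n t - h t) \<le> e"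
    if e: "0 \<le> e" "\<And>m. N \<le> m \<Longrightarrow> L2norm (\<lambda>t. g n t - g m t) \<le> e" for n N e
  proof -
    have b: "(\<integral>\<^sup>+t. ennreal ((cmod (g n t - h t))\<^sup>2) \<partial>lborel) \<le> ennreal (e\<^sup>2)"
      by (rule bound[OF e(2)])
    have i: "integrable lborel (\<lambda>t. (cmod (g n t - h t))\<^sup>2)"
    proof (rule integrableI_bounded)
      show "(\<integral>\<^sup>+t. ennreal (norm ((cmod (g n t - h t))\<^sup>2)) \<partial>lborel) < \<infinity>"
        using le_less_trans[OF b] by simp
    qed measurable
    then show "square_integrable (\<lambda>t. g n t - h t)"
      unfolding square_integrable_def by simp
    have "ennreal ((L2norm (\<lambda>t. g n t - h t))\<^sup>2) \<le> ennreal (e\<^sup>2)"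
      using b i by (simp add: nn_integral_eq_integral L2norm_square)
    then have "(L2norm (\<lambda>t. g n t - h t))\<^sup>2 \<le> e\<^sup>2" by simp
    then show "L2norm (\<lambda>t. g n t - h t) \<le> e"
      using e(1) by (rule power2_le_imp_le)
  qed
  have small: "\<exists>N. \<forall>n\<ge>N. square_integrable (\<lambda>t. g n t - h t) \<and> L2norm (\<lambda>t. g n t - h t) \<le> e" if "e > 0" for e
  proof -
    obtain N where N: "\<forall>m\<ge>N. \<forall>n\<ge>N. L2norm (\<lambda>t. g m t - g n t) < e"
      using Cauchy[OF \<open>e > 0\<close>] by blast
    then show ?thesis
      using \<open>e > 0\<close> by (intro exI[of _ N] allI impI conjI close[of e N]) (auto intro: less_imp_le)
  qed
  show ?thesis
  proof (rule that)
    obtain n where "square_integrable (\<lambda>t. g n t - h t)"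
      using small[of 1] by auto
    from square_integrable_diff[OF g this, of n] show "square_integrable h" by simp
    show "(\<lambda>n. L2norm (\<lambda>t. g n t - h t)) \<longlonglongrightarrow> 0"
    proof (rule LIMSEQ_I)
      fix e :: real assume "e > 0"
      then obtain N where "\<forall>n\<ge>N. L2norm (\<lambda>t. g n t - h t) \<le> e / 2"
        using small[of "e / 2"] by auto
      then show "\<exists>N. \<forall>n\<ge>N. norm (L2norm (\<lambda>t. g n t - h t) - 0) < e"
        using \<open>e > 0\<close> by (intro exI[of _ N]) (fastforce)
    qed
  qed
qed

text \<open>Supplies the witness for the choice in \<open>fourier_L2\<close>: by Plancherel the
  transforms of the truncations are as close as the truncations themselves, hence Cauchy, and L^2 is
  complete.\<close>

lemma fourier_L2_limit:
  assumes f: "square_integrable f"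
  shows "square_integrable (fourier_L2 f)"
    and "(\<lambda>N. L2norm (\<lambda>\<omega>. fourier (truncate N f) \<omega> - fourier_L2 f \<omega>)) \<longlonglongrightarrow> 0"
proof -
  note T = integrable_truncate[OF f] square_integrable_truncate[OF f]
  have dist: "L2norm (\<lambda>\<omega>. fourier (truncate m f) \<omega> - fourier (truncate n f) \<omega>)
      \<le> L2norm (\<lambda>t. truncate m f t - f t) + L2norm (\<lambda>t. truncate n f t - f t)" for m n
  proof -
    have "L2norm (\<lambda>\<omega>. fourier (truncate m f) \<omega> - fourier (truncate n f) \<omega>)
        = L2norm (fourier (\<lambda>t. truncate m f t - truncate n f t))"
      by (rule arg_cong[where f = L2norm], rule ext, rule fourier_diff[symmetric, OF T(1) T(1)])
    also have "\<dots> = L2norm (\<lambda>t. truncate m f t - truncate n f t)"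
      by (rule Plancherel(2)[OF Bochner_Integration.integrable_diff[OF T(1) T(1)] square_integrable_diff[OF T(2) T(2)]])
    also have "\<dots> = L2norm (\<lambda>t. (truncate m f t - f t) + (f t - truncate n f t))"
      by simp
    also have "\<dots> \<le> L2norm (\<lambda>t. truncate m f t - f t) + L2norm (\<lambda>t. f t - truncate n f t)"
      by (intro L2norm_triangle square_integrable_diff T f)
    finally show ?thesis
      by (simp only: L2norm_minus_commute[of f])
  qed
  have "\<exists>g. square_integrable g \<and> (\<lambda>N. L2norm (\<lambda>\<omega>. fourier (truncate N f) \<omega> - g \<omega>)) \<longlonglongrightarrow> 0"
  proof (rule L2_complete[of "\<lambda>N. fourier (truncate N f)"])
    show "square_integrable (fourier (truncate n f))" for n
      by (rule Plancherel(1)[OF T])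
    fix e :: real assume "e > 0"
    then obtain N where N: "\<And>n. n \<ge> N \<Longrightarrow> norm (L2norm (\<lambda>t. truncate n f t - f t) - 0) < e / 2"
      using LIMSEQ_D[OF truncate_tendsto_L2[OF f], of "e / 2"] by auto
    show "\<exists>N. \<forall>m\<ge>N. \<forall>n\<ge>N. L2norm (\<lambda>\<omega>. fourier (truncate m f) \<omega> - fourier (truncate n f) \<omega>) < e"
    proof (intro exI[of _ N] allI impI)
      fix m n assume "m \<ge> N" "n \<ge> N"
      then show "L2norm (\<lambda>\<omega>. fourier (truncate m f) \<omega> - fourier (truncate n f) \<omega>) < e"
        using dist[of m n] N[of m] N[of n] by simp
    qed
  qed blast
  from someI_ex[OF this]
  show "square_integrable (fourier_L2 f)"
    and "(\<lambda>N. L2norm (\<lambda>\<omega>. fourier (truncate N f) \<omega> - fourier_L2 f \<omega>)) \<longlonglongrightarrow> 0"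
    unfolding fourier_L2_def by blast+
qed

section \<open>Limits along truncations of a square integrable signal\<close>

lemma L2norm_convolution_tendsto:
  assumes f: "square_integrable f" and g: "integrable lborel g" "square_integrable g"
  shows "(\<lambda>N. L2norm (truncate N f \<star> g)) \<longlonglongrightarrow> L2norm (f \<star> g)"
proof (rule L2norm_tendsto)
  note T = square_integrable_truncate[OF f]
  show "square_integrable (truncate N f \<star> g)" for N by (rule Young_L2(1)[OF T g(1)])
  show "square_integrable (f \<star> g)" by (rule Young_L2(1)[OF f g(1)])
  show "(\<lambda>N. L2norm (\<lambda>t. (truncate N f \<star> g) t - (f \<star> g) t)) \<longlonglongrightarrow> 0"
  proof (rule Lim_null_comparison[OF always_eventually])
    show "\<forall>N. norm (L2norm (\<lambda>t. (truncate N f \<star> g) t - (f \<star> g) t))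
        \<le> (LINT t|lborel. cmod (g t)) * L2norm (\<lambda>t. truncate N f t - f t)"
      using Young_L2(2)[OF square_integrable_diff[OF T f] g(1)]
      by (simp add: convolution_diff_left[OF T f g(2)])
    show "(\<lambda>N. (LINT t|lborel. cmod (g t)) * L2norm (\<lambda>t. truncate N f t - f t)) \<longlonglongrightarrow> 0"
      using tendsto_mult[OF tendsto_const truncate_tendsto_L2[OF f], of "LINT t|lborel. cmod (g t)"] by simp
  qed
qed

lemma square_integrable_gaussian:
  assumes "b > 0" shows "square_integrable (gaussian b)"
proof -
  have "integrable lborel (\<lambda>t. (sqrt pi * b)\<^sup>2 * exp (- (2 * (pi * b)\<^sup>2 * t\<^sup>2)))"
    using integrable_exp_quadratic[of "2 * (pi * b)\<^sup>2"] assms by simp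
  moreover have "(cmod (gaussian b t))\<^sup>2 = (sqrt pi * b)\<^sup>2 * exp (- (2 * (pi * b)\<^sup>2 * t\<^sup>2))" for t
    by (simp add: gaussian_def norm_mult power_mult_distrib flip: exp_double)
  ultimately show ?thesis
    using integrable_gaussian[OF assms] by (simp add: square_integrable_def)
qed

lemma gaussian_energy_identity_L1:
  assumes f: "integrable lborel f" "square_integrable f" and b: "b > 0"
  shows "(L2norm f)\<^sup>2 - (L2norm (f \<star> gaussian b))\<^sup>2
    = (LINT \<omega>|lborel. (cmod (fourier f \<omega>))\<^sup>2 * (1 - exp (- 2 * (\<omega> / b)\<^sup>2)))"
proof -
  have e: "(cmod (fourier (gaussian b) \<omega>))\<^sup>2 = exp (- 2 * (\<omega> / b)\<^sup>2)" for \<omega>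
    by (simp add: fourier_gaussian[OF b] flip: exp_double)
  have "(L2norm (f \<star> gaussian b))\<^sup>2 = (LINT \<omega>|lborel. (cmod (fourier f \<omega>))\<^sup>2 * exp (- 2 * (\<omega> / b)\<^sup>2))"
    unfolding L2norm_convolution[OF f integrable_gaussian[OF b]] e ..
  moreover have "integrable lborel (\<lambda>\<omega>. (cmod (fourier f \<omega>))\<^sup>2 * exp (- 2 * (\<omega> / b)\<^sup>2))"
    by (rule integrable_fourier_square[OF f, of _ 1]) auto
  ultimately show ?thesis
    using Plancherel[OF f] by (simp add: right_diff_distrib square_integrable_def L2norm_square[symmetric])
qed

text \<open>Truncations satisfy the identity already. Both sides converge along them, and uniqueness
  of limits gives it for \<open>f\<close>.\<close>

lemma gaussian_energy_identity:
  assumes f: "square_integrable f" and b: "b > 0"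
  shows "(L2norm f)\<^sup>2 - (L2norm (f \<star> gaussian b))\<^sup>2
    = (LINT \<omega>|lborel. (cmod (fourier_L2 f \<omega>))\<^sup>2 * (1 - (cmod (fourier (gaussian b) \<omega>))\<^sup>2))"
proof (rule LIMSEQ_unique)
  note T = integrable_truncate[OF f] square_integrable_truncate[OF f]
  note FL = fourier_L2_limit[OF f]
  \<comment> \<open>The square root of the weight, so that weighted energy becomes the L^2 norm of a
    product. Multiplication by \<open>s\<close> does not increase that norm, hence it preserves the
    convergence to \<open>fourier_L2 f\<close>.\<close>
  define s where "s \<omega> = complex_of_real (sqrt (1 - exp (- 2 * (\<omega> / b)\<^sup>2)))" for \<omega>
  have s_le: "cmod (s \<omega>) \<le> 1" for \<omega> by (simp add: s_def)
  have [measurable]: "s \<in> borel_measurable borel" unfolding s_def by measurable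
  have sq: "(cmod (g \<omega> * s \<omega>))\<^sup>2 = (cmod (g \<omega>))\<^sup>2 * (1 - exp (- 2 * (\<omega> / b)\<^sup>2))" for g \<omega>
    by (simp add: s_def norm_mult power_mult_distrib)
  have si: "square_integrable (\<lambda>\<omega>. g \<omega> * s \<omega>)" if "square_integrable g" for g
    using that s_le by (intro square_integrable_bound[OF _ that, of _ 1]) (auto simp: norm_mult mult_left_le square_integrable_def)
  show "(\<lambda>N. (L2norm (truncate N f))\<^sup>2 - (L2norm (truncate N f \<star> gaussian b))\<^sup>2)
      \<longlonglongrightarrow> (L2norm f)\<^sup>2 - (L2norm (f \<star> gaussian b))\<^sup>2"
    by (intro tendsto_intros L2norm_tendsto[OF T(2) f truncate_tendsto_L2[OF f]]
        L2norm_convolution_tendsto f integrable_gaussian square_integrable_gaussian b)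
  have "(\<lambda>N. L2norm (\<lambda>\<omega>. fourier (truncate N f) \<omega> * s \<omega>)) \<longlonglongrightarrow> L2norm (\<lambda>\<omega>. fourier_L2 f \<omega> * s \<omega>)"
  proof (rule L2norm_tendsto)
    show "square_integrable (\<lambda>\<omega>. fourier (truncate N f) \<omega> * s \<omega>)" for N
      by (rule si[OF Plancherel(1)[OF T]])
    show "square_integrable (\<lambda>\<omega>. fourier_L2 f \<omega> * s \<omega>)" by (rule si[OF FL(1)])
    show "(\<lambda>N. L2norm (\<lambda>t. fourier (truncate N f) t * s t - fourier_L2 f t * s t)) \<longlonglongrightarrow> 0"
    proof (rule Lim_null_comparison[OF always_eventually FL(2)], rule allI)
      fix N
      have D: "square_integrable (\<lambda>t. fourier (truncate N f) t - fourier_L2 f t)"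
        by (rule square_integrable_diff[OF Plancherel(1)[OF T] FL(1)])
      have "L2norm (\<lambda>t. (fourier (truncate N f) t - fourier_L2 f t) * s t)
          \<le> L2norm (\<lambda>t. fourier (truncate N f) t - fourier_L2 f t)"
        using si[OF D] s_le by (intro L2norm_mono D) (auto simp: norm_mult mult_left_le square_integrable_def)
      then show "norm (L2norm (\<lambda>t. fourier (truncate N f) t * s t - fourier_L2 f t * s t))
          \<le> L2norm (\<lambda>t. fourier (truncate N f) t - fourier_L2 f t)"
        by (simp add: left_diff_distrib)
    qed
  qed
  from tendsto_power[OF this, of 2]
  have "(\<lambda>N. LINT \<omega>|lborel. (cmod (fourier (truncate N f) \<omega>))\<^sup>2 * (1 - exp (- 2 * (\<omega> / b)\<^sup>2)))
      \<longlonglongrightarrow> (LINT \<omega>|lborel. (cmod (fourier_L2 f \<omega>))\<^sup>2 * (1 - exp (- 2 * (\<omega> / b)\<^sup>2)))"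
    by (simp only: L2norm_square sq)
  moreover have "(cmod (fourier (gaussian b) \<omega>))\<^sup>2 = exp (- 2 * (\<omega> / b)\<^sup>2)" for \<omega>
    by (simp add: fourier_gaussian[OF b] flip: exp_double)
  ultimately show "(\<lambda>N. (L2norm (truncate N f))\<^sup>2 - (L2norm (truncate N f \<star> gaussian b))\<^sup>2)
    \<longlonglongrightarrow> (LINT \<omega>|lborel. (cmod (fourier_L2 f \<omega>))\<^sup>2 * (1 - (cmod (fourier (gaussian b) \<omega>))\<^sup>2))"
    by (simp only: gaussian_energy_identity_L1[OF T b])
qed

section \<open>The energy bound for all real square integrable signals\<close>

context wavelet
begin

text \<open>Each layer is Lipschitz: Young's inequality controls the convolution and the reverse
  triangle inequality the modulus. The constant may depend on the path, which is harmless because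
  only finitely many paths pass to the limit at once.\<close>

lemma scatter_L2_continuous:
  "\<exists>C\<ge>0. \<forall>f g. square_integrable f \<longrightarrow> square_integrable g \<longrightarrow>
    square_integrable (scatter \<psi> p f) \<and>
    L2norm (\<lambda>t. scatter \<psi> p f t - scatter \<psi> p g t) \<le> C * L2norm (\<lambda>t. f t - g t)"
proof (induction p)
  case Nil
  show ?case by (intro exI[of _ 1]) (simp add: scatter_Nil)
next
  case (Cons j p)
  then obtain C where C: "C \<ge> 0" "\<And>f g. square_integrable f \<Longrightarrow> square_integrable g \<Longrightarrow>
    square_integrable (scatter \<psi> p f) \<and>
    L2norm (\<lambda>t. scatter \<psi> p f t - scatter \<psi> p g t) \<le> C * L2norm (\<lambda>t. f t - g t)"
    by blast
  define A where "A = (LINT t|lborel. cmod (dilate \<psi> j t))"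
  have A: "A \<ge> 0" by (simp add: A_def)
  note ij = integrable_dilate[OF int_psi, of j] and sj = square_integrable_dilate[OF sq_psi, of j]
  show ?case
  proof (intro exI[of _ "C * A"] conjI allI impI)
    show "0 \<le> C * A" using C A by simp
    fix f g assume f: "square_integrable f" and g: "square_integrable g"
    have lf: "square_integrable (layer j f)" and lg: "square_integrable (layer j g)"
      unfolding layer_def by (intro square_integrable_cmod Young_L2(1) f g ij)+
    have sc: "scatter \<psi> (j # p) u = scatter \<psi> p (layer j u)" for u
      by (simp add: scatter_Cons layer_def)
    show "square_integrable (scatter \<psi> (j # p) f)"
      using C(2)[OF lf lf] by (simp add: sc)
    have "L2norm (\<lambda>t. layer j f t - layer j g t) \<le> L2norm (\<lambda>t. (f \<star> dilate \<psi> j) t - (g \<star> dilate \<psi> j) t)"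
    proof (rule L2norm_mono)
      show "(\<lambda>t. layer j f t - layer j g t) \<in> borel_measurable lborel"
        using square_integrable_diff[OF lf lg] by (simp add: square_integrable_def)
      show "square_integrable (\<lambda>t. (f \<star> dilate \<psi> j) t - (g \<star> dilate \<psi> j) t)"
        by (intro square_integrable_diff Young_L2(1) f g ij)
      show "cmod (layer j f t - layer j g t) \<le> cmod ((f \<star> dilate \<psi> j) t - (g \<star> dilate \<psi> j) t)" for t
        unfolding layer_def of_real_diff[symmetric] norm_of_real by (rule norm_triangle_ineq3)
    qed
    also have "\<dots> \<le> A * L2norm (\<lambda>t. f t - g t)"
      using Young_L2(2)[OF square_integrable_diff[OF f g] ij] unfolding convolution_diff_left[OF f g sj] A_def .
    finally have "C * L2norm (\<lambda>t. layer j f t - layer j g t) \<le> C * (A * L2norm (\<lambda>t. f t - g t))"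
      using C(1) by (rule mult_left_mono)
    then show "L2norm (\<lambda>t. scatter \<psi> (j # p) f t - scatter \<psi> (j # p) g t) \<le> C * A * L2norm (\<lambda>t. f t - g t)"
      using C(2)[OF lf lg] by (simp add: sc mult.assoc)
  qed
qed

lemma scatter_truncate_tendsto:
  assumes f: "square_integrable f"
  shows "(\<lambda>N. L2norm (scatter \<psi> p (truncate N f))) \<longlonglongrightarrow> L2norm (scatter \<psi> p f)"
proof -
  obtain C where C: "\<And>f g. square_integrable f \<Longrightarrow> square_integrable g \<Longrightarrow>
    square_integrable (scatter \<psi> p f) \<and>
    L2norm (\<lambda>t. scatter \<psi> p f t - scatter \<psi> p g t) \<le> C * L2norm (\<lambda>t. f t - g t)"
    using scatter_L2_continuous[of p] by blast
  note T = square_integrable_truncate[OF f]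
  show ?thesis
  proof (rule L2norm_tendsto)
    show "square_integrable (scatter \<psi> p (truncate N f))" for N using C[OF T T] by blast
    show "square_integrable (scatter \<psi> p f)" using C[OF f f] by blast
    show "(\<lambda>N. L2norm (\<lambda>t. scatter \<psi> p (truncate N f) t - scatter \<psi> p f t)) \<longlonglongrightarrow> 0"
    proof (rule Lim_null_comparison[OF always_eventually])
      show "\<forall>N. norm (L2norm (\<lambda>t. scatter \<psi> p (truncate N f) t - scatter \<psi> p f t))
          \<le> C * L2norm (\<lambda>t. truncate N f t - f t)"
        using C[OF T f] by simp
      show "(\<lambda>N. C * L2norm (\<lambda>t. truncate N f t - f t)) \<longlonglongrightarrow> 0"
        using tendsto_mult[OF tendsto_const truncate_tendsto_L2[OF f], of C] by simp
    qed
  qed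
qed

text \<open>For fixed n and F the left side is a finite sum, so the inequality for truncations
  passes to the limit term by term; \<open>r\<close> and \<open>a\<close> are fixed before the
  signal.\<close>

lemma scatter_energy_bound:
  obtains r a where "r > 0" "a > 1"
    "\<forall>n\<ge>2. \<forall>F f. finite F \<longrightarrow> F \<subseteq> {..J} \<longrightarrow> square_integrable f \<longrightarrow> (\<forall>t. f t \<in> \<real>) \<longrightarrow>
      (\<Sum>p\<in>{p. set p \<subseteq> F \<and> length p = n}. (L2norm (scatter \<psi> p f))\<^sup>2)
      \<le> (L2norm f)\<^sup>2 - (L2norm (f \<star> gaussian (r * a ^ n)))\<^sup>2"
proof (rule scatter_energy_signal[of J])
  fix r a :: real assume r: "r > 0" "a > 1"
    and bound: "\<And>n F f. n \<ge> 2 \<Longrightarrow> finite F \<Longrightarrow> F \<subseteq> {..J} \<Longrightarrow> signal f \<Longrightarrow>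
      (\<Sum>p\<in>{p. set p \<subseteq> F \<and> length p = n}. (L2norm (scatter \<psi> p f))\<^sup>2)
      \<le> (LINT \<omega>|lborel. (cmod (fourier f \<omega>))\<^sup>2 * (1 - exp (- 2 * (\<omega> / (r * a ^ n))\<^sup>2)))"
  show ?thesis
  proof (rule that[OF r], intro allI impI)
    fix n F f
    assume n: "(2::nat) \<le> n" and F: "finite F" "F \<subseteq> {..J}" and f: "square_integrable f" and re: "\<forall>t. f t \<in> \<real>"
    have b: "r * a ^ n > 0" using r by simp
    note T = integrable_truncate[OF f] square_integrable_truncate[OF f]
    show "(\<Sum>p\<in>{p. set p \<subseteq> F \<and> length p = n}. (L2norm (scatter \<psi> p f))\<^sup>2)
      \<le> (L2norm f)\<^sup>2 - (L2norm (f \<star> gaussian (r * a ^ n)))\<^sup>2"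
    proof (rule LIMSEQ_le)
      show "(\<lambda>N. \<Sum>p\<in>{p. set p \<subseteq> F \<and> length p = n}. (L2norm (scatter \<psi> p (truncate N f)))\<^sup>2)
        \<longlonglongrightarrow> (\<Sum>p\<in>{p. set p \<subseteq> F \<and> length p = n}. (L2norm (scatter \<psi> p f))\<^sup>2)"
        by (intro tendsto_intros scatter_truncate_tendsto f)
      show "(\<lambda>N. (L2norm (truncate N f))\<^sup>2 - (L2norm (truncate N f \<star> gaussian (r * a ^ n)))\<^sup>2)
        \<longlonglongrightarrow> (L2norm f)\<^sup>2 - (L2norm (f \<star> gaussian (r * a ^ n)))\<^sup>2"
        by (intro tendsto_intros L2norm_tendsto[OF T(2) f truncate_tendsto_L2[OF f]]
            L2norm_convolution_tendsto f integrable_gaussian square_integrable_gaussian b)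
      have "signal (truncate N f)" for N
        using T re by (auto simp: signal_def indicator_def)
      then show "\<exists>N. \<forall>M\<ge>N. (\<Sum>p\<in>{p. set p \<subseteq> F \<and> length p = n}. (L2norm (scatter \<psi> p (truncate M f)))\<^sup>2)
        \<le> (L2norm (truncate M f))\<^sup>2 - (L2norm (truncate M f \<star> gaussian (r * a ^ n)))\<^sup>2"
        unfolding gaussian_energy_identity_L1[OF T b] using bound[OF n F] by blast
    qed
  qed
qed

end

theorem theorem3p1:
  fixes \<psi> :: "real \<Rightarrow> complex" and J :: int
  assumes "integrable lborel \<psi>"
    and "square_integrable \<psi>"
    and "(LINT t|lborel. \<psi> t) = 0"
    and "\<And>\<omega>::real.
        (\<lambda>j::int. (cmod (fourier (dilate \<psi> j) \<omega>))\<^sup>2 + (cmod (fourier (dilate \<psi> j) (- \<omega>)))\<^sup>2)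
          summable_on UNIV \<and>
        1 / 2 * (\<Sum>\<^sub>\<infinity>j::int. (cmod (fourier (dilate \<psi> j) \<omega>))\<^sup>2
                            + (cmod (fourier (dilate \<psi> j) (- \<omega>)))\<^sup>2) \<le> 1"
    and "\<And>(j::int) (\<omega>::real). \<omega> > 0 \<Longrightarrow>
        cmod (fourier (dilate \<psi> j) (- \<omega>)) \<le> cmod (fourier (dilate \<psi> j) \<omega>)"
    and "\<And>\<omega>::real. \<omega> > 0 \<Longrightarrow>
        \<exists>j::int. cmod (fourier (dilate \<psi> j) (- \<omega>)) < cmod (fourier (dilate \<psi> j) \<omega>)"
    and "\<exists>\<epsilon>>0. (\<lambda>\<omega>. cmod (fourier \<psi> \<omega>)) \<in> O[at 0](\<lambda>\<omega>::real. \<bar>\<omega>\<bar> powr (1 + \<epsilon>))"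
  shows "\<exists>r>0. \<exists>a>1. \<forall>n\<ge>2. \<forall>f :: real \<Rightarrow> complex.
      square_integrable f \<and> (\<forall>t. f t \<in> \<real>) \<longrightarrow>
        (\<lambda>p. (L2norm (scatter \<psi> p f))\<^sup>2) summable_on {p \<in> paths J. length p = n} \<and>
        (\<Sum>\<^sub>\<infinity>p\<in>{p \<in> paths J. length p = n}. (L2norm (scatter \<psi> p f))\<^sup>2)
          \<le> (L2norm f)\<^sup>2 - (L2norm (f \<star> gaussian (r * a ^ n)))\<^sup>2 \<and>
        (L2norm f)\<^sup>2 - (L2norm (f \<star> gaussian (r * a ^ n)))\<^sup>2
          = (LINT \<omega>|lborel. (cmod (fourier_L2 f \<omega>))\<^sup>2
               * (1 - (cmod (fourier (gaussian (r * a ^ n)) \<omega>))\<^sup>2))"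
proof -
  have lp: "littlewood_paley (\<lambda>\<omega>. cmod (fourier \<psi> \<omega>))"
  proof
    show "continuous_on UNIV (\<lambda>\<omega>. cmod (fourier \<psi> \<omega>))"
      by (intro continuous_intros continuous_fourier assms(1))
    show "cmod (fourier \<psi> (- u)) \<le> cmod (fourier \<psi> u)" if "u > 0" for u
      using assms(5)[OF that, of 0] by (simp add: fourier_dilate)
    show "\<exists>j::int. cmod (fourier \<psi> (- (2 powi j * \<omega>))) < cmod (fourier \<psi> (2 powi j * \<omega>))" if "\<omega> > 0" for \<omega>
      using assms(6)[OF that] by (simp add: fourier_dilate)
    show "1 / 2 * (\<Sum>j\<in>F. (cmod (fourier \<psi> (2 powi j * \<omega>)))\<^sup>2 + (cmod (fourier \<psi> (- (2 powi j * \<omega>))))\<^sup>2) \<le> 1"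
      if "finite F" for F \<omega>
    proof -
      have "(\<Sum>j\<in>F. (cmod (fourier (dilate \<psi> j) \<omega>))\<^sup>2 + (cmod (fourier (dilate \<psi> j) (- \<omega>)))\<^sup>2)
          \<le> (\<Sum>\<^sub>\<infinity>j. (cmod (fourier (dilate \<psi> j) \<omega>))\<^sup>2 + (cmod (fourier (dilate \<psi> j) (- \<omega>)))\<^sup>2)"
        using assms(4)[of \<omega>] that by (intro finite_sum_le_infsum) auto
      then show ?thesis
        using assms(4)[of \<omega>] by (simp add: fourier_dilate)
    qed
  qed (use assms(7) in auto)
  interpret wavelet \<psi>
    by (intro wavelet.intro assms(1,2) lp)
  obtain r a where r: "r > 0" "a > 1" and bound:
    "\<forall>n\<ge>2. \<forall>F f. finite F \<longrightarrow> F \<subseteq> {..J} \<longrightarrow> square_integrable f \<longrightarrow> (\<forall>t. f t \<in> \<real>) \<longrightarrow>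
      (\<Sum>p\<in>{p. set p \<subseteq> F \<and> length p = n}. (L2norm (scatter \<psi> p f))\<^sup>2)
      \<le> (L2norm f)\<^sup>2 - (L2norm (f \<star> gaussian (r * a ^ n)))\<^sup>2"
    using scatter_energy_bound[of J] .
  show ?thesis
  proof (rule exI[of _ r], rule conjI[OF r(1)], rule exI[of _ a], rule conjI[OF r(2)], intro allI impI, elim conjE)
    fix n and f :: "real \<Rightarrow> complex"
    assume n: "(2::nat) \<le> n" and f: "square_integrable f" "\<forall>t. f t \<in> \<real>"
    let ?W = "{p \<in> paths J. length p = n}"
    let ?B = "(L2norm f)\<^sup>2 - (L2norm (f \<star> gaussian (r * a ^ n)))\<^sup>2"
    have fin: "(\<Sum>p\<in>P. (L2norm (scatter \<psi> p f))\<^sup>2) \<le> ?B" if P: "finite P" "P \<subseteq> ?W" for P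
    proof -
      \<comment> \<open>The scales occurring in \<open>P\<close> form a finite alphabet, so the sum
        over \<open>P\<close> is dominated by the sum over all words of length n in it. The
        resulting bound is the same for every finite \<open>P\<close>, which gives summability as
        well as the estimate.\<close>
      define F where "F = (\<Union>p\<in>P. set p)"
      have F: "finite F" "F \<subseteq> {..J}"
        using P by (auto simp: F_def paths_def)
      have "(\<Sum>p\<in>P. (L2norm (scatter \<psi> p f))\<^sup>2) \<le> (\<Sum>p\<in>{p. set p \<subseteq> F \<and> length p = n}. (L2norm (scatter \<psi> p f))\<^sup>2)"
        using P by (intro sum_mono2 finite_words F(1)) (auto simp: F_def)
      also have "\<dots> \<le> ?B"
        using bound n F f by blast
      finally show ?thesis .
    qed
    have summ: "(\<lambda>p. (L2norm (scatter \<psi> p f))\<^sup>2) summable_on ?W"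
    proof (rule nonneg_bdd_above_summable_on)
      show "bdd_above (sum (\<lambda>p. (L2norm (scatter \<psi> p f))\<^sup>2) ` {F. F \<subseteq> ?W \<and> finite F})"
        using fin by (intro bdd_aboveI[of _ ?B]) auto
    qed simp
    moreover have "(\<Sum>\<^sub>\<infinity>p\<in>?W. (L2norm (scatter \<psi> p f))\<^sup>2) \<le> ?B"
      by (rule infsum_le_finite_sums[OF summ]) (use fin in auto)
    moreover have "?B = (LINT \<omega>|lborel. (cmod (fourier_L2 f \<omega>))\<^sup>2
               * (1 - (cmod (fourier (gaussian (r * a ^ n)) \<omega>))\<^sup>2))"
      using r by (intro gaussian_energy_identity f(1)) simp
    ultimately show "(\<lambda>p. (L2norm (scatter \<psi> p f))\<^sup>2) summable_on ?W \<and>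
        (\<Sum>\<^sub>\<infinity>p\<in>?W. (L2norm (scatter \<psi> p f))\<^sup>2) \<le> ?B \<and>
        ?B = (LINT \<omega>|lborel. (cmod (fourier_L2 f \<omega>))\<^sup>2
               * (1 - (cmod (fourier (gaussian (r * a ^ n)) \<omega>))\<^sup>2))"
      by blast
  qed
qed

end
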